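(* Let $M$ be a manifold with base point $m_0$ such that $\pi_1(M)=\pi_1(M,m_0)$ has no element of order two. Then $\Gamma(M)=\{\Gamma(\alpha,\beta)\}_{\alpha,\beta\in\pi_1(M)}$, with the operations $m,P,Q$ described in the context, is a $\Delta$-group based at $\pi_1(M)$. Moreover, if $f:M\to N$ is a (continuous, base-point preserving) map between two such manifolds, then the induced map $f^*:\Gamma(M)\to\Gamma(N)$ is a morphism of $\Delta$-groups.
   Context: **$\Delta$-groups.** Let $G$ be a group. A $\Delta$-group based at $G$ is a collection of sets $T=\{T(g,h)\}_{g,h\in G}$ with operations, for all $g,h,k\in G$, $$m:T(g,h^{-1})\times T(h,k^{-1})\times T(h^{-1}g,k^{-1}h)\to T(g,k^{-1}),$$ $$P:T(g,h)\to T(h,g^{-1}h^{-1}),\qquad Q:T(g,h)\to T(g^{-1},hg),$$ such that, whenever the expressions are defined, (1) $P^3=\mathrm{id}$, $Q^2=\mathrm{id}$, $P^2Q=QP$; (2) $P(m(a,b,c))=m(P(b),P(c),P(a))$; (3) $Q(m(a,b,c))=m(Q(a),Q(c),Q(b))$; (4) $m(m(a,b,c),d,e)=m(a,m(b,d,f),m(c,Q(f),e))$, for $a\in T(g,h^{-1})$, $b\in T(h,k^{-1})$, $c\in T(h^{-1}g,k^{-1}h)$, $d\in T(k,l^{-1})$, $e\in T(k^{-1}g,l^{-1}k)$, $f\in T(k^{-1}h,l^{-1}k)$; (5) $m(m(f,a,b),P^2Q(a),PQ(b))=f$, for $f\in T(g,h^{-1})$, $a\in T(h,k^{-1})$, $b\in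 T(h^{-1}g,k^{-1}h)$. A morphism from a $\Delta$-group $T$ based at $G$ to a $\Delta$-group $T'$ based at $G'$ consists of a group homomorphism $\varphi:G\to G'$ and maps $T(g,h)\to T'(\varphi(g),\varphi(h))$ commuting with $m$, $P$ and $Q$. **Construction of $\Gamma(M)$.** The product $gh$ in $\pi_1(M)$ is "$g$ followed by $h$". Fix a section $s$ assigning to each class in $\pi_1(M)$ a loop at $m_0$ representing it, such that $s(\alpha^{-1})$ is the reverse path $t\mapsto s(\alpha)(1-t)$ and $s(1)$ is the constant loop. We identify $\alpha\in\pi_1(M)$ with the loop $s(\alpha)$; thus $\beta\alpha$ as a loop means the chosen representative of the product $\beta\alpha$ in $\pi_1(M)$. Let $\Delta_2=\{(x_0,x_1,x_2): x_i\ge 0,\ \sum x_i=1\}$ with vertices $[0],[1],[2]$, and similarly $\Delta_3$. For a map $a$ on a simplex, $a_{|[i,j]}$ denotes the path obtained by restricting $a$ to the edge traversed from vertex $[i]$ to vertex $[j]$; for a map $\omega$ on $\Delta_3$, $\omega_{|[i,j,l]}$ denotes the map on $\Delta_2$ obtained by composing $\omega$ with the affine map sending $[0],[1],[2]$ to $[i],[j],[l]$. $\Gamma(\alpha,\beta)$ is the set of homotopy classes, relative to the boundary $\partial\Delta_2$, of continuous maps $a:\Delta_2\to M$ with $a_{|[1,0]}=\alpha$, $a_{|[2,1]}=\beta$, $a_{|[2,0]}=\beta\alpha$. Operations: - $P(a)=a\circ p$ with $p(x_0,x_1,x_2)=(x_2,x_0,x_1)$; - $Q(a)=a\circ q$ with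 $q(x_0,x_1,x_2)=(x_1,x_0,x_2)$; - for $a\in\Gamma(\alpha,\beta^{-1})$, $b\in\Gamma(\beta,\gamma^{-1})$, $c\in\Gamma(\beta^{-1}\alpha,\gamma^{-1}\beta)$, choose a map $\omega:\Delta_3\to M$ with $\omega_{|[1,2,0]}=a$, $\omega_{|[0,2,3]}=b$, $\omega_{|[1,0,3]}=c$ (such $\omega$ exists by gluing the three faces and extending) and set $m(a,b,c)=\omega_{|[1,2,3]}\in\Gamma(\alpha,\gamma^{-1})$, whose class is well defined. **Induced map.** Let $f:M\to N$ be as in the claim, with induced homomorphism $f_*:\pi_1(M)\to\pi_1(N)$ and chosen sections $s_M$, $s_N$. Choose for each $g\in\pi_1(M)$ a homotopy $H_g$ of loops (relative to endpoints) from $f\circ s_M(g)$ to $s_N(f_*g)$, with $H_{g^{-1}}(t,\tau)=H_g(1-t,\tau)$ and $H_1$ constant. For $a\in\Gamma(\alpha,\beta)$, $f^*(a)\in\Gamma(f_*\alpha,f_*\beta)$ is the class of $F(\cdot,1)$, where $F:\Delta_2\times[0,1]\to N$ is any homotopy with $F(\cdot,0)=f\circ a$ whose restrictions to the edges $[1,0]$, $[2,1]$, $[2,0]$ are $H_\alpha,H_\beta,H_{\beta\alpha}$ respectively. *)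

theory Defs
  imports "HOL-Analysis.Analysis" "HOL-Homology.Homology" "HOL-Algebra.Multiplicative_Group"
begin

section \<open>Delta-groups\<close>

text \<open>
  The sets \<open>T(g,h)\<close> of a family need not be disjoint, so every operation carries the group
  elements that index its domain.
\<close>

record ('g, 't) delta_ops =
  cells :: "'g \<Rightarrow> 'g \<Rightarrow> 't set"
  mop :: "'g \<Rightarrow> 'g \<Rightarrow> 'g \<Rightarrow> 't \<Rightarrow> 't \<Rightarrow> 't \<Rightarrow> 't"
  Pop :: "'g \<Rightarrow> 'g \<Rightarrow> 't \<Rightarrow> 't"
  Qop :: "'g \<Rightarrow> 'g \<Rightarrow> 't \<Rightarrow> 't"

text \<open>
  \<open>mop D g h k\<close> is the operation on \<open>T(g,h\<inverse>) \<times> T(h,k\<inverse>) \<times> T(h\<inverse>g,k\<inverse>h)\<close>, while \<open>Pop D g h\<close> and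
  \<open>Qop D g h\<close> act on \<open>T(g,h)\<close>.  In the axioms the indices of the nested operations are simplified
  by the group laws; they are forced by the sets containing the arguments.
\<close>

locale delta_group = group G for G :: "('g, 'm) monoid_scheme" (structure) +
  fixes D :: "('g, 't) delta_ops"
  assumes m_closed_cells:
    "\<lbrakk>g \<in> carrier G; h \<in> carrier G; k \<in> carrier G;
      a \<in> cells D g (inv h); b \<in> cells D h (inv k); c \<in> cells D (inv h \<otimes> g) (inv k \<otimes> h)\<rbrakk>
     \<Longrightarrow> mop D g h k a b c \<in> cells D g (inv k)"
  and P_closed_cells:
    "\<lbrakk>g \<in> carrier G; h \<in> carrier G; x \<in> cells D g h\<rbrakk>
     \<Longrightarrow> Pop D g h x \<in> cells D h (inv g \<otimes> inv h)"
  and Q_closed_cells: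
    "\<lbrakk>g \<in> carrier G; h \<in> carrier G; x \<in> cells D g h\<rbrakk>
     \<Longrightarrow> Qop D g h x \<in> cells D (inv g) (h \<otimes> g)"
  and P_cubed:
    "\<lbrakk>g \<in> carrier G; h \<in> carrier G; x \<in> cells D g h\<rbrakk>
     \<Longrightarrow> Pop D (inv g \<otimes> inv h) g (Pop D h (inv g \<otimes> inv h) (Pop D g h x)) = x"
  and Q_squared:
    "\<lbrakk>g \<in> carrier G; h \<in> carrier G; x \<in> cells D g h\<rbrakk>
     \<Longrightarrow> Qop D (inv g) (h \<otimes> g) (Qop D g h x) = x"
  and PPQ_eq_QP:
    "\<lbrakk>g \<in> carrier G; h \<in> carrier G; x \<in> cells D g h\<rbrakk>
     \<Longrightarrow> Pop D (h \<otimes> g) (inv h) (Pop D (inv g) (h \<otimes> g) (Qop D g h x)) =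
         Qop D h (inv g \<otimes> inv h) (Pop D g h x)"
  and P_m:
    "\<lbrakk>g \<in> carrier G; h \<in> carrier G; k \<in> carrier G;
      a \<in> cells D g (inv h); b \<in> cells D h (inv k); c \<in> cells D (inv h \<otimes> g) (inv k \<otimes> h)\<rbrakk>
     \<Longrightarrow> Pop D g (inv k) (mop D g h k a b c) =
         mop D (inv k) (inv k \<otimes> h) (inv k \<otimes> g)
           (Pop D h (inv k) b) (Pop D (inv h \<otimes> g) (inv k \<otimes> h) c) (Pop D g (inv h) a)"
  and Q_m:
    "\<lbrakk>g \<in> carrier G; h \<in> carrier G; k \<in> carrier G;
      a \<in> cells D g (inv h); b \<in> cells D h (inv k); c \<in> cells D (inv h \<otimes> g) (inv k \<otimes> h)\<rbrakk>
     \<Longrightarrow> Qop D g (inv k) (mop D g h k a b c) =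
         mop D (inv g) (inv g \<otimes> h) (inv g \<otimes> k)
           (Qop D g (inv h) a) (Qop D (inv h \<otimes> g) (inv k \<otimes> h) c) (Qop D h (inv k) b)"
  and m_m:
    "\<lbrakk>g \<in> carrier G; h \<in> carrier G; k \<in> carrier G; l \<in> carrier G;
      a \<in> cells D g (inv h); b \<in> cells D h (inv k); c \<in> cells D (inv h \<otimes> g) (inv k \<otimes> h);
      d \<in> cells D k (inv l); e \<in> cells D (inv k \<otimes> g) (inv l \<otimes> k);
      f \<in> cells D (inv k \<otimes> h) (inv l \<otimes> k)\<rbrakk>
     \<Longrightarrow> mop D g k l (mop D g h k a b c) d e =
         mop D g h l a
           (mop D h k l b d f)
           (mop D (inv h \<otimes> g) (inv h \<otimes> k) (inv h \<otimes> l)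
              c (Qop D (inv k \<otimes> h) (inv l \<otimes> k) f) e)"
  and m_inverse:
    "\<lbrakk>g \<in> carrier G; h \<in> carrier G; k \<in> carrier G;
      f \<in> cells D g (inv h); a \<in> cells D h (inv k); b \<in> cells D (inv h \<otimes> g) (inv k \<otimes> h)\<rbrakk>
     \<Longrightarrow> mop D g k h
           (mop D g h k f a b)
           (Pop D (inv k \<otimes> h) k (Pop D (inv h) (inv k \<otimes> h) (Qop D h (inv k) a)))
           (Pop D (inv g \<otimes> h) (inv k \<otimes> g) (Qop D (inv h \<otimes> g) (inv k \<otimes> h) b)) = f"

locale delta_morphism =
  source: delta_group G D + target: delta_group G' D'
  for G :: "('g, 'm) monoid_scheme" (structure) and D :: "('g, 't) delta_ops"
  and G' :: "('h, 'n) monoid_scheme" and D' :: "('h, 'u) delta_ops" +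
  fixes \<phi> :: "'g \<Rightarrow> 'h" and F :: "'g \<Rightarrow> 'g \<Rightarrow> 't \<Rightarrow> 'u"
  assumes hom: "\<phi> \<in> hom G G'"
  and F_cells:
    "\<lbrakk>g \<in> carrier G; h \<in> carrier G; x \<in> cells D g h\<rbrakk>
     \<Longrightarrow> F g h x \<in> cells D' (\<phi> g) (\<phi> h)"
  and F_m:
    "\<lbrakk>g \<in> carrier G; h \<in> carrier G; k \<in> carrier G;
      a \<in> cells D g (inv h); b \<in> cells D h (inv k); c \<in> cells D (inv h \<otimes> g) (inv k \<otimes> h)\<rbrakk>
     \<Longrightarrow> F g (inv k) (mop D g h k a b c) =
         mop D' (\<phi> g) (\<phi> h) (\<phi> k)
           (F g (inv h) a) (F h (inv k) b) (F (inv h \<otimes> g) (inv k \<otimes> h) c)"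
  and F_P:
    "\<lbrakk>g \<in> carrier G; h \<in> carrier G; x \<in> cells D g h\<rbrakk>
     \<Longrightarrow> F h (inv g \<otimes> inv h) (Pop D g h x) = Pop D' (\<phi> g) (\<phi> h) (F g h x)"
  and F_Q:
    "\<lbrakk>g \<in> carrier G; h \<in> carrier G; x \<in> cells D g h\<rbrakk>
     \<Longrightarrow> F (inv g) (h \<otimes> g) (Qop D g h x) = Qop D' (\<phi> g) (\<phi> h) (F g h x)"


section \<open>Manifolds and the fundamental group\<close>

definition manifold :: "'a::topological_space set \<Rightarrow> bool" where
  "manifold M \<longleftrightarrow>
     Hausdorff_space (top_of_set M) \<and> second_countable (top_of_set M) \<and>
     (\<exists>n. \<forall>x\<in>M. \<exists>U V. openin (top_of_set M) U \<and> x \<in> U \<and> openin (Euclidean_space n) V \<and>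
        subtopology (top_of_set M) U homeomorphic_space subtopology (Euclidean_space n) V)"

definition loops :: "'a::topological_space set \<Rightarrow> 'a \<Rightarrow> (real \<Rightarrow> 'a) set" where
  "loops M m\<^sub>0 = {p. path p \<and> path_image p \<subseteq> M \<and> pathstart p = m\<^sub>0 \<and> pathfinish p = m\<^sub>0}"

text \<open>
  As usual for paths of type \<^typ>\<open>real \<Rightarrow> 'a\<close>, values outside \<open>{0..1}\<close> are irrelevant: two
  functions agreeing on \<open>{0..1}\<close> represent the same loop and lie in the same class.
\<close>

definition loop_class :: "'a::topological_space set \<Rightarrow> (real \<Rightarrow> 'a) \<Rightarrow> (real \<Rightarrow> 'a) set" where
  "loop_class M p = {q. homotopic_paths M p q}"

text \<open>The product of two classes is "first followed by second".\<close>

definition pi1 :: "'a::topological_space set \<Rightarrow> 'a \<Rightarrow> (real \<Rightarrow> 'a) set monoid" where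
  "pi1 M m\<^sub>0 =
     \<lparr>carrier = loop_class M ` loops M m\<^sub>0,
      mult = (\<lambda>A B. \<Union>p\<in>A. \<Union>q\<in>B. loop_class M (p +++ q)),
      one = loop_class M (\<lambda>_. m\<^sub>0)\<rparr>"

definition pi1_map ::
    "'b::topological_space set \<Rightarrow> ('a::topological_space \<Rightarrow> 'b) \<Rightarrow> (real \<Rightarrow> 'a) set \<Rightarrow> (real \<Rightarrow> 'b) set"
  where "pi1_map N f A = (\<Union>p\<in>A. loop_class N (f \<circ> p))"

definition loop_section ::
    "'a::topological_space set \<Rightarrow> 'a \<Rightarrow> ((real \<Rightarrow> 'a) set \<Rightarrow> real \<Rightarrow> 'a) \<Rightarrow> bool" where
  "loop_section M m\<^sub>0 s \<longleftrightarrow>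
     (\<forall>\<alpha>\<in>carrier (pi1 M m\<^sub>0). s \<alpha> \<in> \<alpha>) \<and>
     (\<forall>\<alpha>\<in>carrier (pi1 M m\<^sub>0). \<forall>t\<in>{0..1}. s (inv\<^bsub>pi1 M m\<^sub>0\<^esub> \<alpha>) t = s \<alpha> (1 - t)) \<and>
     (\<forall>t\<in>{0..1}. s \<one>\<^bsub>pi1 M m\<^sub>0\<^esub> t = m\<^sub>0)"


section \<open>Singular triangles\<close>

definition vertex :: "nat \<Rightarrow> nat \<Rightarrow> real" where
  "vertex i = (\<lambda>j. if j = i then 1 else 0)"

definition edge_point :: "nat \<Rightarrow> nat \<Rightarrow> real \<Rightarrow> nat \<Rightarrow> real" where
  "edge_point i j t = (\<lambda>r. (1 - t) * vertex i r + t * vertex j r)"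

definition face :: "((nat \<Rightarrow> real) \<Rightarrow> 'a) \<Rightarrow> nat \<Rightarrow> nat \<Rightarrow> nat \<Rightarrow> (nat \<Rightarrow> real) \<Rightarrow> 'a" where
  "face \<omega> i j l = simplex_map 2 \<omega> (oriented_simplex 2 (\<lambda>r. vertex ([i, j, l] ! r)))"

definition triangle_boundary :: "(nat \<Rightarrow> real) set" where
  "triangle_boundary = {x \<in> standard_simplex 2. \<exists>i\<le>2. x i = 0}"

definition triangle_class ::
    "'a::topological_space set \<Rightarrow> ((nat \<Rightarrow> real) \<Rightarrow> 'a) \<Rightarrow> ((nat \<Rightarrow> real) \<Rightarrow> 'a) set" where
  "triangle_class M a =
     {b. singular_simplex 2 (top_of_set M) b \<and>
         homotopic_with (\<lambda>h. \<forall>x\<in>triangle_boundary. h x = a x)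
           (subtopology (powertop_real UNIV) (standard_simplex 2)) (top_of_set M) a b}"

definition triangles ::
    "'a::topological_space set \<Rightarrow> 'a \<Rightarrow> ((real \<Rightarrow> 'a) set \<Rightarrow> real \<Rightarrow> 'a) \<Rightarrow>
     (real \<Rightarrow> 'a) set \<Rightarrow> (real \<Rightarrow> 'a) set \<Rightarrow> ((nat \<Rightarrow> real) \<Rightarrow> 'a) set" where
  "triangles M m\<^sub>0 s \<alpha> \<beta> =
     {a. singular_simplex 2 (top_of_set M) a \<and>
         (\<forall>t\<in>{0..1}. a (edge_point 1 0 t) = s \<alpha> t \<and>
                     a (edge_point 2 1 t) = s \<beta> t \<and>
                     a (edge_point 2 0 t) = s (\<beta> \<otimes>\<^bsub>pi1 M m\<^sub>0\<^esub> \<alpha>) t)}"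


section \<open>The Delta-group of a space\<close>

definition Gamma ::
    "'a::topological_space set \<Rightarrow> 'a \<Rightarrow> ((real \<Rightarrow> 'a) set \<Rightarrow> real \<Rightarrow> 'a) \<Rightarrow>
     (real \<Rightarrow> 'a) set \<Rightarrow> (real \<Rightarrow> 'a) set \<Rightarrow> ((nat \<Rightarrow> real) \<Rightarrow> 'a) set set" where
  "Gamma M m\<^sub>0 s \<alpha> \<beta> = triangle_class M ` triangles M m\<^sub>0 s \<alpha> \<beta>"

text \<open>
  \<open>P\<close> and \<open>Q\<close> send a class to the set of all reparametrised representatives, which is again a class
  because \<open>p\<close> and \<open>q\<close> are homeomorphisms of the triangle preserving its boundary.
\<close>

definition Gamma_P :: "((nat \<Rightarrow> real) \<Rightarrow> 'a) set \<Rightarrow> ((nat \<Rightarrow> real) \<Rightarrow> 'a) set" where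
  "Gamma_P A = (\<lambda>a. simplex_map 2 a (\<lambda>x. (\<lambda>_. 0)(0 := x 2, 1 := x 0, 2 := x 1))) ` A"

definition Gamma_Q :: "((nat \<Rightarrow> real) \<Rightarrow> 'a) set \<Rightarrow> ((nat \<Rightarrow> real) \<Rightarrow> 'a) set" where
  "Gamma_Q A = (\<lambda>a. simplex_map 2 a (\<lambda>x. (\<lambda>_. 0)(0 := x 1, 1 := x 0, 2 := x 2))) ` A"

definition tetrahedron_filling ::
    "'a::topological_space set \<Rightarrow> ((nat \<Rightarrow> real) \<Rightarrow> 'a) \<Rightarrow> ((nat \<Rightarrow> real) \<Rightarrow> 'a) \<Rightarrow>
     ((nat \<Rightarrow> real) \<Rightarrow> 'a) \<Rightarrow> ((nat \<Rightarrow> real) \<Rightarrow> 'a) \<Rightarrow> bool" where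
  "tetrahedron_filling M a b c \<omega> \<longleftrightarrow>
     singular_simplex 3 (top_of_set M) \<omega> \<and>
     face \<omega> 1 2 0 = a \<and> face \<omega> 0 2 3 = b \<and> face \<omega> 1 0 3 = c"

definition Gamma_m ::
    "'a::topological_space set \<Rightarrow> ((nat \<Rightarrow> real) \<Rightarrow> 'a) set \<Rightarrow> ((nat \<Rightarrow> real) \<Rightarrow> 'a) set \<Rightarrow>
     ((nat \<Rightarrow> real) \<Rightarrow> 'a) set \<Rightarrow> ((nat \<Rightarrow> real) \<Rightarrow> 'a) set" where
  "Gamma_m M A B C =
     triangle_class M
       (face (SOME \<omega>. \<exists>a\<in>A. \<exists>b\<in>B. \<exists>c\<in>C. tetrahedron_filling M a b c \<omega>) 1 2 3)"

definition Gamma_ops ::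
    "'a::topological_space set \<Rightarrow> 'a \<Rightarrow> ((real \<Rightarrow> 'a) set \<Rightarrow> real \<Rightarrow> 'a) \<Rightarrow>
     ((real \<Rightarrow> 'a) set, ((nat \<Rightarrow> real) \<Rightarrow> 'a) set) delta_ops" where
  "Gamma_ops M m\<^sub>0 s =
     \<lparr>cells = Gamma M m\<^sub>0 s,
      mop = (\<lambda>_ _ _. Gamma_m M),
      Pop = (\<lambda>_ _. Gamma_P),
      Qop = (\<lambda>_ _. Gamma_Q)\<rparr>"

text \<open>
  \<^const>\<open>Gamma_m\<close> chooses a map on the tetrahedron; this states that for all representatives one exists
  and that the resulting class does not depend on the choices.
\<close>

definition Gamma_m_well_defined ::
    "'a::topological_space set \<Rightarrow> 'a \<Rightarrow> ((real \<Rightarrow> 'a) set \<Rightarrow> real \<Rightarrow> 'a) \<Rightarrow> bool" where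
  "Gamma_m_well_defined M m\<^sub>0 s \<longleftrightarrow>
     (\<forall>\<alpha>\<in>carrier (pi1 M m\<^sub>0). \<forall>\<beta>\<in>carrier (pi1 M m\<^sub>0). \<forall>\<gamma>\<in>carrier (pi1 M m\<^sub>0).
      \<forall>A \<in> Gamma M m\<^sub>0 s \<alpha> (inv\<^bsub>pi1 M m\<^sub>0\<^esub> \<beta>).
      \<forall>B \<in> Gamma M m\<^sub>0 s \<beta> (inv\<^bsub>pi1 M m\<^sub>0\<^esub> \<gamma>).
      \<forall>C \<in> Gamma M m\<^sub>0 s (inv\<^bsub>pi1 M m\<^sub>0\<^esub> \<beta> \<otimes>\<^bsub>pi1 M m\<^sub>0\<^esub> \<alpha>) (inv\<^bsub>pi1 M m\<^sub>0\<^esub> \<gamma> \<otimes>\<^bsub>pi1 M m\<^sub>0\<^esub> \<beta>).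
      \<forall>a\<in>A. \<forall>b\<in>B. \<forall>c\<in>C.
        (\<exists>\<omega>. tetrahedron_filling M a b c \<omega>) \<and>
        (\<forall>\<omega>. tetrahedron_filling M a b c \<omega> \<longrightarrow>
             triangle_class M (face \<omega> 1 2 3) = Gamma_m M A B C))"


section \<open>The induced map\<close>

definition loop_homotopies ::
    "'a::topological_space set \<Rightarrow> 'a \<Rightarrow> 'b::topological_space set \<Rightarrow> 'b \<Rightarrow> ('a \<Rightarrow> 'b) \<Rightarrow>
     ((real \<Rightarrow> 'a) set \<Rightarrow> real \<Rightarrow> 'a) \<Rightarrow> ((real \<Rightarrow> 'b) set \<Rightarrow> real \<Rightarrow> 'b) \<Rightarrow>
     ((real \<Rightarrow> 'a) set \<Rightarrow> real \<times> real \<Rightarrow> 'b) \<Rightarrow> bool" where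
  "loop_homotopies M m\<^sub>0 N n\<^sub>0 f s\<^sub>M s\<^sub>N H \<longleftrightarrow>
     (\<forall>g\<in>carrier (pi1 M m\<^sub>0).
        continuous_on ({0..1} \<times> {0..1}) (H g) \<and> H g ` ({0..1} \<times> {0..1}) \<subseteq> N \<and>
        (\<forall>t\<in>{0..1}. H g (t, 0) = f (s\<^sub>M g t) \<and> H g (t, 1) = s\<^sub>N (pi1_map N f g) t) \<and>
        (\<forall>\<tau>\<in>{0..1}. H g (0, \<tau>) = n\<^sub>0 \<and> H g (1, \<tau>) = n\<^sub>0) \<and>
        (\<forall>t\<in>{0..1}. \<forall>\<tau>\<in>{0..1}. H (inv\<^bsub>pi1 M m\<^sub>0\<^esub> g) (t, \<tau>) = H g (1 - t, \<tau>))) \<and>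
     (\<forall>t\<in>{0..1}. \<forall>\<tau>\<in>{0..1}. H \<one>\<^bsub>pi1 M m\<^sub>0\<^esub> (t, \<tau>) = n\<^sub>0)"

definition triangle_homotopy ::
    "'a::topological_space set \<Rightarrow> 'a \<Rightarrow> 'b::topological_space set \<Rightarrow> ('a \<Rightarrow> 'b) \<Rightarrow>
     ((real \<Rightarrow> 'a) set \<Rightarrow> real \<times> real \<Rightarrow> 'b) \<Rightarrow> (real \<Rightarrow> 'a) set \<Rightarrow> (real \<Rightarrow> 'a) set \<Rightarrow>
     ((nat \<Rightarrow> real) \<Rightarrow> 'a) \<Rightarrow> ((nat \<Rightarrow> real) \<times> real \<Rightarrow> 'b) \<Rightarrow> bool" where
  "triangle_homotopy M m\<^sub>0 N f H \<alpha> \<beta> a F \<longleftrightarrow>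
     continuous_map
       (prod_topology (subtopology (powertop_real UNIV) (standard_simplex 2)) (top_of_set {0..1}))
       (top_of_set N) F \<and>
     (\<forall>x\<in>standard_simplex 2. F (x, 0) = f (a x)) \<and>
     (\<forall>t\<in>{0..1}. \<forall>\<tau>\<in>{0..1}.
        F (edge_point 1 0 t, \<tau>) = H \<alpha> (t, \<tau>) \<and>
        F (edge_point 2 1 t, \<tau>) = H \<beta> (t, \<tau>) \<and>
        F (edge_point 2 0 t, \<tau>) = H (\<beta> \<otimes>\<^bsub>pi1 M m\<^sub>0\<^esub> \<alpha>) (t, \<tau>))"

definition homotopy_end :: "((nat \<Rightarrow> real) \<times> real \<Rightarrow> 'b) \<Rightarrow> (nat \<Rightarrow> real) \<Rightarrow> 'b" where
  "homotopy_end F = restrict (\<lambda>x. F (x, 1)) (standard_simplex 2)"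

definition Gamma_map ::
    "'a::topological_space set \<Rightarrow> 'a \<Rightarrow> 'b::topological_space set \<Rightarrow> ('a \<Rightarrow> 'b) \<Rightarrow>
     ((real \<Rightarrow> 'a) set \<Rightarrow> real \<times> real \<Rightarrow> 'b) \<Rightarrow> (real \<Rightarrow> 'a) set \<Rightarrow> (real \<Rightarrow> 'a) set \<Rightarrow>
     ((nat \<Rightarrow> real) \<Rightarrow> 'a) set \<Rightarrow> ((nat \<Rightarrow> real) \<Rightarrow> 'b) set" where
  "Gamma_map M m\<^sub>0 N f H \<alpha> \<beta> A =
     triangle_class N (homotopy_end (SOME F. \<exists>a\<in>A. triangle_homotopy M m\<^sub>0 N f H \<alpha> \<beta> a F))"

definition Gamma_map_well_defined ::
    "'a::topological_space set \<Rightarrow> 'a \<Rightarrow> 'b::topological_space set \<Rightarrow> ('a \<Rightarrow> 'b) \<Rightarrow>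
     ((real \<Rightarrow> 'a) set \<Rightarrow> real \<Rightarrow> 'a) \<Rightarrow> ((real \<Rightarrow> 'a) set \<Rightarrow> real \<times> real \<Rightarrow> 'b) \<Rightarrow> bool" where
  "Gamma_map_well_defined M m\<^sub>0 N f s\<^sub>M H \<longleftrightarrow>
     (\<forall>\<alpha>\<in>carrier (pi1 M m\<^sub>0). \<forall>\<beta>\<in>carrier (pi1 M m\<^sub>0). \<forall>A \<in> Gamma M m\<^sub>0 s\<^sub>M \<alpha> \<beta>. \<forall>a\<in>A.
        (\<exists>F. triangle_homotopy M m\<^sub>0 N f H \<alpha> \<beta> a F) \<and>
        (\<forall>F. triangle_homotopy M m\<^sub>0 N f H \<alpha> \<beta> a F \<longrightarrow>
             triangle_class N (homotopy_end F) = Gamma_map M m\<^sub>0 N f H \<alpha> \<beta> A))"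

end

theory Submission
  imports Defs
begin

text \<open>
  A tetrahedron retracts onto any horn by a deformation through affine combinations. Hence three
  triangles with matching edges always extend to a tetrahedron, and the class of the remaining face
  relative to its boundary depends only on the classes of the other three. Every axiom is thereby
  reduced to exhibiting fillings: the laws for \<open>P\<close>, \<open>Q\<close> and inverses relabel the vertices of one
  tetrahedron, and the associativity law (4) reads off the five facets of a 4-simplex that is
  filled from the three facets around a common edge. The induced map is treated in the same way,
  with the retraction of a prism onto its bottom and sides in place of the horn.
\<close>

section \<open>Barycentric vertex maps\<close>

text \<open>Faces must be glued pointwise, while cells are only homotopy classes. The section
  \<open>s\<close> resolves this: an edge depends on its class alone and \<open>s\<close> turns
  inverses into reversed loops, so the faces entering \<open>m\<close> agree exactly along shared
  edges. A self-inverse class would need a representative equal to its own reverse; such a loop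
  contracts, so a nontrivial self-inverse class has no admissible representative. This is the reason
  for excluding order two.

  The operation \<open>m\<close> involves a choice of filling, so it is never computed directly. The
  relation \<open>tetra\<close> on representatives replaces it until \<open>Gamma_m_class\<close>
  transfers results to classes.

  The horn argument is stated for three facets of a simplex of any dimension and with an additional
  closed parameter set. Dimension 3 with a one-point parameter set fills tetrahedra, dimension 3
  with the unit interval gives homotopies of fillings, and dimension 4 gives associativity.\<close>

text \<open>The affine map sending the \<open>j\<close>-th vertex to the vertex \<open>L ! j\<close>.\<close>

definition vmap :: "nat list \<Rightarrow> (nat \<Rightarrow> real) \<Rightarrow> nat \<Rightarrow> real" where
  "vmap L x = (\<lambda>i. \<Sum>j<length L. if L ! j = i then x j else 0)"

text \<open>The list may permute or omit vertices, so taking faces and the reparametrisations behind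
  \<open>P\<close> and \<open>Q\<close> are one operation. Restricting keeps the result extensional,
  which allows faces to be compared by plain equality of functions.\<close>

definition subsimplex :: "((nat \<Rightarrow> real) \<Rightarrow> 'a) \<Rightarrow> nat list \<Rightarrow> (nat \<Rightarrow> real) \<Rightarrow> 'a" where
  "subsimplex \<omega> L = restrict (\<omega> \<circ> vmap L) (standard_simplex (length L - 1))"

lemma continuous_on_vmap [continuous_intros]:
  assumes "continuous_on S g"
  shows "continuous_on S (\<lambda>x. vmap L (g x))"
  unfolding vmap_def
proof (intro continuous_on_coordinatewise_then_product continuous_on_sum)
  fix i j
  show "continuous_on S (\<lambda>x. if L ! j = i then g x j else 0)"
    using continuous_on_product_then_coordinatewise[OF assms] by (cases "L ! j = i") simp_all
qed

text \<open>Every mass \<open>x j\<close> lands on exactly one vertex, so exchanging the order of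
  summation preserves the total; repeated entries of \<open>L\<close> merely add masses.\<close>

lemma vmap_in_simplex:
  assumes x: "x \<in> standard_simplex p" and L: "length L = Suc p" "set L \<subseteq> {..n}"
  shows "vmap L x \<in> standard_simplex n"
proof -
  have eq: "{..<Suc p} = {..p}" by auto
  have nn: "0 \<le> vmap L x i" for i
    using x unfolding vmap_def standard_simplex_def by (auto intro: sum_nonneg)
  have zero: "vmap L x i = 0" if "i > n" for i
    proof -
    have "L ! j \<noteq> i" if "j < length L" for j
      using L(2) nth_mem[OF that] \<open>i > n\<close> by auto
    then show ?thesis unfolding vmap_def by (intro sum.neutral) auto
  qed
  have "(\<Sum>i\<le>n. vmap L x i) = (\<Sum>j<Suc p. \<Sum>i\<le>n. if L ! j = i then x j else 0)"
    unfolding vmap_def L(1) by (rule sum.swap)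
  also have "\<dots> = (\<Sum>j<Suc p. x j)"
    using L by (intro sum.cong) (auto simp: subset_iff)
  also have "\<dots> = 1" using x unfolding eq by (simp add: standard_simplex_def)
  finally have one: "(\<Sum>i\<le>n. vmap L x i) = 1" .
  have "vmap L x i \<le> 1" for i
  proof (cases "i \<le> n")
    case True
    then have "vmap L x i \<le> (\<Sum>i\<le>n. vmap L x i)" by (intro member_le_sum nn) auto
    with one show ?thesis by simp
  qed (simp add: zero)
  with nn zero one show ?thesis by (simp add: standard_simplex_def)
qed

text \<open>Composing affine vertex maps is indexing one list by another. Later identities between
  faces reduce to evaluating such lists.\<close>

lemma vmap_vmap:
  assumes "set K \<subseteq> {..<length L}"
  shows "vmap L (vmap K x) = vmap (map ((!) L) K) x"
proof
  fix i
  have "vmap L (vmap K x) i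
      = (\<Sum>j<length L. \<Sum>k<length K. if L ! j = i \<and> K ! k = j then x k else 0)"
    unfolding vmap_def by (intro sum.cong refl) (auto simp: if_distrib cong: if_cong)
  also have "\<dots> = (\<Sum>k<length K. \<Sum>j<length L. if L ! j = i \<and> K ! k = j then x k else 0)"
    by (rule sum.swap)
  also have "\<dots> = (\<Sum>k<length K. \<Sum>j<length L. if j = K ! k then (if L ! (K ! k) = i then x k else 0) else 0)"
    by (intro sum.cong refl) auto
  also have "\<dots> = (\<Sum>k<length K. if L ! (K ! k) = i then x k else 0)"
    using assms by (intro sum.cong refl) (auto simp: subset_iff)
  also have "\<dots> = vmap (map ((!) L) K) x i"
    unfolding vmap_def by (auto intro: sum.cong)
  finally show "vmap L (vmap K x) i = vmap (map ((!) L) K) x i" .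
qed

text \<open>The alternative \<open>x j = 0\<close> is for collapse lists: an arbitrary entry at a
  missing vertex does no harm on the facet where that coordinate vanishes.\<close>

lemma vmap_ident:
  assumes x: "x \<in> standard_simplex n" and K: "length K = Suc n"
    and j: "\<And>j. j \<le> n \<Longrightarrow> K ! j = j \<or> x j = 0"
  shows "vmap K x = x"
proof
  fix i
  have "vmap K x i = (\<Sum>k\<le>n. if k = i then x k else 0)"
    unfolding vmap_def K lessThan_Suc_atMost
    using j by (intro sum.cong refl) force
  also have "\<dots> = x i" using x by (auto simp: standard_simplex_def)
  finally show "vmap K x i = x i" .
qed

lemma simplex_map_oriented:
  "simplex_map p \<omega> (oriented_simplex p (\<lambda>j. vertex (L ! j))) = subsimplex \<omega> L"
  if "length L = Suc p"
proof -
  have *: "oriented_simplex p (\<lambda>j. vertex (L ! j)) x = vmap L x" if "x \<in> standard_simplex p" for x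
    using that \<open>length L = Suc p\<close>
    by (auto simp: oriented_simplex_def vmap_def vertex_def lessThan_Suc_atMost fun_eq_iff
             intro!: sum.cong)
  show ?thesis
    using that by (auto simp: simplex_map_def subsimplex_def * intro!: restrict_ext)
qed

lemma face_subsimplex: "face \<omega> i j l = subsimplex \<omega> [i, j, l]"
  unfolding face_def by (rule simplex_map_oriented) simp

lemma subsimplex_apply:
  "x \<in> standard_simplex (length L - 1) \<Longrightarrow> subsimplex \<omega> L x = \<omega> (vmap L x)"
  by (simp add: subsimplex_def)

lemma subsimplex_subsimplex:
  assumes "set K \<subseteq> {..<length L}" "K \<noteq> []"
  shows "subsimplex (subsimplex \<omega> L) K = subsimplex \<omega> (map ((!) L) K)"
proof
  fix x
  have "vmap K x \<in> standard_simplex (length L - 1)" if "x \<in> standard_simplex (length K - 1)"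
    using that assms by (intro vmap_in_simplex[of x "length K - 1"]) auto
  then show "subsimplex (subsimplex \<omega> L) K x = subsimplex \<omega> (map ((!) L) K) x"
    using assms by (auto simp: subsimplex_def vmap_vmap)
qed

section \<open>Singular simplices as extensional continuous maps, and their edges\<close>

lemma singular_simplex_iff:
  "singular_simplex n (top_of_set M) \<omega> \<longleftrightarrow>
     continuous_on (standard_simplex n) \<omega> \<and> \<omega> ` standard_simplex n \<subseteq> M \<and>
     \<omega> \<in> extensional (standard_simplex n)"
  by (auto simp: singular_simplex_def euclidean_product_topology image_subset_iff_funcset)

lemma singular_subsimplex:
  assumes "singular_simplex n (top_of_set M) \<omega>" "length L = Suc p" "set L \<subseteq> {..n}"
  shows "singular_simplex p (top_of_set M) (subsimplex \<omega> L)"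
proof -
  have *: "vmap L ` standard_simplex p \<subseteq> standard_simplex n"
    using assms vmap_in_simplex by blast
  have "continuous_on (standard_simplex p) (\<omega> \<circ> vmap L)"
    using assms(1) * by (intro continuous_on_compose continuous_on_vmap)
      (auto simp: singular_simplex_iff intro: continuous_on_subset)
  moreover have "(\<omega> \<circ> vmap L) ` standard_simplex p \<subseteq> M"
    using assms(1) * by (auto simp: singular_simplex_iff)
  ultimately show ?thesis
    using assms(2) by (auto simp: singular_simplex_iff subsimplex_def)
qed

lemma subsimplex_ident:
  assumes "singular_simplex n (top_of_set M) \<omega>"
  shows "subsimplex \<omega> [0..<Suc n] = \<omega>"
proof
  fix x
  show "subsimplex \<omega> [0..<Suc n] x = \<omega> x"
  proof (cases "x \<in> standard_simplex n")
    case True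
    then show ?thesis
      by (simp add: subsimplex_def vmap_ident[OF True] del: upt_Suc)
  next
    case False
    then show ?thesis using assms
      by (auto simp: subsimplex_def singular_simplex_iff extensional_def)
  qed
qed

lemma vmap_edge_point:
  assumes "i < length L" "j < length L"
  shows "vmap L (edge_point i j t) = edge_point (L ! i) (L ! j) t"
proof
  fix k
  have "vmap L (edge_point i j t) k =
      (\<Sum>r<length L. (if r = i then (if L ! i = k then 1 - t else 0) else 0) +
                      (if r = j then (if L ! j = k then t else 0) else 0))"
    unfolding vmap_def edge_point_def vertex_def by (intro sum.cong) auto
  also have "\<dots> = edge_point (L ! i) (L ! j) t k"
    using assms by (simp add: sum.distrib edge_point_def vertex_def)
  finally show "vmap L (edge_point i j t) k = edge_point (L ! i) (L ! j) t k" .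
qed

lemma edge_point_reverse: "edge_point i j t = edge_point j i (1 - t)"
  by (auto simp: edge_point_def)

lemma edge_point_in_simplex:
  assumes "i \<le> n" "j \<le> n" "t \<in> {0..1}"
  shows "edge_point i j t \<in> standard_simplex n"
proof -
  have "(\<Sum>k\<le>n. edge_point i j t k) = (\<Sum>k\<le>n. (if k = i then 1 - t else 0) + (if k = j then t else 0))"
    unfolding edge_point_def vertex_def by (intro sum.cong) auto
  also have "\<dots> = 1" using assms by (simp add: sum.distrib)
  finally show ?thesis
    using assms by (auto simp: standard_simplex_def) (auto simp: edge_point_def vertex_def)
qed

lemma subsimplex_edge:
  assumes "i < length L" "j < length L" "t \<in> {0..1}"
  shows "subsimplex \<omega> L (edge_point i j t) = \<omega> (edge_point (L ! i) (L ! j) t)"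
  using assms by (simp add: subsimplex_apply edge_point_in_simplex vmap_edge_point)

lemma closed_standard_simplex: "closed (standard_simplex n)"
  using closedin_standard_simplex by (simp add: euclidean_product_topology)

lemma edge_point_cases:
  assumes x: "x \<in> standard_simplex n" "i \<le> n" "j \<le> n" "i \<noteq> j"
    and zero: "\<And>k. k \<le> n \<Longrightarrow> k \<noteq> i \<Longrightarrow> k \<noteq> j \<Longrightarrow> x k = 0"
  shows "x j \<in> {0..1}" "x = edge_point i j (x j)"
proof -
  show "x j \<in> {0..1}" using x by (auto simp: standard_simplex_def)
  have "1 = (\<Sum>k\<le>n. x k)" using x by (simp add: standard_simplex_def)
  also have "\<dots> = (\<Sum>k\<in>{i,j}. x k)"
    using x zero by (intro sum.mono_neutral_right) auto
  finally have "x i = 1 - x j" using x by simp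
  moreover have "x k = 0" if "k \<noteq> i" "k \<noteq> j" for k
    using that zero x by (cases "k \<le> n") (auto simp: standard_simplex_def)
  ultimately show "x = edge_point i j (x j)"
    using x(4) by (auto simp: edge_point_def vertex_def fun_eq_iff)
qed

section \<open>Horn extension\<close>

text \<open>
  Deformation of a simplex onto the union of the facets opposite \<open>p\<close>, \<open>q\<close>, \<open>r\<close>: at time 1 the smallest
  of these three coordinates has been lowered to 0 and the lost mass moved to the vertex \<open>s\<close>.
\<close>

definition horn_push :: "nat \<Rightarrow> nat \<Rightarrow> nat \<Rightarrow> nat \<Rightarrow> real \<Rightarrow> (nat \<Rightarrow> real) \<Rightarrow> nat \<Rightarrow> real" where
  "horn_push p q r s t x =
     (let \<mu> = min (x p) (min (x q) (x r)) in
      (\<lambda>k. if k = p \<or> k = q \<or> k = r then x k - t * \<mu> else if k = s then x k + 3 * t * \<mu> else x k))"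

lemma continuous_on_horn_push:
  "continuous_on S (\<lambda>z. horn_push p q r s (fst z) (snd z))"
  unfolding horn_push_def Let_def
proof (rule continuous_on_coordinatewise_then_product)
  fix i
  let ?m = "\<lambda>x::real \<times> (nat \<Rightarrow> real). min (snd x p) (min (snd x q) (snd x r))"
  have c: "continuous_on S (\<lambda>z. snd z k)" for k
    by (rule continuous_on_product_then_coordinatewise[OF continuous_on_snd[OF continuous_on_id]])
  have f: "continuous_on S fst"
    by (rule continuous_on_fst[OF continuous_on_id])
  have m: "continuous_on S ?m"
    by (rule continuous_on_min[OF c continuous_on_min[OF c c]])
  have 1: "continuous_on S (\<lambda>x. snd x i - fst x * ?m x)"
    by (rule continuous_on_diff[OF c continuous_on_mult[OF f m]])
  have 2: "continuous_on S (\<lambda>x. snd x i + 3 * fst x * ?m x)"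
    by (rule continuous_on_add[OF c continuous_on_mult[OF continuous_on_mult[OF continuous_on_const f] m]])
  show "continuous_on S (\<lambda>x. if i = p \<or> i = q \<or> i = r then snd x i - fst x * ?m x
           else if i = s then snd x i + 3 * fst x * ?m x else snd x i)"
    using 1 2 c[of i] by (cases "i = p \<or> i = q \<or> i = r"; cases "i = s") simp_all
qed

text \<open>Turns the nested conditional into a sum of indicator terms, so that the total mass after
  the push can be computed term by term.\<close>

lemma if_three_or_one_eq_sum:
  fixes \<mu> :: real
  assumes d: "distinct [p, q, r, s]"
    and y: "y = (if k \<in> {p, q, r} then z - t * \<mu> else if k = s then z + 3 * t * \<mu> else z)"
  shows "y = z + (if k = s then 3 * t * \<mu> else 0) - (if k = p then t * \<mu> else 0)
      - (if k = q then t * \<mu> else 0) - (if k = r then t * \<mu> else 0)"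
proof -
  consider "k = p" | "k = q" | "k = r" | "k = s" | "k \<notin> {p,q,r,s}" by blast
  then show ?thesis
  proof cases
    case 1 with d show ?thesis by (auto simp: y)
  next
    case 2 with d show ?thesis by (auto simp: y)
  next
    case 3 with d show ?thesis by (auto simp: y)
  next
    case 4 with d show ?thesis by (auto simp: y)
  next
    case 5 with d show ?thesis by (auto simp: y)
  qed
qed

lemma horn_push_in_simplex:
  assumes x: "x \<in> standard_simplex n" and d: "distinct [p, q, r, s]" "{p, q, r, s} \<subseteq> {..n}"
    and t: "t \<in> {0..1}"
  shows "horn_push p q r s t x \<in> standard_simplex n"
proof -
  let ?y = "horn_push p q r s t x"
  define \<mu> where "\<mu> = min (x p) (min (x q) (x r))"
  have y: "?y k = (if k \<in> {p,q,r} then x k - t * \<mu> else if k = s then x k + 3 * t * \<mu> else x k)" for k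
    by (simp add: horn_push_def \<mu>_def Let_def)
  have \<mu>: "0 \<le> \<mu>" using x by (auto simp: standard_simplex_def \<mu>_def)
  \<comment> \<open>The amount removed is at most the smallest of the three coordinates, so none
    becomes negative.\<close>
  have t\<mu>: "0 \<le> t * \<mu>" "t * \<mu> \<le> \<mu>" using t \<mu> by (auto simp: mult_left_le_one_le)
  have nn: "0 \<le> ?y k" for k
    unfolding y using x t\<mu> by (auto simp: standard_simplex_def \<mu>_def)
  have zero: "?y k = 0" if "k > n" for k
    using that x d(2) by (auto simp: y standard_simplex_def)
  have "?y k = x k + (if k = s then 3 * t * \<mu> else 0) - (if k = p then t * \<mu> else 0)
      - (if k = q then t * \<mu> else 0) - (if k = r then t * \<mu> else 0)" for k
    by (rule if_three_or_one_eq_sum[OF d(1) y])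
  then have "(\<Sum>k\<le>n. ?y k) = (\<Sum>k\<le>n. x k + (if k = s then 3 * t * \<mu> else 0) - (if k = p then t * \<mu> else 0)
      - (if k = q then t * \<mu> else 0) - (if k = r then t * \<mu> else 0))"
    by (rule sum.cong[OF refl])
  \<comment> \<open>The gain \<open>3 * t * \<mu>\<close> at \<open>s\<close> balances the three
    losses.\<close>
  also have "\<dots> = (\<Sum>k\<le>n. x k)"
    using d(2) by (simp add: sum.distrib sum_subtractf)
  finally have one: "(\<Sum>k\<le>n. ?y k) = 1" using x by (simp add: standard_simplex_def)
  have "?y k \<le> 1" for k
  proof (cases "k \<le> n")
    case True
    then have "?y k \<le> (\<Sum>k\<le>n. ?y k)" by (intro member_le_sum nn) auto
    with one show ?thesis by simp
  qed (simp add: zero)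
  with nn zero one show ?thesis by (simp add: standard_simplex_def)
qed

lemma horn_push_0: "horn_push p q r s 0 x = x"
  by (auto simp: horn_push_def Let_def)

lemma horn_push_fixed:
  assumes "x \<in> standard_simplex n" "x p = 0 \<or> x q = 0 \<or> x r = 0"
  shows "horn_push p q r s t x = x"
proof -
  have "min (x p) (min (x q) (x r)) = 0"
    using assms by (auto simp: standard_simplex_def min_def order_antisym)
  then show ?thesis by (auto simp: horn_push_def)
qed

lemma horn_push_1:
  assumes "distinct [p, q, r, s]" and y: "y = horn_push p q r s 1 x"
  shows "y p = 0 \<or> y q = 0 \<or> y r = 0"
  using assms(1) unfolding y by (auto simp: horn_push_def Let_def min_def)

text \<open>Pasting on closed sets glues the three maps on the horn, and precomposition with the
  push at time 1 spreads them over the simplex. The parameter in \<open>T\<close> is carried along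
  unchanged.\<close>

lemma horn_extension:
  fixes K1 K2 K3 :: "real \<times> (nat \<Rightarrow> real) \<Rightarrow> 'a::topological_space"
  assumes d: "distinct [p, q, r, s]" "{p, q, r, s} \<subseteq> {..n}" and T: "closed T"
    and K1: "continuous_on (T \<times> {x \<in> standard_simplex n. x p = 0}) K1"
      "K1 ` (T \<times> {x \<in> standard_simplex n. x p = 0}) \<subseteq> N"
    and K2: "continuous_on (T \<times> {x \<in> standard_simplex n. x q = 0}) K2"
      "K2 ` (T \<times> {x \<in> standard_simplex n. x q = 0}) \<subseteq> N"
    and K3: "continuous_on (T \<times> {x \<in> standard_simplex n. x r = 0}) K3"
      "K3 ` (T \<times> {x \<in> standard_simplex n. x r = 0}) \<subseteq> N"
    and K12: "\<And>\<tau> x. \<lbrakk>\<tau> \<in> T; x \<in> standard_simplex n; x p = 0; x q = 0\<rbrakk> \<Longrightarrow> K1 (\<tau>, x) = K2 (\<tau>, x)"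
    and K13: "\<And>\<tau> x. \<lbrakk>\<tau> \<in> T; x \<in> standard_simplex n; x p = 0; x r = 0\<rbrakk> \<Longrightarrow> K1 (\<tau>, x) = K3 (\<tau>, x)"
    and K23: "\<And>\<tau> x. \<lbrakk>\<tau> \<in> T; x \<in> standard_simplex n; x q = 0; x r = 0\<rbrakk> \<Longrightarrow> K2 (\<tau>, x) = K3 (\<tau>, x)"
  obtains K where "continuous_on (T \<times> standard_simplex n) K" "K ` (T \<times> standard_simplex n) \<subseteq> N"
    "\<And>\<tau> x. \<lbrakk>\<tau> \<in> T; x \<in> standard_simplex n; x p = 0\<rbrakk> \<Longrightarrow> K (\<tau>, x) = K1 (\<tau>, x)"
    "\<And>\<tau> x. \<lbrakk>\<tau> \<in> T; x \<in> standard_simplex n; x q = 0\<rbrakk> \<Longrightarrow> K (\<tau>, x) = K2 (\<tau>, x)"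
    "\<And>\<tau> x. \<lbrakk>\<tau> \<in> T; x \<in> standard_simplex n; x r = 0\<rbrakk> \<Longrightarrow> K (\<tau>, x) = K3 (\<tau>, x)"
proof -
  let ?S = "standard_simplex n"
  let ?F = "\<lambda>i. T \<times> {x \<in> ?S. x i = 0}"
  \<comment> \<open>The order of the cases is immaterial on overlaps because of \<open>K12\<close>,
    \<open>K13\<close> and \<open>K23\<close>.\<close>
  define k where "k = (\<lambda>z. if snd z p = 0 then K1 z else if snd z q = 0 then K2 z else K3 z)"
  have cl: "closed (?F i)" for i
  proof -
    have "{x \<in> ?S. x i = 0} = ?S \<inter> (\<lambda>x. x i) -` {0}" by auto
    moreover have "closed \<dots>"
      using closed_standard_simplex by (intro closed_Int closed_vimage) auto
    ultimately show ?thesis using T by (simp add: closed_Times)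
  qed
  have k1: "k z = K1 z" if "z \<in> ?F p" for z using that by (auto simp: k_def)
  have k2: "k z = K2 z" if "z \<in> ?F q" for z using that by (auto simp: k_def K12)
  have k3: "k z = K3 z" if "z \<in> ?F r" for z using that by (auto simp: k_def K13 K23)
  have "continuous_on (?F p) k" "continuous_on (?F q) k" "continuous_on (?F r) k"
    using K1(1) K2(1) K3(1) k1 k2 k3 by (simp_all cong: continuous_on_cong)
  then have ck: "continuous_on (?F p \<union> ?F q \<union> ?F r) k"
    by (intro continuous_on_closed_Un cl closed_Un)
  have ik: "k ` (?F p \<union> ?F q \<union> ?F r) \<subseteq> N"
    unfolding image_Un using K1(2) K2(2) K3(2) k1 k2 k3 by (simp add: image_subset_iff)
  \<comment> \<open>At time 1 the push is a retraction onto the horn; the intermediate times serve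
    the uniqueness of fillings later.\<close>
  define R where "R = (\<lambda>z::real \<times> (nat \<Rightarrow> real). (fst z, horn_push p q r s 1 (snd z)))"
  have cR: "continuous_on (T \<times> ?S) R"
  proof -
    have "continuous_on (T \<times> ?S) ((\<lambda>z. horn_push p q r s (fst z) (snd z)) \<circ> (\<lambda>z. (1, snd z)))"
      by (intro continuous_on_compose continuous_on_horn_push continuous_intros)
    then show ?thesis
      unfolding R_def by (intro continuous_on_Pair) (auto simp: o_def intro: continuous_intros)
  qed
  have iR: "R ` (T \<times> ?S) \<subseteq> ?F p \<union> ?F q \<union> ?F r"
  proof (clarsimp simp: R_def, goal_cases)
    case (1 \<tau> x)
    then show ?case
      using horn_push_in_simplex[OF _ d, of x 1] horn_push_1[OF d(1) refl, of x] by auto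
  qed
  have Rid: "R z = z" if "z \<in> ?F p \<union> ?F q \<union> ?F r" for z
    using that horn_push_fixed[of "snd z" n p q r s 1] by (auto simp: R_def prod_eq_iff)
  show thesis
  proof
    show "continuous_on (T \<times> ?S) (k \<circ> R)"
      by (intro continuous_on_compose cR continuous_on_subset[OF ck iR])
    show "(k \<circ> R) ` (T \<times> ?S) \<subseteq> N"
      unfolding image_comp[symmetric] using image_mono[OF iR, of k] ik by (rule order_trans)
    fix \<tau> x
    assume \<tau>: "\<tau> \<in> T" and x: "x \<in> ?S"
    have fx: "(k \<circ> R) z = k z" if "z \<in> ?F p \<union> ?F q \<union> ?F r" for z
      unfolding comp_def using Rid[OF that] by (rule arg_cong)
    show "x p = 0 \<Longrightarrow> (k \<circ> R) (\<tau>, x) = K1 (\<tau>, x)"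
      by (subst fx) (use \<tau> x in \<open>auto intro: k1\<close>)
    show "x q = 0 \<Longrightarrow> (k \<circ> R) (\<tau>, x) = K2 (\<tau>, x)"
      by (subst fx) (use \<tau> x in \<open>auto intro: k2\<close>)
    show "x r = 0 \<Longrightarrow> (k \<circ> R) (\<tau>, x) = K3 (\<tau>, x)"
      by (subst fx) (use \<tau> x in \<open>auto intro: k3\<close>)
  qed
qed

section \<open>Homotopies relative to a subset\<close>

text \<open>One notion for triangles, tetrahedra and prisms: \<open>C\<close> is the domain and
  \<open>L\<close> the part held fixed. Stationarity is expressed through the first map only, an
  asymmetry that the symmetry and transitivity proofs have to remove.\<close>

definition rel_htpy ::
    "'c::topological_space set \<Rightarrow> 'c set \<Rightarrow> 'a::topological_space set \<Rightarrow> ('c \<Rightarrow> 'a) \<Rightarrow> ('c \<Rightarrow> 'a) \<Rightarrow> bool"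
  where "rel_htpy L C M u v \<longleftrightarrow> homotopic_with_canon (\<lambda>h. \<forall>x\<in>L. h x = u x) C M u v"

text \<open>The characterisation of \<open>homotopic_with\<close> asks for a predicate that depends
  only on values on the domain; \<open>L \<subseteq> C\<close> ensures this.\<close>

lemma rel_htpy_iff:
  fixes u v :: "'c::topological_space \<Rightarrow> 'a::topological_space"
  assumes "L \<subseteq> C"
  shows "rel_htpy L C M u v \<longleftrightarrow>
    (\<exists>h. continuous_on ({0..1::real} \<times> C) h \<and> h ` ({0..1} \<times> C) \<subseteq> M \<and>
         (\<forall>x\<in>C. h (0, x) = u x \<and> h (1, x) = v x) \<and> (\<forall>t\<in>{0..1}. \<forall>x\<in>L. h (t, x) = u x))"
proof -
  have "(\<forall>x\<in>L. h x = u x) \<longleftrightarrow> (\<forall>x\<in>L. k x = u x)"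
    if "\<And>x. x \<in> topspace (top_of_set C) \<Longrightarrow> h x = k x" for h k :: "'c \<Rightarrow> 'a"
    using assms that by (simp add: subset_iff)
  from homotopic_with[of "top_of_set C" "\<lambda>h. \<forall>x\<in>L. h x = u x", OF this] show ?thesis
    unfolding rel_htpy_def by (simp add: image_subset_iff_funcset ball_conj_distrib)
qed

lemma rel_htpyI:
  assumes "L \<subseteq> C" "continuous_on ({0..1::real} \<times> C) h" "h ` ({0..1} \<times> C) \<subseteq> M"
    "\<And>x. x \<in> C \<Longrightarrow> h (0, x) = u x" "\<And>x. x \<in> C \<Longrightarrow> h (1, x) = v x"
    "\<And>t x. \<lbrakk>t \<in> {0..1}; x \<in> L\<rbrakk> \<Longrightarrow> h (t, x) = u x"
  shows "rel_htpy L C M u v"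
  unfolding rel_htpy_iff[OF assms(1)]
  by (rule exI[of _ h], intro conjI ballI) (use assms in simp_all)

lemma rel_htpyE:
  assumes "rel_htpy L C M u v" "L \<subseteq> C"
  obtains h where "continuous_on ({0..1::real} \<times> C) h" "h ` ({0..1} \<times> C) \<subseteq> M"
    "\<And>x. x \<in> C \<Longrightarrow> h (0, x) = u x" "\<And>x. x \<in> C \<Longrightarrow> h (1, x) = v x"
    "\<And>t x. \<lbrakk>t \<in> {0..1}; x \<in> L\<rbrakk> \<Longrightarrow> h (t, x) = u x"
proof -
  obtain h where "continuous_on ({0..1::real} \<times> C) h \<and> h ` ({0..1} \<times> C) \<subseteq> M \<and>
      (\<forall>x\<in>C. h (0, x) = u x \<and> h (1, x) = v x) \<and> (\<forall>t\<in>{0..1}. \<forall>x\<in>L. h (t, x) = u x)"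
    using assms(1) unfolding rel_htpy_iff[OF assms(2)] ..
  then show thesis using that[of h] by simp
qed

lemma rel_htpy_on: "\<lbrakk>rel_htpy L C M u v; x \<in> L\<rbrakk> \<Longrightarrow> v x = u x"
  using homotopic_with_imp_property[of "\<lambda>h. \<forall>x\<in>L. h x = u x" "top_of_set C" "top_of_set M" u v]
  by (simp add: rel_htpy_def)

text \<open>Both ends agree on \<open>L\<close>, so the predicate formed with \<open>v\<close> is
  the one formed with \<open>u\<close>.\<close>

lemma rel_htpy_sym:
  assumes "rel_htpy L C M u v"
  shows "rel_htpy L C M v u"
proof -
  have eq: "(\<lambda>h. \<forall>x\<in>L. h x = v x) = (\<lambda>h. \<forall>x\<in>L. h x = u x)"
    using rel_htpy_on[OF assms] by (simp cong: ball_cong)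
  show ?thesis
    unfolding rel_htpy_def eq by (rule homotopic_with_symD[OF assms[unfolded rel_htpy_def]])
qed

lemma rel_htpy_trans:
  assumes "rel_htpy L C M u v" "rel_htpy L C M v w"
  shows "rel_htpy L C M u w"
proof -
  have eq: "(\<lambda>h. \<forall>x\<in>L. h x = v x) = (\<lambda>h. \<forall>x\<in>L. h x = u x)"
    using rel_htpy_on[OF assms(1)] by (simp cong: ball_cong)
  show ?thesis
    unfolding rel_htpy_def
    by (rule homotopic_with_trans[OF assms(1)[unfolded rel_htpy_def] assms(2)[unfolded rel_htpy_def eq]])
qed

lemma rel_htpy_refl: "\<lbrakk>continuous_on C u; u ` C \<subseteq> M\<rbrakk> \<Longrightarrow> rel_htpy L C M u u"
  unfolding rel_htpy_def homotopic_with_refl by (simp add: image_subset_iff_funcset)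

lemma rel_htpy_compose:
  assumes "rel_htpy L C M u v" "continuous_on C' i" "i ` C' \<subseteq> C" "i ` L' \<subseteq> L"
  shows "rel_htpy L' C' M (u \<circ> i) (v \<circ> i)"
  unfolding rel_htpy_def
proof (rule homotopic_with_compose_continuous_map_right[OF assms(1)[unfolded rel_htpy_def]])
  show "continuous_map (top_of_set C') (top_of_set C) i"
    using assms(2,3) by (simp add: image_subset_iff_funcset)
  show "\<forall>x\<in>L'. (j \<circ> i) x = (u \<circ> i) x" if "\<forall>x\<in>L. j x = u x" for j
    using that assms(4) by (simp add: image_subset_iff)
qed

text \<open>Values off \<open>C\<close> carry no information; this moves between a map and its
  restriction to the simplex.\<close>

lemma rel_htpy_eq:
  assumes "rel_htpy L C M u v" "\<And>x. x \<in> C \<Longrightarrow> u' x = u x" "\<And>x. x \<in> C \<Longrightarrow> v' x = v x" "L \<subseteq> C"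
  shows "rel_htpy L C M u' v'"
proof -
  obtain h where h: "continuous_on ({0..1::real} \<times> C) h" "h ` ({0..1} \<times> C) \<subseteq> M"
    "\<And>x. x \<in> C \<Longrightarrow> h (0, x) = u x" "\<And>x. x \<in> C \<Longrightarrow> h (1, x) = v x"
    "\<And>t x. \<lbrakk>t \<in> {0..1}; x \<in> L\<rbrakk> \<Longrightarrow> h (t, x) = u x"
    by (rule rel_htpyE[OF assms(1,4)]) (rule that; simp)
  show ?thesis
    by (rule rel_htpyI[OF assms(4) h(1,2)]) (use h(3-5) assms(2-4) in \<open>simp_all add: subset_iff\<close>)
qed

text \<open>Along the deformation every \<open>w\<close> is homotopic to \<open>w\<close> after the
  retraction \<open>G (1, _)\<close>, which sees only the values of \<open>w\<close> on
  \<open>L\<close>. Two maps agreeing there therefore share this intermediate map.\<close>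

lemma rel_htpy_deformation:
  fixes u v :: "'c::topological_space \<Rightarrow> 'a::topological_space"
  assumes LC: "L \<subseteq> C"
    and G: "continuous_on ({0..1::real} \<times> C) G" "G ` ({0..1} \<times> C) \<subseteq> C"
      "\<And>x. x \<in> C \<Longrightarrow> G (0, x) = x" "\<And>x. x \<in> C \<Longrightarrow> G (1, x) \<in> L"
      "\<And>t x. \<lbrakk>t \<in> {0..1}; x \<in> L\<rbrakk> \<Longrightarrow> G (t, x) = x"
    and u: "continuous_on C u" "u ` C \<subseteq> M" and v: "continuous_on C v" "v ` C \<subseteq> M"
    and uv: "\<And>x. x \<in> L \<Longrightarrow> u x = v x"
  shows "rel_htpy L C M u v"
proof -
  have *: "rel_htpy L C M w (\<lambda>x. w (G (1, x)))" if "continuous_on C w" "w ` C \<subseteq> M" for w :: "'c \<Rightarrow> 'a"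
  proof (rule rel_htpyI[OF LC, where h = "w \<circ> G"])
    show "continuous_on ({0..1} \<times> C) (w \<circ> G)"
      by (intro continuous_on_compose G(1) continuous_on_subset[OF that(1) G(2)])
    show "(w \<circ> G) ` ({0..1} \<times> C) \<subseteq> M"
      unfolding image_comp[symmetric] using image_mono[OF G(2), of w] that(2) by (rule order_trans)
  qed (auto simp: G)
  have "rel_htpy L C M u (\<lambda>x. v (G (1, x)))"
    using rel_htpy_eq[OF *[OF u] _ _ LC, of u] uv G(4) by simp
  then show ?thesis
    using rel_htpy_trans rel_htpy_sym *[OF v] by blast
qed

section \<open>Triangles up to homotopy relative to the boundary\<close>

abbreviation tri_htpy ::
    "'a::topological_space set \<Rightarrow> ((nat \<Rightarrow> real) \<Rightarrow> 'a) \<Rightarrow> ((nat \<Rightarrow> real) \<Rightarrow> 'a) \<Rightarrow> bool" where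
  "tri_htpy M \<equiv> rel_htpy triangle_boundary (standard_simplex 2) M"

lemma triangle_boundary_subset: "triangle_boundary \<subseteq> standard_simplex 2"
  by (auto simp: triangle_boundary_def)

lemma triangle_class_iff:
  "b \<in> triangle_class M a \<longleftrightarrow> singular_simplex 2 (top_of_set M) b \<and> tri_htpy M a b"
  by (simp add: triangle_class_def rel_htpy_def euclidean_product_topology)

lemma tri_htpy_refl: "singular_simplex 2 (top_of_set M) a \<Longrightarrow> tri_htpy M a a"
  by (simp add: rel_htpy_refl singular_simplex_iff)

lemma triangle_class_self: "singular_simplex 2 (top_of_set M) a \<Longrightarrow> a \<in> triangle_class M a"
  by (simp add: triangle_class_iff tri_htpy_refl)

lemma triangle_class_eqI: "tri_htpy M a b \<Longrightarrow> triangle_class M a = triangle_class M b"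
  using rel_htpy_sym rel_htpy_trans by (auto simp: triangle_class_iff) blast+

lemma le_2_cases: "(i::nat) \<le> 2 \<longleftrightarrow> i = 0 \<or> i = 1 \<or> i = 2" by auto
lemma le_3_cases: "(i::nat) \<le> 3 \<longleftrightarrow> i = 0 \<or> i = 1 \<or> i = 2 \<or> i = 3" by auto

lemma triangle_boundary_cases:
  assumes "x \<in> triangle_boundary"
  obtains t where "t \<in> {0..1}" "x = edge_point 1 0 t" | t where "t \<in> {0..1}" "x = edge_point 2 1 t"
    | t where "t \<in> {0..1}" "x = edge_point 2 0 t"
proof -
  have x: "x \<in> standard_simplex 2" and "x 0 = 0 \<or> x 1 = 0 \<or> x 2 = 0"
    using assms by (auto simp: triangle_boundary_def le_2_cases)
  then consider "x 0 = 0" | "x 1 = 0" | "x 2 = 0" by blast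
  then show thesis
  proof cases
    case 1
    then show ?thesis
      using edge_point_cases[OF x, of 2 1] that(2) by (auto simp: le_2_cases)
  next
    case 2
    then show ?thesis
      using edge_point_cases[OF x, of 2 0] that(3) by (auto simp: le_2_cases)
  next
    case 3
    then show ?thesis
      using edge_point_cases[OF x, of 1 0] that(1) by (auto simp: le_2_cases)
  qed
qed

lemma edge_point_in_boundary:
  assumes "i \<le> 2" "j \<le> 2" "t \<in> {0..1}"
  shows "edge_point i j t \<in> triangle_boundary"
proof -
  obtain k where "k \<le> 2" "k \<noteq> i" "k \<noteq> j"
    using assms by (metis le_2_cases zero_neq_numeral one_neq_zero numeral_eq_one_iff semiring_norm(85))
  then show ?thesis
    using assms edge_point_in_simplex by (auto simp: triangle_boundary_def edge_point_def vertex_def)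
qed

lemma vmap_boundary:
  assumes "x \<in> triangle_boundary" "length L = 3" "set L \<subseteq> {..2}"
  shows "vmap L x \<in> triangle_boundary"
proof -
  have *: "L ! 0 \<le> 2" "L ! 1 \<le> 2" "L ! 2 \<le> 2"
    using assms(2,3) nth_mem[of _ L] by (auto simp: subset_iff)
  show ?thesis
    using assms(1)
    by (cases rule: triangle_boundary_cases)
       (use assms(2) * in \<open>auto simp: vmap_edge_point intro!: edge_point_in_boundary\<close>)
qed

lemma tri_htpy_subsimplex:
  assumes "tri_htpy M a b" "length L = 3" "set L \<subseteq> {..2}"
  shows "tri_htpy M (subsimplex a L) (subsimplex b L)"
proof -
  have "tri_htpy M (a \<circ> vmap L) (b \<circ> vmap L)"
    using assms vmap_in_simplex[of _ 2 L 2] vmap_boundary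
    by (intro rel_htpy_compose[OF assms(1)] continuous_on_vmap) auto
  then show ?thesis
    by (rule rel_htpy_eq) (use assms triangle_boundary_subset in \<open>auto simp: subsimplex_def\<close>)
qed

section \<open>Fillings of tetrahedra\<close>

text \<open>A choice-free form of the operation: \<open>d\<close> is one possible value of
  \<open>m\<close> on the representatives \<open>a\<close>, \<open>b\<close>, \<open>c\<close>, with
  all four faces prescribed as functions.\<close>

definition tetra ::
    "'a::topological_space set \<Rightarrow> ((nat \<Rightarrow> real) \<Rightarrow> 'a) \<Rightarrow> ((nat \<Rightarrow> real) \<Rightarrow> 'a) \<Rightarrow>
     ((nat \<Rightarrow> real) \<Rightarrow> 'a) \<Rightarrow> ((nat \<Rightarrow> real) \<Rightarrow> 'a) \<Rightarrow> bool" where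
  "tetra M a b c d \<longleftrightarrow> (\<exists>\<omega>. tetrahedron_filling M a b c \<omega> \<and> face \<omega> 1 2 3 = d)"

lemma tetra_iff:
  "tetra M a b c d \<longleftrightarrow> (\<exists>\<omega>. singular_simplex 3 (top_of_set M) \<omega> \<and>
     subsimplex \<omega> [1,2,0] = a \<and> subsimplex \<omega> [0,2,3] = b \<and> subsimplex \<omega> [1,0,3] = c \<and>
     subsimplex \<omega> [1,2,3] = d)"
  by (auto simp: tetra_def tetrahedron_filling_def face_subsimplex)

text \<open>A list such as \<open>[2,0,1,0]\<close> records the position of each vertex of the
  tetrahedron in the face list \<open>[1,2,0]\<close>; the absent vertex gets the default 0. On the
  facet itself the list inverts the face inclusion.\<close>

lemma tetra_facets:
  assumes "x \<in> standard_simplex 3"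
  shows "vmap [2,0,1,0] x \<in> standard_simplex 2" "vmap [0,0,1,2] x \<in> standard_simplex 2"
    "vmap [1,0,0,2] x \<in> standard_simplex 2"
    "x 3 = 0 \<Longrightarrow> vmap [1,2,0] (vmap [2,0,1,0] x) = x"
    "x 1 = 0 \<Longrightarrow> vmap [0,2,3] (vmap [0,0,1,2] x) = x"
    "x 2 = 0 \<Longrightarrow> vmap [1,0,3] (vmap [1,0,0,2] x) = x"
proof -
  show "vmap [2,0,1,0] x \<in> standard_simplex 2" "vmap [0,0,1,2] x \<in> standard_simplex 2"
    "vmap [1,0,0,2] x \<in> standard_simplex 2"
    by (rule vmap_in_simplex[OF assms]; simp)+
  show "x 3 = 0 \<Longrightarrow> vmap [1,2,0] (vmap [2,0,1,0] x) = x"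
    "x 1 = 0 \<Longrightarrow> vmap [0,2,3] (vmap [0,0,1,2] x) = x"
    "x 2 = 0 \<Longrightarrow> vmap [1,0,3] (vmap [1,0,0,2] x) = x"
    by (subst vmap_vmap; (rule vmap_ident[OF assms])?; force simp: le_3_cases)+
qed

text \<open>The three faces contain vertex 0, and the compatibility conditions are those on the
  edges from 0 to 2, 1 and 3. The horn consists of the facets opposite 3, 1 and 2, so mass is pushed
  to vertex 0.\<close>

lemma tetra_extend:
  fixes Ka Kb Kc :: "real \<times> (nat \<Rightarrow> real) \<Rightarrow> 'a::topological_space"
  assumes T: "closed T"
    and Ka: "continuous_on (T \<times> standard_simplex 2) Ka" "Ka ` (T \<times> standard_simplex 2) \<subseteq> N"
    and Kb: "continuous_on (T \<times> standard_simplex 2) Kb" "Kb ` (T \<times> standard_simplex 2) \<subseteq> N"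
    and Kc: "continuous_on (T \<times> standard_simplex 2) Kc" "Kc ` (T \<times> standard_simplex 2) \<subseteq> N"
    and ab: "\<And>\<tau> t. \<lbrakk>\<tau> \<in> T; t \<in> {0..1}\<rbrakk> \<Longrightarrow> Ka (\<tau>, edge_point 2 1 t) = Kb (\<tau>, edge_point 0 1 t)"
    and ac: "\<And>\<tau> t. \<lbrakk>\<tau> \<in> T; t \<in> {0..1}\<rbrakk> \<Longrightarrow> Ka (\<tau>, edge_point 2 0 t) = Kc (\<tau>, edge_point 1 0 t)"
    and bc: "\<And>\<tau> t. \<lbrakk>\<tau> \<in> T; t \<in> {0..1}\<rbrakk> \<Longrightarrow> Kb (\<tau>, edge_point 0 2 t) = Kc (\<tau>, edge_point 1 2 t)"
  obtains K where "continuous_on (T \<times> standard_simplex 3) K" "K ` (T \<times> standard_simplex 3) \<subseteq> N"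
    "\<forall>\<tau>\<in>T. \<forall>y\<in>standard_simplex 2. K (\<tau>, vmap [1,2,0] y) = Ka (\<tau>, y) \<and>
       K (\<tau>, vmap [0,2,3] y) = Kb (\<tau>, y) \<and> K (\<tau>, vmap [1,0,3] y) = Kc (\<tau>, y)"
proof -
  let ?S = "standard_simplex 3"
  let ?K = "\<lambda>K L z. K (fst z, vmap L (snd z))"
  have cont: "continuous_on (T \<times> {x \<in> ?S. x i = 0}) (?K K L)"
    if "continuous_on (T \<times> standard_simplex 2) K" "length L = 4" "set L \<subseteq> {..2}"
    for i L and K :: "real \<times> (nat \<Rightarrow> real) \<Rightarrow> 'a"
  proof (rule continuous_on_compose2[OF that(1)])
    show "continuous_on (T \<times> {x \<in> ?S. x i = 0}) (\<lambda>z. (fst z, vmap L (snd z)))"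
      by (rule continuous_on_Pair[OF continuous_on_fst[OF continuous_on_id]
            continuous_on_vmap[OF continuous_on_snd[OF continuous_on_id]]])
    show "(\<lambda>z. (fst z, vmap L (snd z))) ` (T \<times> {x \<in> ?S. x i = 0}) \<subseteq> T \<times> standard_simplex 2"
      using vmap_in_simplex[of _ 3 L 2] that by (auto simp: image_subset_iff)
  qed
  have im: "(?K K L) ` (T \<times> {x \<in> ?S. x i = 0}) \<subseteq> N"
    if "K ` (T \<times> standard_simplex 2) \<subseteq> N" "length L = 4" "set L \<subseteq> {..2}"
    for i L and K :: "real \<times> (nat \<Rightarrow> real) \<Rightarrow> 'a"
    using vmap_in_simplex[of _ 3 L 2] that by (auto simp: image_subset_iff)
  obtain K where K: "continuous_on (T \<times> ?S) K" "K ` (T \<times> ?S) \<subseteq> N"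
    "\<And>\<tau> x. \<lbrakk>\<tau> \<in> T; x \<in> ?S; x 3 = 0\<rbrakk> \<Longrightarrow> K (\<tau>, x) = ?K Ka [2,0,1,0] (\<tau>, x)"
    "\<And>\<tau> x. \<lbrakk>\<tau> \<in> T; x \<in> ?S; x 1 = 0\<rbrakk> \<Longrightarrow> K (\<tau>, x) = ?K Kb [0,0,1,2] (\<tau>, x)"
    "\<And>\<tau> x. \<lbrakk>\<tau> \<in> T; x \<in> ?S; x 2 = 0\<rbrakk> \<Longrightarrow> K (\<tau>, x) = ?K Kc [1,0,0,2] (\<tau>, x)"
  proof (rule horn_extension[where p = 3 and q = 1 and r = 2 and s = 0 and n = 3 and T = T and N = N
        and ?K1.0 = "?K Ka [2,0,1,0]" and ?K2.0 = "?K Kb [0,0,1,2]" and ?K3.0 = "?K Kc [1,0,0,2]"])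
    fix \<tau> x assume \<tau>: "\<tau> \<in> T" and x: "x \<in> ?S"
    \<comment> \<open>Where two facets meet, all mass lies on two vertices, so \<open>x\<close> is a
      point of an edge at vertex 0 and a matching hypothesis applies.\<close>
    show "?K Ka [2,0,1,0] (\<tau>, x) = ?K Kb [0,0,1,2] (\<tau>, x)" if "x 3 = 0" "x 1 = 0"
    proof -
      have "x 2 \<in> {0..1}" "x = edge_point 0 2 (x 2)"
        using edge_point_cases[OF x, of 0 2] that by (auto simp: le_3_cases)
      then show ?thesis
        using ab[OF \<tau>, of "x 2"] vmap_edge_point[of 0 "[2,0,1,0]" 2 "x 2"]
          vmap_edge_point[of 0 "[0,0,1,2]" 2 "x 2"] by simp
    qed
    show "?K Ka [2,0,1,0] (\<tau>, x) = ?K Kc [1,0,0,2] (\<tau>, x)" if "x 3 = 0" "x 2 = 0"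
    proof -
      have "x 1 \<in> {0..1}" "x = edge_point 0 1 (x 1)"
        using edge_point_cases[OF x, of 0 1] that by (auto simp: le_3_cases)
      then show ?thesis
        using ac[OF \<tau>, of "x 1"] vmap_edge_point[of 0 "[2,0,1,0]" 1 "x 1"]
          vmap_edge_point[of 0 "[1,0,0,2]" 1 "x 1"] by simp
    qed
    show "?K Kb [0,0,1,2] (\<tau>, x) = ?K Kc [1,0,0,2] (\<tau>, x)" if "x 1 = 0" "x 2 = 0"
    proof -
      have "x 3 \<in> {0..1}" "x = edge_point 0 3 (x 3)"
        using edge_point_cases[OF x, of 0 3] that by (auto simp: le_3_cases)
      then show ?thesis
        using bc[OF \<tau>, of "x 3"] vmap_edge_point[of 0 "[0,0,1,2]" 3 "x 3"]
          vmap_edge_point[of 0 "[1,0,0,2]" 3 "x 3"] by simp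
    qed
  qed (use T in \<open>simp_all add: cont im Ka Kb Kc\<close>)
  have "K (\<tau>, vmap [1,2,0] y) = Ka (\<tau>, y) \<and> K (\<tau>, vmap [0,2,3] y) = Kb (\<tau>, y) \<and>
      K (\<tau>, vmap [1,0,3] y) = Kc (\<tau>, y)" if \<tau>: "\<tau> \<in> T" and y: "y \<in> standard_simplex 2" for \<tau> y
  proof (intro conjI)
    have s: "vmap [1,2,0] y \<in> ?S" "vmap [0,2,3] y \<in> ?S" "vmap [1,0,3] y \<in> ?S"
      by (rule vmap_in_simplex[OF y]; simp)+
    have z: "vmap [1,2,0] y 3 = 0" "vmap [0,2,3] y 1 = 0" "vmap [1,0,3] y 2 = 0"
      by (simp_all add: vmap_def lessThan_Suc numeral_3_eq_3)
    \<comment> \<open>The collapse lists are also left inverses of the face inclusions, so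
      \<open>K\<close> restricts to the prescribed maps.\<close>
    have b: "vmap [2,0,1,0] (vmap [1,2,0] y) = y" "vmap [0,0,1,2] (vmap [0,2,3] y) = y"
      "vmap [1,0,0,2] (vmap [1,0,3] y) = y"
      by (subst vmap_vmap; (rule vmap_ident[OF y])?; force simp: le_2_cases)+
    show "K (\<tau>, vmap [1,2,0] y) = Ka (\<tau>, y)" using K(3)[OF \<tau> s(1) z(1)] b(1) by simp
    show "K (\<tau>, vmap [0,2,3] y) = Kb (\<tau>, y)" using K(4)[OF \<tau> s(2) z(2)] b(2) by simp
    show "K (\<tau>, vmap [1,0,3] y) = Kc (\<tau>, y)" using K(5)[OF \<tau> s(3) z(3)] b(3) by simp
  qed
  then show thesis using that[OF K(1,2)] by simp
qed

lemma restrict_slice_singular: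
  assumes "continuous_on (T \<times> standard_simplex n) K" "K ` (T \<times> standard_simplex n) \<subseteq> N" "\<tau> \<in> T"
  shows "singular_simplex n (top_of_set N) (restrict (\<lambda>x. K (\<tau>, x)) (standard_simplex n))"
proof -
  have "continuous_on (standard_simplex n) (\<lambda>x. K (\<tau>, x))"
    by (rule continuous_on_compose2[OF assms(1)])
       (use assms(3) in \<open>auto intro: continuous_on_Pair continuous_on_const continuous_on_id\<close>)
  then show ?thesis
    using assms(2,3) by (auto simp: singular_simplex_iff)
qed

lemma subsimplex_restrict_slice:
  assumes "\<forall>y\<in>standard_simplex (length L - 1). K (\<tau>, vmap L y) = a y"
    and "a \<in> extensional (standard_simplex (length L - 1))" "set L \<subseteq> {..n}" "L \<noteq> []"
  shows "subsimplex (restrict (\<lambda>x. K (\<tau>, x)) (standard_simplex n)) L = a"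
proof (rule extensionalityI[OF _ assms(2)])
  fix y assume y: "y \<in> standard_simplex (length L - 1)"
  then have "vmap L y \<in> standard_simplex n"
    using assms(3,4) by (intro vmap_in_simplex[OF y]) auto
  then show "subsimplex (restrict (\<lambda>x. K (\<tau>, x)) (standard_simplex n)) L y = a y"
    using y assms(1) by (simp add: subsimplex_apply)
qed (simp add: subsimplex_def)

lemma tetra_exists:
  assumes s: "singular_simplex 2 (top_of_set M) a" "singular_simplex 2 (top_of_set M) b"
      "singular_simplex 2 (top_of_set M) c"
    and ab: "\<And>t. t \<in> {0..1} \<Longrightarrow> a (edge_point 2 1 t) = b (edge_point 0 1 t)"
    and ac: "\<And>t. t \<in> {0..1} \<Longrightarrow> a (edge_point 2 0 t) = c (edge_point 1 0 t)"
    and bc: "\<And>t. t \<in> {0..1} \<Longrightarrow> b (edge_point 0 2 t) = c (edge_point 1 2 t)"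
  obtains d where "tetra M a b c d"
proof -
  \<comment> \<open>A one-point parameter set makes the parametrised extension a plain one.\<close>
  have cont: "continuous_on ({0::real} \<times> standard_simplex 2) (\<lambda>z. f (snd z))"
    "(\<lambda>z. f (snd z)) ` ({0::real} \<times> standard_simplex 2) \<subseteq> M"
    if "singular_simplex 2 (top_of_set M) f" for f
    using that by (auto simp: singular_simplex_iff
        intro!: continuous_on_compose2[of "standard_simplex 2" f] continuous_on_snd[OF continuous_on_id])
  obtain K where K: "continuous_on ({0::real} \<times> standard_simplex 3) K"
    "K ` ({0} \<times> standard_simplex 3) \<subseteq> M"
    "\<forall>\<tau>\<in>{0}. \<forall>y\<in>standard_simplex 2. K (\<tau>, vmap [1,2,0] y) = a (snd (\<tau>, y)) \<and>
       K (\<tau>, vmap [0,2,3] y) = b (snd (\<tau>, y)) \<and> K (\<tau>, vmap [1,0,3] y) = c (snd (\<tau>, y))"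
    by (rule tetra_extend[where T = "{0}" and N = M and Ka = "\<lambda>z. a (snd z)"
          and Kb = "\<lambda>z. b (snd z)" and Kc = "\<lambda>z. c (snd z)"])
       (use cont s ab ac bc in simp_all)
  define \<omega> where "\<omega> = restrict (\<lambda>x. K (0, x)) (standard_simplex 3)"
  have "singular_simplex 3 (top_of_set M) \<omega>"
    unfolding \<omega>_def by (rule restrict_slice_singular[OF K(1,2)]) simp
  moreover have "subsimplex \<omega> [1,2,0] = a" "subsimplex \<omega> [0,2,3] = b" "subsimplex \<omega> [1,0,3] = c"
    unfolding \<omega>_def using K(3) s
    by (auto intro!: subsimplex_restrict_slice simp: singular_simplex_iff numeral_2_eq_2[symmetric])
  ultimately show thesis using that by (auto simp: tetra_iff)
qed

lemma tetra_singular: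
  assumes "tetra M a b c d"
  shows "singular_simplex 2 (top_of_set M) a" "singular_simplex 2 (top_of_set M) b"
    "singular_simplex 2 (top_of_set M) c" "singular_simplex 2 (top_of_set M) d"
  using assms by (auto simp: tetra_iff intro!: singular_subsimplex)

text \<open>Each of the six edges belongs to two faces. The first three meet in vertex 0; the last
  three bound \<open>d\<close> and thus determine the cell in which it lies.\<close>

lemma tetra_edges:
  assumes "tetra M a b c d" "t \<in> {0..1}"
  shows "a (edge_point 2 1 t) = b (edge_point 0 1 t)" "a (edge_point 2 0 t) = c (edge_point 1 0 t)"
    "b (edge_point 0 2 t) = c (edge_point 1 2 t)"
    "d (edge_point 1 0 t) = a (edge_point 1 0 t)" "d (edge_point 2 1 t) = b (edge_point 2 1 t)"
    "d (edge_point 2 0 t) = c (edge_point 2 0 t)"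
  using assms by (auto simp: tetra_iff subsimplex_edge)

text \<open>The vertex list \<open>[0,2,3,1]\<close> fixes 0 and rotates 1, 2, 3: the face
  \<open>d\<close> is rotated and the other three are permuted cyclically.\<close>

lemma tetra_P:
  assumes "tetra M a b c d"
  shows "tetra M (face b 1 2 0) (face c 1 2 0) (face a 1 2 0) (face d 1 2 0)"
proof -
  obtain \<omega> where \<omega>: "singular_simplex 3 (top_of_set M) \<omega>" and
    f: "a = subsimplex \<omega> [1,2,0]" "b = subsimplex \<omega> [0,2,3]" "c = subsimplex \<omega> [1,0,3]"
    "d = subsimplex \<omega> [1,2,3]"
    using assms by (auto simp: tetra_iff)
  have "singular_simplex 3 (top_of_set M) (subsimplex \<omega> [0,2,3,1])"
    by (rule singular_subsimplex[OF \<omega>]) auto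
  then show ?thesis
    unfolding tetra_iff f face_subsimplex
    by (intro exI[of _ "subsimplex \<omega> [0,2,3,1]"]) (simp add: subsimplex_subsimplex)
qed

text \<open>Exchanging vertices 1 and 2 reflects \<open>a\<close> and \<open>d\<close> and swaps the
  roles of \<open>b\<close> and \<open>c\<close>.\<close>

lemma tetra_Q:
  assumes "tetra M a b c d"
  shows "tetra M (face a 1 0 2) (face c 1 0 2) (face b 1 0 2) (face d 1 0 2)"
proof -
  obtain \<omega> where \<omega>: "singular_simplex 3 (top_of_set M) \<omega>" and
    f: "a = subsimplex \<omega> [1,2,0]" "b = subsimplex \<omega> [0,2,3]" "c = subsimplex \<omega> [1,0,3]"
    "d = subsimplex \<omega> [1,2,3]"
    using assms by (auto simp: tetra_iff)
  have "singular_simplex 3 (top_of_set M) (subsimplex \<omega> [0,2,1,3])"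
    by (rule singular_subsimplex[OF \<omega>]) auto
  then show ?thesis
    unfolding tetra_iff f face_subsimplex
    by (intro exI[of _ "subsimplex \<omega> [0,2,1,3]"]) (simp add: subsimplex_subsimplex)
qed

text \<open>Exchanging vertices 0 and 3 interchanges the input face \<open>f\<close> with the output
  face \<open>u\<close>; the other two faces are reoriented, which produces the words in
  \<open>P\<close> and \<open>Q\<close>.\<close>

lemma tetra_inverse:
  assumes "tetra M f a b u"
  shows "tetra M u (face (face (face a 1 0 2) 1 2 0) 1 2 0) (face (face b 1 0 2) 1 2 0) f"
proof -
  obtain \<omega> where \<omega>: "singular_simplex 3 (top_of_set M) \<omega>" and
    f: "f = subsimplex \<omega> [1,2,0]" "a = subsimplex \<omega> [0,2,3]" "b = subsimplex \<omega> [1,0,3]"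
    "u = subsimplex \<omega> [1,2,3]"
    using assms by (auto simp: tetra_iff)
  have "singular_simplex 3 (top_of_set M) (subsimplex \<omega> [3,1,2,0])"
    by (rule singular_subsimplex[OF \<omega>]) auto
  then show ?thesis
    unfolding tetra_iff f face_subsimplex
    by (intro exI[of _ "subsimplex \<omega> [3,1,2,0]"]) (simp add: subsimplex_subsimplex)
qed

lemma subsimplex_apply_triangle:
  "x \<in> standard_simplex 2 \<Longrightarrow> subsimplex \<omega> [i,j,k] x = \<omega> (vmap [i,j,k] x)"
  by (rule subsimplex_apply) (simp add: numeral_2_eq_2)

lemma rel_htpy_horn:
  assumes d: "distinct [p, q, r, s]" "{p, q, r, s} \<subseteq> {..n}"
    and u: "continuous_on (standard_simplex n) u" "u ` standard_simplex n \<subseteq> M"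
    and v: "continuous_on (standard_simplex n) v" "v ` standard_simplex n \<subseteq> M"
    and uv: "\<And>x. \<lbrakk>x \<in> standard_simplex n; x p = 0 \<or> x q = 0 \<or> x r = 0\<rbrakk> \<Longrightarrow> u x = v x"
  shows "rel_htpy {x \<in> standard_simplex n. x p = 0 \<or> x q = 0 \<or> x r = 0} (standard_simplex n) M u v"
proof (rule rel_htpy_deformation[where G = "\<lambda>z. horn_push p q r s (fst z) (snd z)"])
  show "continuous_on ({0..1} \<times> standard_simplex n) (\<lambda>z. horn_push p q r s (fst z) (snd z))"
    by (rule continuous_on_horn_push)
  show "(\<lambda>z. horn_push p q r s (fst z) (snd z)) ` ({0..1} \<times> standard_simplex n) \<subseteq> standard_simplex n"
    using horn_push_in_simplex[OF _ d] by (auto simp: image_subset_iff)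
  show "horn_push p q r s (fst (1, x)) (snd (1, x)) \<in> {x \<in> standard_simplex n. x p = 0 \<or> x q = 0 \<or> x r = 0}"
    if "x \<in> standard_simplex n" for x
    using horn_push_in_simplex[OF that d, of 1] horn_push_1[OF d(1) refl, of x] by simp
  show "horn_push p q r s (fst (t, x)) (snd (t, x)) = x"
    if "x \<in> {x \<in> standard_simplex n. x p = 0 \<or> x q = 0 \<or> x r = 0}" for t x
    using that horn_push_fixed[of x n p q r s t] by simp
qed (use u v uv in \<open>auto simp: horn_push_0\<close>)

text \<open>The opposite face of a filling is homotopic relative to its boundary to the image of that face
  under the retraction onto the horn, hence determined by the other three faces.\<close>

lemma tetra_unique:
  assumes t: "tetra M a b c d" and t': "tetra M a' b' c' d'"
    and aa: "tri_htpy M a a'" and bb: "tri_htpy M b b'" and cc: "tri_htpy M c c'"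
  shows "tri_htpy M d d'"
proof -
  let ?S = "standard_simplex 3" and ?T = "standard_simplex 2"
  let ?L = "{x \<in> ?S. x 1 = 0 \<or> x 2 = 0 \<or> x 3 = 0}"
  \<comment> \<open>The boundary of the facet opposite 0, that is, of the face to be
    compared.\<close>
  let ?E = "{x \<in> ?L. x 0 = 0}"
  note hE = rel_htpyE[OF _ triangle_boundary_subset]
  obtain ha where ha: "continuous_on ({0..1::real} \<times> ?T) ha" "ha ` ({0..1} \<times> ?T) \<subseteq> M"
    "\<And>x. x \<in> ?T \<Longrightarrow> ha (0, x) = a x" "\<And>x. x \<in> ?T \<Longrightarrow> ha (1, x) = a' x"
    "\<And>t x. \<lbrakk>t \<in> {0..1}; x \<in> triangle_boundary\<rbrakk> \<Longrightarrow> ha (t, x) = a x"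
    by (rule hE[OF aa]) (rule that; simp)
  obtain hb where hb: "continuous_on ({0..1::real} \<times> ?T) hb" "hb ` ({0..1} \<times> ?T) \<subseteq> M"
    "\<And>x. x \<in> ?T \<Longrightarrow> hb (0, x) = b x" "\<And>x. x \<in> ?T \<Longrightarrow> hb (1, x) = b' x"
    "\<And>t x. \<lbrakk>t \<in> {0..1}; x \<in> triangle_boundary\<rbrakk> \<Longrightarrow> hb (t, x) = b x"
    by (rule hE[OF bb]) (rule that; simp)
  obtain hc where hc: "continuous_on ({0..1::real} \<times> ?T) hc" "hc ` ({0..1} \<times> ?T) \<subseteq> M"
    "\<And>x. x \<in> ?T \<Longrightarrow> hc (0, x) = c x" "\<And>x. x \<in> ?T \<Longrightarrow> hc (1, x) = c' x"
    "\<And>t x. \<lbrakk>t \<in> {0..1}; x \<in> triangle_boundary\<rbrakk> \<Longrightarrow> hc (t, x) = c x"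
    by (rule hE[OF cc]) (rule that; simp)
  \<comment> \<open>The homotopies of the three faces are constant along the edges, so they match at
    every time and extend to a homotopy of tetrahedra.\<close>
  obtain K where K: "continuous_on ({0..1::real} \<times> ?S) K" "K ` ({0..1} \<times> ?S) \<subseteq> M"
    "\<forall>\<tau>\<in>{0..1}. \<forall>y\<in>?T. K (\<tau>, vmap [1,2,0] y) = ha (\<tau>, y) \<and>
       K (\<tau>, vmap [0,2,3] y) = hb (\<tau>, y) \<and> K (\<tau>, vmap [1,0,3] y) = hc (\<tau>, y)"
    by (rule tetra_extend[where T = "{0..1}" and N = M and Ka = ha and Kb = hb and Kc = hc])
       (use ha hb hc tetra_edges[OF t] in \<open>simp_all add: edge_point_in_boundary\<close>)
  have Kh: "K (\<tau>, x) = (if x 3 = 0 then ha (\<tau>, vmap [2,0,1,0] x)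
      else if x 1 = 0 then hb (\<tau>, vmap [0,0,1,2] x) else hc (\<tau>, vmap [1,0,0,2] x))"
    if "\<tau> \<in> {0..1}" "x \<in> ?L" for \<tau> x
  proof -
    have x: "x \<in> ?S" using that by simp
    note tf = tetra_facets[OF x]
    show ?thesis
      using K(3)[rule_format, OF that(1) tf(1)] K(3)[rule_format, OF that(1) tf(2)]
        K(3)[rule_format, OF that(1) tf(3)] tf(4,5,6) that(2) by auto
  qed
  \<comment> \<open>A tetrahedron with the three faces prescribed at time \<tau> agrees with
    \<open>K\<close> on the horn, hence is homotopic to that slice of \<open>K\<close> relative to
    the horn.\<close>
  have fill: "rel_htpy ?L ?S M \<omega> (\<lambda>x. K (\<tau>, x))"
    if \<omega>: "singular_simplex 3 (top_of_set M) \<omega>" and \<tau>: "\<tau> \<in> {0..1}"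
      and f: "\<And>y. y \<in> ?T \<Longrightarrow> \<omega> (vmap [1,2,0] y) = ha (\<tau>, y)"
        "\<And>y. y \<in> ?T \<Longrightarrow> \<omega> (vmap [0,2,3] y) = hb (\<tau>, y)"
        "\<And>y. y \<in> ?T \<Longrightarrow> \<omega> (vmap [1,0,3] y) = hc (\<tau>, y)" for \<omega> \<tau>
  proof (rule rel_htpy_horn[where s = 0])
    show "continuous_on ?S (\<lambda>x. K (\<tau>, x))"
      by (rule continuous_on_compose2[OF K(1)])
         (use \<tau> in \<open>auto intro: continuous_on_Pair continuous_on_const continuous_on_id\<close>)
    show "(\<lambda>x. K (\<tau>, x)) ` ?S \<subseteq> M" using K(2) \<tau> by auto
    show "\<omega> x = K (\<tau>, x)" if x: "x \<in> ?S" "x 1 = 0 \<or> x 2 = 0 \<or> x 3 = 0" for x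
    proof -
      note tf = tetra_facets[OF x(1)]
      have "x \<in> ?L" using x by simp
      from Kh[OF \<tau> this] show ?thesis
        using f(1)[OF tf(1)] f(2)[OF tf(2)] f(3)[OF tf(3)] tf(4,5,6) x(2) by auto
    qed
  qed (use \<omega> in \<open>auto simp: singular_simplex_iff\<close>)
  obtain \<omega> \<omega>' where
    \<omega>: "singular_simplex 3 (top_of_set M) \<omega>" "subsimplex \<omega> [1,2,0] = a" "subsimplex \<omega> [0,2,3] = b"
      "subsimplex \<omega> [1,0,3] = c" "subsimplex \<omega> [1,2,3] = d" and
    \<omega>': "singular_simplex 3 (top_of_set M) \<omega>'" "subsimplex \<omega>' [1,2,0] = a'"
      "subsimplex \<omega>' [0,2,3] = b'" "subsimplex \<omega>' [1,0,3] = c'" "subsimplex \<omega>' [1,2,3] = d'"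
    using t t' by (auto simp: tetra_iff)
  have 1: "rel_htpy ?L ?S M \<omega> (\<lambda>x. K (0, x))"
    by (rule fill[OF \<omega>(1)]) (simp_all add: ha(3) hb(3) hc(3) \<omega>(2-4)[symmetric] subsimplex_apply_triangle del: One_nat_def)
  have 2: "rel_htpy ?L ?S M \<omega>' (\<lambda>x. K (1, x))"
    by (rule fill[OF \<omega>'(1)]) (simp_all add: ha(4) hb(4) hc(4) \<omega>'(2-4)[symmetric] subsimplex_apply_triangle del: One_nat_def)
  \<comment> \<open>The three faces move during \<open>K\<close>, so this homotopy need not be
    relative to the horn; it is stationary on \<open>?E\<close>, which suffices for the opposite
    face.\<close>
  have 3: "rel_htpy ?E ?S M (\<lambda>x. K (0, x)) (\<lambda>x. K (1, x))"
  proof (rule rel_htpyI[where h = K])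
    fix \<tau> :: real and x assume \<tau>: "\<tau> \<in> {0..1}" and x: "x \<in> ?E"
    have bd: "vmap [2,0,1,0] x \<in> triangle_boundary" "vmap [0,0,1,2] x \<in> triangle_boundary \<or> x 1 \<noteq> 0"
      "vmap [1,0,0,2] x \<in> triangle_boundary \<or> x 2 \<noteq> 0"
    proof -
      \<comment> \<open>On \<open>?E\<close> the mass at vertex 0 vanishes, so the collapsed point
        has a zero coordinate in each case that \<open>Kh\<close> uses.\<close>
      have z: "vmap [2,0,1,0] x 2 = 0" "x 1 = 0 \<longrightarrow> vmap [0,0,1,2] x 0 = 0" "x 2 = 0 \<longrightarrow> vmap [1,0,0,2] x 1 = 0"
        using x by (auto simp: vmap_def eval_nat_numeral)
      show "vmap [2,0,1,0] x \<in> triangle_boundary" "vmap [0,0,1,2] x \<in> triangle_boundary \<or> x 1 \<noteq> 0"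
        "vmap [1,0,0,2] x \<in> triangle_boundary \<or> x 2 \<noteq> 0"
        using z tetra_facets(1-3)[of x] x by (auto simp: triangle_boundary_def le_2_cases)
    qed
    have 0: "(0::real) \<in> {0..1}" by simp
    have x': "x \<in> ?L" using x by simp
    show "K (\<tau>, x) = K (0, x)"
      unfolding Kh[OF \<tau> x'] Kh[OF 0 x'] using bd x ha(5) hb(5) hc(5) \<tau> by auto
  qed (use K in auto)
  have sub: "rel_htpy ?E ?S M u v" if "rel_htpy ?L ?S M u v" for u v
    using rel_htpy_compose[OF that, of ?S id ?E] by (auto simp: image_subset_iff continuous_on_id)
  have "rel_htpy ?E ?S M \<omega> \<omega>'"
    using rel_htpy_trans[OF rel_htpy_trans[OF sub[OF 1] 3] rel_htpy_sym[OF sub[OF 2]]] .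
  then have "tri_htpy M (\<omega> \<circ> vmap [1,2,3]) (\<omega>' \<circ> vmap [1,2,3])"
  proof (rule rel_htpy_compose)
    show "continuous_on ?T (vmap [1,2,3])"
      by (rule continuous_on_vmap[OF continuous_on_id])
    show "vmap [1,2,3] ` ?T \<subseteq> ?S"
      using vmap_in_simplex[of _ 2 "[1,2,3]" 3] by auto
    have "vmap [1,2,3] x 0 = 0" "vmap [1,2,3] x 1 = x 0" "vmap [1,2,3] x 2 = x 1"
      "vmap [1,2,3] x 3 = x 2" for x
      by (simp_all add: vmap_def eval_nat_numeral)
    then show "vmap [1,2,3] ` triangle_boundary \<subseteq> ?E"
      using vmap_in_simplex[of _ 2 "[1,2,3]" 3] by (auto simp: triangle_boundary_def le_2_cases)
  qed
  then show ?thesis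
    by (rule rel_htpy_eq)
       (simp_all add: \<omega>(5)[symmetric] \<omega>'(5)[symmetric] subsimplex_apply_triangle
         triangle_boundary_subset del: One_nat_def)
qed

text \<open>
  With vertices numbered so that \<open>a\<close> is \<open>[1,2,0]\<close>, \<open>b\<close> is \<open>[0,2,3]\<close>, \<open>d\<close> is \<open>[3,2,4]\<close> and \<open>e\<close> is \<open>[1,3,4]\<close>,
  the given tetrahedra are the facets opposite 4, 1 and 2 of a 4-simplex, the three that contain
  the edge \<open>[0,3]\<close>; the two sides of the associativity law share the face \<open>[1,2,4]\<close>.
\<close>

lemma tetra_assoc:
  assumes t1: "tetra M a b c u" and t3: "tetra M b d f v" and t4: "tetra M c (face f 1 0 2) e w"
  obtains z where "tetra M u d e z" "tetra M a v w z"
proof -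
  let ?S = "standard_simplex 4"
  obtain \<omega>1 \<omega>3 \<omega>4 where
    \<omega>1: "singular_simplex 3 (top_of_set M) \<omega>1" "subsimplex \<omega>1 [1,2,0] = a" "subsimplex \<omega>1 [0,2,3] = b"
      "subsimplex \<omega>1 [1,0,3] = c" "subsimplex \<omega>1 [1,2,3] = u" and
    \<omega>3: "singular_simplex 3 (top_of_set M) \<omega>3" "subsimplex \<omega>3 [1,2,0] = b" "subsimplex \<omega>3 [0,2,3] = d"
      "subsimplex \<omega>3 [1,0,3] = f" "subsimplex \<omega>3 [1,2,3] = v" and
    \<omega>4: "singular_simplex 3 (top_of_set M) \<omega>4" "subsimplex \<omega>4 [1,2,0] = c"
      "subsimplex \<omega>4 [0,2,3] = subsimplex f [1,0,2]"
      "subsimplex \<omega>4 [1,0,3] = e" "subsimplex \<omega>4 [1,2,3] = w"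
    using t1 t3 t4 by (auto simp: tetra_iff face_subsimplex)
  have sf: "singular_simplex 2 (top_of_set M) f" using t3 by (rule tetra_singular)
  \<comment> \<open>Swapping twice is the identity, so \<open>f\<close> itself is recovered as a
    face of \<open>\<omega>4\<close>, to be matched with the corresponding face of
    \<open>\<omega>3\<close>.\<close>
  have "subsimplex (subsimplex \<omega>4 [0,2,3]) [1,0,2] = subsimplex (subsimplex f [1,0,2]) [1,0,2]"
    by (simp add: \<omega>4)
  then have \<omega>4f: "subsimplex \<omega>4 [2,0,3] = f"
    using subsimplex_ident[OF sf] by (simp add: subsimplex_subsimplex upt_rec numeral_2_eq_2)
  have cont: "continuous_on ({0::real} \<times> {x \<in> ?S. x i = 0}) (\<lambda>z. \<omega> (vmap L (snd z)))"
    "(\<lambda>z. \<omega> (vmap L (snd z))) ` ({0::real} \<times> {x \<in> ?S. x i = 0}) \<subseteq> M"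
    if "singular_simplex 3 (top_of_set M) \<omega>" "length L = 5" "set L \<subseteq> {..3}" for \<omega> L i
  proof -
    have im: "vmap L x \<in> standard_simplex 3" if "x \<in> ?S" for x
      using vmap_in_simplex[OF that, of L 3] \<open>length L = 5\<close> \<open>set L \<subseteq> {..3}\<close> by simp
    have c: "continuous_on (standard_simplex 3) \<omega>" using that by (simp add: singular_simplex_iff)
    show "continuous_on ({0::real} \<times> {x \<in> ?S. x i = 0}) (\<lambda>z. \<omega> (vmap L (snd z)))"
      by (rule continuous_on_compose2[OF c continuous_on_vmap[OF continuous_on_snd[OF continuous_on_id]]])
         (auto simp: im)
    show "(\<lambda>z. \<omega> (vmap L (snd z))) ` ({0::real} \<times> {x \<in> ?S. x i = 0}) \<subseteq> M"
      using that im by (auto simp: singular_simplex_iff)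
  qed
  have le4: "(i::nat) \<le> 4 \<longleftrightarrow> i = 0 \<or> i = 1 \<or> i = 2 \<or> i = 3 \<or> i = 4" for i by auto
  \<comment> \<open>Two facets of the 4-simplex meet in a triangle, so they agree there as soon as
    one triangular face of each tetrahedron is the same function.\<close>
  have overlap: "\<omega> (vmap L x) = \<omega>' (vmap L' x)"
    if x: "x \<in> ?S" and R: "length R = 5" "set R \<subseteq> {..2}" "vmap [i,j,k] (vmap R x) = x"
      and L: "length L = 5" "length L' = 5" "i < 5" "j < 5" "k < 5"
      and eq: "subsimplex \<omega> [L!i, L!j, L!k] = subsimplex \<omega>' [L'!i, L'!j, L'!k]"
    for x R i j k L L' and \<omega> \<omega>' :: "(nat \<Rightarrow> real) \<Rightarrow> 'a"
  proof -
    let ?y = "vmap R x"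
    have y: "?y \<in> standard_simplex 2" using vmap_in_simplex[OF x, of R 2] R by simp
    have "vmap L x = vmap L (vmap [i,j,k] ?y)" "vmap L' x = vmap L' (vmap [i,j,k] ?y)"
      by (simp_all add: R(3))
    then show ?thesis
      using fun_cong[OF eq, of ?y] L by (simp add: vmap_vmap subsimplex_apply_triangle y)
  qed
  \<comment> \<open>The lists give the positions of the vertices 0 to 4 inside
    \<open>\<omega>1\<close>, \<open>\<omega>3\<close> and \<open>\<omega>4\<close>, seen as the
    facets \<open>[0,1,2,3]\<close>, \<open>[3,0,2,4]\<close> and \<open>[3,1,0,4]\<close>; absent
    vertices default to 0.\<close>
  obtain K where K: "continuous_on ({0::real} \<times> ?S) K" "K ` ({0} \<times> ?S) \<subseteq> M"
    "\<And>\<tau> x. \<lbrakk>\<tau> \<in> {0}; x \<in> ?S; x 4 = 0\<rbrakk> \<Longrightarrow> K (\<tau>, x) = \<omega>1 (vmap [0,1,2,3,0] (snd (\<tau>, x)))"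
    "\<And>\<tau> x. \<lbrakk>\<tau> \<in> {0}; x \<in> ?S; x 1 = 0\<rbrakk> \<Longrightarrow> K (\<tau>, x) = \<omega>3 (vmap [1,0,2,0,3] (snd (\<tau>, x)))"
    "\<And>\<tau> x. \<lbrakk>\<tau> \<in> {0}; x \<in> ?S; x 2 = 0\<rbrakk> \<Longrightarrow> K (\<tau>, x) = \<omega>4 (vmap [2,1,0,0,3] (snd (\<tau>, x)))"
  proof (rule horn_extension[where p = 4 and q = 1 and r = 2 and s = 0 and n = 4 and T = "{0::real}" and N = M
        and ?K1.0 = "\<lambda>z. \<omega>1 (vmap [0,1,2,3,0] (snd z))" and ?K2.0 = "\<lambda>z. \<omega>3 (vmap [1,0,2,0,3] (snd z))"
        and ?K3.0 = "\<lambda>z. \<omega>4 (vmap [2,1,0,0,3] (snd z))"])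
    fix \<tau> x assume x: "x \<in> ?S"
    show "\<omega>1 (vmap [0,1,2,3,0] (snd (\<tau>::real, x))) = \<omega>3 (vmap [1,0,2,0,3] (snd (\<tau>, x)))"
      if "x 4 = 0" "x 1 = 0"
    proof -
      have "vmap [0,2,3] (vmap [0,0,1,2,0] x) = x"
        by (subst vmap_vmap; (rule vmap_ident[OF x])?) (use that in \<open>auto simp: le4\<close>)
      then show ?thesis
        unfolding snd_conv by (rule overlap[OF x, rotated 2]) (simp_all add: \<omega>1 \<omega>3 del: One_nat_def)
    qed
    show "\<omega>1 (vmap [0,1,2,3,0] (snd (\<tau>::real, x))) = \<omega>4 (vmap [2,1,0,0,3] (snd (\<tau>, x)))"
      if "x 4 = 0" "x 2 = 0"
    proof -
      have "vmap [1,0,3] (vmap [1,0,0,2,0] x) = x"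
        by (subst vmap_vmap; (rule vmap_ident[OF x])?) (use that in \<open>auto simp: le4\<close>)
      then show ?thesis
        unfolding snd_conv by (rule overlap[OF x, rotated 2]) (simp_all add: \<omega>1 \<omega>4 del: One_nat_def)
    qed
    show "\<omega>3 (vmap [1,0,2,0,3] (snd (\<tau>::real, x))) = \<omega>4 (vmap [2,1,0,0,3] (snd (\<tau>, x)))"
      if "x 1 = 0" "x 2 = 0"
    proof -
      have "vmap [0,3,4] (vmap [0,0,0,1,2] x) = x"
        by (subst vmap_vmap; (rule vmap_ident[OF x])?) (use that in \<open>auto simp: le4\<close>)
      then show ?thesis
        unfolding snd_conv by (rule overlap[OF x, rotated 2]) (simp_all add: \<omega>3 \<omega>4 \<omega>4f del: One_nat_def)
    qed
  qed (simp_all add: cont \<omega>1 \<omega>3 \<omega>4)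
  define \<Omega> where "\<Omega> = restrict (\<lambda>x. K (0, x)) ?S"
  have \<Omega>: "singular_simplex 4 (top_of_set M) \<Omega>"
    unfolding \<Omega>_def by (rule restrict_slice_singular[OF K(1,2)]) simp
  have facet: "subsimplex \<Omega> L = \<omega>"
    if \<omega>: "singular_simplex 3 (top_of_set M) \<omega>" and L: "length L = 4" "set L \<subseteq> {..4}" and R: "length R = 5"
      "map ((!) R) L = [0,1,2,3]"
      and i: "\<And>x. \<lbrakk>x \<in> ?S; x i = 0\<rbrakk> \<Longrightarrow> K (0, x) = \<omega> (vmap R x)" "i \<notin> set L" for \<omega> L R i
    unfolding \<Omega>_def
  proof (rule subsimplex_restrict_slice)
    show "\<omega> \<in> extensional (standard_simplex (length L - 1))"
      using \<omega> L by (simp add: singular_simplex_iff)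
    show "\<forall>y\<in>standard_simplex (length L - 1). K (0, vmap L y) = \<omega> y"
    proof
      fix y assume "y \<in> standard_simplex (length L - 1)"
      then have y: "y \<in> standard_simplex 3" using L by simp
      have "vmap L y \<in> ?S" using vmap_in_simplex[OF y, of L 4] L by simp
      moreover have "vmap L y i = 0"
        unfolding vmap_def using i(2) by (intro sum.neutral) (auto dest: nth_mem)
      ultimately have "K (0, vmap L y) = \<omega> (vmap R (vmap L y))" by (rule i(1))
      also have "vmap R (vmap L y) = vmap [0,1,2,3] y"
        using L R by (subst vmap_vmap) auto
      also have "\<dots> = y" by (rule vmap_ident[OF y]) (auto simp: le_3_cases)
      finally show "K (0, vmap L y) = \<omega> y" .
    qed
  qed (use L in auto)
  have o1: "subsimplex \<Omega> [0,1,2,3] = \<omega>1"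
    by (rule facet[OF \<omega>1(1), where R = "[0,1,2,3,0]" and i = 4]) (use K(3) in auto)
  have o3: "subsimplex \<Omega> [3,0,2,4] = \<omega>3"
    by (rule facet[OF \<omega>3(1), where R = "[1,0,2,0,3]" and i = 1]) (use K(4) in auto)
  have o4: "subsimplex \<Omega> [3,1,0,4] = \<omega>4"
    by (rule facet[OF \<omega>4(1), where R = "[2,1,0,0,3]" and i = 2]) (use K(5) in auto)
  \<comment> \<open>This and the next are the facets opposite 0 and 3, which were not prescribed:
    one for each side of the law.\<close>
  have s2: "singular_simplex 3 (top_of_set M) (subsimplex \<Omega> [3,1,2,4])"
    by (rule singular_subsimplex[OF \<Omega>]) auto
  have s5: "singular_simplex 3 (top_of_set M) (subsimplex \<Omega> [0,1,2,4])"
    by (rule singular_subsimplex[OF \<Omega>]) auto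
  show thesis
  proof
    show "tetra M u d e (subsimplex \<Omega> [1,2,4])"
      unfolding tetra_iff \<omega>1(5)[symmetric] \<omega>3(3)[symmetric] \<omega>4(4)[symmetric] o1[symmetric] o3[symmetric] o4[symmetric]
      using s2 by (intro exI[of _ "subsimplex \<Omega> [3,1,2,4]"]) (simp add: subsimplex_subsimplex)
    show "tetra M a v w (subsimplex \<Omega> [1,2,4])"
      unfolding tetra_iff \<omega>1(2)[symmetric] \<omega>3(5)[symmetric] \<omega>4(5)[symmetric] o1[symmetric] o3[symmetric] o4[symmetric]
      using s5 by (intro exI[of _ "subsimplex \<Omega> [0,1,2,4]"]) (simp add: subsimplex_subsimplex)
  qed
qed

section \<open>The fundamental group\<close>

lemma loop_class_eqI: "homotopic_paths M p q \<Longrightarrow> loop_class M p = loop_class M q"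
  unfolding loop_class_def using homotopic_paths_trans homotopic_paths_sym by blast

lemma in_loop_class_loops:
  assumes "p \<in> loops M m" "q \<in> loop_class M p"
  shows "q \<in> loops M m"
proof -
  have h: "homotopic_paths M p q" using assms(2) by (simp add: loop_class_def)
  show ?thesis
    using assms(1) homotopic_paths_imp_path[OF h] homotopic_paths_imp_subset[OF h]
      homotopic_paths_imp_pathstart[OF h] homotopic_paths_imp_pathfinish[OF h]
    by (simp add: loops_def)
qed

lemma loops_self: "p \<in> loops M m \<Longrightarrow> p \<in> loop_class M p"
  by (simp add: loops_def loop_class_def)

lemma loops_const: "m \<in> M \<Longrightarrow> (\<lambda>_. m) \<in> loops M m"
  by (auto simp: loops_def path_def path_image_def pathstart_def pathfinish_def)

lemma loops_join: "\<lbrakk>p \<in> loops M m; q \<in> loops M m\<rbrakk> \<Longrightarrow> p +++ q \<in> loops M m"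
  by (simp add: loops_def path_join subset_path_image_join)

lemma loops_reverse: "p \<in> loops M m \<Longrightarrow> reversepath p \<in> loops M m"
  by (simp add: loops_def)

lemma loops_compose:
  "\<lbrakk>p \<in> loops M m; continuous_on M f; f ` M \<subseteq> N\<rbrakk> \<Longrightarrow> f \<circ> p \<in> loops N (f m)"
  by (auto simp: loops_def path_image_compose pathstart_compose pathfinish_compose
      intro!: path_continuous_image intro: continuous_on_subset)

lemma pi1_carrierE:
  assumes "\<alpha> \<in> carrier (pi1 M m)"
  obtains p where "p \<in> loops M m" "\<alpha> = loop_class M p"
  using assms by (auto simp: pi1_def)

lemma pi1_carrierI: "p \<in> loops M m \<Longrightarrow> loop_class M p \<in> carrier (pi1 M m)"
  by (auto simp: pi1_def)

lemma pi1_one: "\<one>\<^bsub>pi1 M m\<^esub> = loop_class M (\<lambda>_. m)"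
  by (simp add: pi1_def)

text \<open>Joining respects homotopy, so all sets in the defining union are equal; the index sets
  are nonempty and the union collapses.\<close>

lemma pi1_mult:
  assumes p: "p \<in> loops M m" and q: "q \<in> loops M m"
  shows "loop_class M p \<otimes>\<^bsub>pi1 M m\<^esub> loop_class M q = loop_class M (p +++ q)"
proof -
  have eq: "loop_class M (p' +++ q') = loop_class M (p +++ q)"
    if "p' \<in> loop_class M p" "q' \<in> loop_class M q" for p' q'
  proof (rule loop_class_eqI[symmetric])
    show "homotopic_paths M (p +++ q) (p' +++ q')"
      using that p q by (intro homotopic_paths_join) (auto simp: loop_class_def loops_def)
  qed
  have "loop_class M p \<otimes>\<^bsub>pi1 M m\<^esub> loop_class M q =
      (\<Union>p'\<in>loop_class M p. \<Union>q'\<in>loop_class M q. loop_class M (p' +++ q'))"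
    by (simp add: pi1_def)
  also have "\<dots> = (\<Union>p'\<in>loop_class M p. \<Union>q'\<in>loop_class M q. loop_class M (p +++ q))"
    by (intro SUP_cong refl eq)
  also have "\<dots> = loop_class M (p +++ q)"
    using loops_self[OF p] loops_self[OF q] by blast
  finally show ?thesis .
qed

text \<open>The joined path waits at the base point and then runs \<open>p\<close> on the second
  half, so it is \<open>p\<close> reparametrised by \<open>max 0 (2 * t - 1)\<close>.\<close>

lemma homotopic_const_join:
  assumes p: "p \<in> loops M m"
  shows "homotopic_paths M ((\<lambda>_. m) +++ p) p"
proof (rule homotopic_paths_sym, rule homotopic_paths_reparametrize[where f = "\<lambda>t. max 0 (2 * t - 1)"])
  show "continuous_on {0..1} (\<lambda>t::real. max 0 (2 * t - 1))"
    by (intro continuous_intros)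
  show "((\<lambda>_. m) +++ p) t = p (max 0 (2 * t - 1))" if "t \<in> {0..1}" for t
  proof (cases "t \<le> 1/2")
    case True
    then have "max 0 (2 * t - 1) = 0" by simp
    with True p show ?thesis by (simp add: joinpaths_def loops_def pathstart_def)
  next
    case False
    then have "max 0 (2 * t - 1) = 2 * t - 1" by simp
    with False show ?thesis by (simp add: joinpaths_def)
  qed
qed (use p in \<open>auto simp: loops_def\<close>)

lemma homotopic_reverse_join:
  assumes p: "p \<in> loops M m"
  shows "homotopic_paths M (reversepath p +++ p) (\<lambda>_. m)"
proof -
  have c: "continuous_on {0..1} p" and im: "p ` {0..1} \<subseteq> M" and p1: "p 1 = m"
    using p by (auto simp: loops_def path_def path_image_def pathfinish_def)
  \<comment> \<open>Here \<open>snd z\<close> is the path parameter. The absolute value falls from 1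
    to 0 and rises again, which is the reversed loop followed by the loop; raising the lower bound
    \<open>fst z\<close> to 1 shortens this excursion to the end point.\<close>
  let ?h = "\<lambda>z::real \<times> real. p (max \<bar>1 - 2 * snd z\<bar> (fst z))"
  have r: "max \<bar>1 - 2 * snd z\<bar> (fst z) \<in> {0..1}" if "z \<in> {0..1} \<times> {0..1}" for z :: "real \<times> real"
    using that by auto
  show ?thesis
    unfolding homotopic_paths
  proof (intro exI[of _ ?h] conjI ballI)
    show "continuous_on ({0..1} \<times> {0..1}) ?h"
      by (rule continuous_on_compose2[OF c]) (use r in \<open>auto intro!: continuous_intros\<close>)
    show "?h \<in> {0..1} \<times> {0..1} \<rightarrow> M" using r im by blast
    fix t :: real assume t: "t \<in> {0..1}"
    show "?h (0, t) = (reversepath p +++ p) t"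
    proof (cases "t \<le> 1/2")
      case True
      then have "max \<bar>1 - 2 * t\<bar> 0 = 1 - 2 * t" by simp
      with True show ?thesis by (simp add: joinpaths_def reversepath_def)
    next
      case False
      then have "max \<bar>1 - 2 * t\<bar> 0 = 2 * t - 1" by simp
      with False show ?thesis by (simp add: joinpaths_def)
    qed
    show "?h (1, t) = m"
      using t p1 by (simp add: max_def abs_le_iff)
    show "pathstart (?h \<circ> Pair t) = pathstart (reversepath p +++ p)"
         "pathfinish (?h \<circ> Pair t) = pathfinish (reversepath p +++ p)"
      using t p1 by (auto simp: pathstart_def pathfinish_def joinpaths_def reversepath_def max_def)
  qed
qed

lemma pi1_group:
  assumes m: "m \<in> M"
  shows "group (pi1 M m)"
proof (rule groupI)
  show "\<one>\<^bsub>pi1 M m\<^esub> \<in> carrier (pi1 M m)"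
    unfolding pi1_one by (rule pi1_carrierI[OF loops_const[OF m]])
  fix x y z
  assume x: "x \<in> carrier (pi1 M m)"
  then obtain p where p: "p \<in> loops M m" "x = loop_class M p" by (rule pi1_carrierE)
  show "\<one>\<^bsub>pi1 M m\<^esub> \<otimes>\<^bsub>pi1 M m\<^esub> x = x"
    unfolding pi1_one p(2) pi1_mult[OF loops_const[OF m] p(1)]
    by (rule loop_class_eqI[OF homotopic_const_join[OF p(1)]])
  show "\<exists>y\<in>carrier (pi1 M m). y \<otimes>\<^bsub>pi1 M m\<^esub> x = \<one>\<^bsub>pi1 M m\<^esub>"
  proof
    show "loop_class M (reversepath p) \<otimes>\<^bsub>pi1 M m\<^esub> x = \<one>\<^bsub>pi1 M m\<^esub>"
      unfolding p(2) pi1_one pi1_mult[OF loops_reverse[OF p(1)] p(1)]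
      by (rule loop_class_eqI[OF homotopic_reverse_join[OF p(1)]])
  qed (rule pi1_carrierI[OF loops_reverse[OF p(1)]])
  assume y: "y \<in> carrier (pi1 M m)"
  then obtain q where q: "q \<in> loops M m" "y = loop_class M q" by (rule pi1_carrierE)
  show "x \<otimes>\<^bsub>pi1 M m\<^esub> y \<in> carrier (pi1 M m)"
    using p q by (simp add: pi1_mult pi1_carrierI loops_join)
  assume z: "z \<in> carrier (pi1 M m)"
  then obtain r where r: "r \<in> loops M m" "z = loop_class M r" by (rule pi1_carrierE)
  have "homotopic_paths M (p +++ (q +++ r)) ((p +++ q) +++ r)"
    using p q r by (intro homotopic_paths_assoc) (auto simp: loops_def)
  then show "(x \<otimes>\<^bsub>pi1 M m\<^esub> y) \<otimes>\<^bsub>pi1 M m\<^esub> z = x \<otimes>\<^bsub>pi1 M m\<^esub> (y \<otimes>\<^bsub>pi1 M m\<^esub> z)"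
    using p q r by (simp add: pi1_mult loops_join loop_class_eqI[symmetric])
qed

lemma pi1_inv:
  assumes m: "m \<in> M" and p: "p \<in> loops M m"
  shows "inv\<^bsub>pi1 M m\<^esub> (loop_class M p) = loop_class M (reversepath p)"
proof (rule group.inv_equality[OF pi1_group[OF m]])
  show "loop_class M (reversepath p) \<otimes>\<^bsub>pi1 M m\<^esub> loop_class M p = \<one>\<^bsub>pi1 M m\<^esub>"
    unfolding pi1_one pi1_mult[OF loops_reverse[OF p] p]
    by (rule loop_class_eqI[OF homotopic_reverse_join[OF p]])
qed (use p in \<open>simp_all add: pi1_carrierI loops_reverse\<close>)

lemma pi1_map_loop_class:
  assumes p: "p \<in> loops M m" and f: "continuous_on M f" "f ` M \<subseteq> N"
  shows "pi1_map N f (loop_class M p) = loop_class N (f \<circ> p)"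
proof -
  have eq: "loop_class N (f \<circ> q) = loop_class N (f \<circ> p)" if "q \<in> loop_class M p" for q
    using that homotopic_paths_continuous_image[of M p q f N] f
    by (intro loop_class_eqI[symmetric]) (auto simp: loop_class_def image_subset_iff_funcset)
  have "pi1_map N f (loop_class M p) = (\<Union>q\<in>loop_class M p. loop_class N (f \<circ> q))"
    by (simp add: pi1_map_def)
  also have "\<dots> = (\<Union>q\<in>loop_class M p. loop_class N (f \<circ> p))"
    by (intro SUP_cong refl eq)
  also have "\<dots> = loop_class N (f \<circ> p)"
    using loops_self[OF p] by blast
  finally show ?thesis .
qed

lemma pi1_map_hom:
  assumes m: "m \<in> M" and f: "continuous_on M f" "f ` M \<subseteq> N"
  shows "pi1_map N f \<in> hom (pi1 M m) (pi1 N (f m))"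
proof (rule homI)
  fix x assume "x \<in> carrier (pi1 M m)"
  then obtain p where p: "p \<in> loops M m" "x = loop_class M p" by (rule pi1_carrierE)
  show "pi1_map N f x \<in> carrier (pi1 N (f m))"
    unfolding p(2) pi1_map_loop_class[OF p(1) f] by (rule pi1_carrierI[OF loops_compose[OF p(1) f]])
  fix y assume "y \<in> carrier (pi1 M m)"
  then obtain q where q: "q \<in> loops M m" "y = loop_class M q" by (rule pi1_carrierE)
  show "pi1_map N f (x \<otimes>\<^bsub>pi1 M m\<^esub> y) = pi1_map N f x \<otimes>\<^bsub>pi1 N (f m)\<^esub> pi1_map N f y"
    unfolding p(2) q(2) pi1_mult[OF p(1) q(1)] pi1_map_loop_class[OF p(1) f]
      pi1_map_loop_class[OF q(1) f] pi1_map_loop_class[OF loops_join[OF p(1) q(1)] f]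
      pi1_mult[OF loops_compose[OF p(1) f] loops_compose[OF q(1) f]] path_compose_join ..
qed

section \<open>Groups without elements of order two and sections compatible with reversal\<close>

lemma (in group) inv_eq_self_imp_one:
  assumes "\<forall>g\<in>carrier G. ord g \<noteq> 2" "x \<in> carrier G" "inv x = x"
  shows "x = \<one>"
proof -
  have "x [^] (2::nat) = \<one>"
    using assms(2) r_inv[OF assms(2)] unfolding assms(3) by (simp add: numeral_2_eq_2)
  then have "ord x dvd 2" using pow_eq_id[OF assms(2)] by blast
  then have "ord x = 1" using assms(1,2) by (metis prime_nat_iff two_is_prime_nat)
  then show ?thesis using assms(2) by (metis ord_eq_1)
qed

text \<open>Since no element other than the identity is its own inverse, one element of each pair
  \<open>{x, inv x}\<close> can be singled out; this is where the absence of elements of order two enters.\<close>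

lemma (in group) inverse_pair_choice:
  assumes "\<forall>g\<in>carrier G. ord g \<noteq> 2"
  obtains S where "\<And>x. \<lbrakk>x \<in> carrier G; x \<noteq> \<one>\<rbrakk> \<Longrightarrow> x \<in> S \<longleftrightarrow> inv x \<notin> S"
proof -
  \<comment> \<open>The choice depends only on the unordered pair, so it is the same for
    \<open>x\<close> and its inverse; the elements that are their own choice form the set.\<close>
  define c where "c x = (SOME y. y \<in> {x, inv x})" for x
  have c: "c x \<in> {x, inv x}" for x
    unfolding c_def by (rule someI[of _ x]) simp
  have ci: "c (inv x) = c x" if "x \<in> carrier G" for x
    using that by (simp add: c_def insert_commute)
  show thesis
  proof
    fix x assume x: "x \<in> carrier G" "x \<noteq> \<one>"
    then have "inv x \<noteq> x" using inv_eq_self_imp_one[OF assms] by blast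
    then show "x \<in> {x. c x = x} \<longleftrightarrow> inv x \<notin> {x. c x = x}"
      using c[of x] ci[OF x(1)] by auto
  qed
qed

text \<open>One member of each inverse pair keeps an arbitrary loop, the other gets the reverse of
  that loop, and the identity gets the constant loop.\<close>

lemma loop_section_exists:
  assumes m: "m \<in> M" and o: "\<forall>g\<in>carrier (pi1 M m). group.ord (pi1 M m) g \<noteq> 2"
  shows "\<exists>s. loop_section M m s"
proof -
  interpret group "pi1 M m" by (rule pi1_group[OF m])
  let ?G = "pi1 M m"
  obtain S where S: "\<And>x. \<lbrakk>x \<in> carrier ?G; x \<noteq> \<one>\<^bsub>?G\<^esub>\<rbrakk> \<Longrightarrow> x \<in> S \<longleftrightarrow> inv\<^bsub>?G\<^esub> x \<notin> S"
    using inverse_pair_choice[OF o] by blast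
  have "\<forall>\<alpha>\<in>carrier ?G. \<exists>p. p \<in> loops M m \<and> \<alpha> = loop_class M p"
    by (meson pi1_carrierE)
  then obtain rep where rep: "\<And>\<alpha>. \<alpha> \<in> carrier ?G \<Longrightarrow> rep \<alpha> \<in> loops M m \<and> \<alpha> = loop_class M (rep \<alpha>)"
    by metis
  define s where "s \<alpha> = (if \<alpha> = \<one>\<^bsub>?G\<^esub> then (\<lambda>_. m) else if \<alpha> \<in> S then rep \<alpha>
    else reversepath (rep (inv\<^bsub>?G\<^esub> \<alpha>)))" for \<alpha>
  have "s \<alpha> \<in> \<alpha>" if a: "\<alpha> \<in> carrier ?G" for \<alpha>
  proof -
    have "reversepath (rep (inv\<^bsub>?G\<^esub> \<alpha>)) \<in> \<alpha>"
      using loops_self[OF loops_reverse] pi1_inv[OF m] rep[OF inv_closed[OF a]] a by (metis inv_inv)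
    moreover have "rep \<alpha> \<in> \<alpha>" using rep[OF a] loops_self by metis
    moreover have "(\<lambda>_. m) \<in> \<one>\<^bsub>?G\<^esub>" unfolding pi1_one by (rule loops_self[OF loops_const[OF m]])
    ultimately show ?thesis by (simp add: s_def)
  qed
  moreover have "s (inv\<^bsub>?G\<^esub> \<alpha>) t = s \<alpha> (1 - t)" if "\<alpha> \<in> carrier ?G" for \<alpha> t
    using S[of \<alpha>] that by (auto simp: s_def reversepath_def inv_eq_1_iff)
  ultimately have "loop_section M m s"
    by (auto simp: loop_section_def s_def)
  then show ?thesis by (rule exI[of "loop_section M m" s])
qed

section \<open>Triangles with prescribed edges\<close>

text \<open>An index list says where each vertex goes, whereas the right-hand side lists
  coordinates; hence \<open>[1, 2, 0]\<close> is the inverse permutation of the subscripts 2, 0,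
  1.\<close>

lemma vmap_cycle: "vmap [1, 2, 0] x = (\<lambda>_. 0)(0 := x 2, 1 := x 0, 2 := x 1)"
  by (auto simp: vmap_def fun_eq_iff eval_nat_numeral)

lemma vmap_swap: "vmap [1, 0, 2] x = (\<lambda>_. 0)(0 := x 1, 1 := x 0, 2 := x 2)"
  by (auto simp: vmap_def fun_eq_iff eval_nat_numeral)

lemma Gamma_P_image: "Gamma_P A = (\<lambda>a. face a 1 2 0) ` A"
  unfolding Gamma_P_def face_subsimplex subsimplex_def simplex_map_def vmap_cycle[symmetric]
  by (simp add: numeral_2_eq_2 comp_def)

lemma Gamma_Q_image: "Gamma_Q A = (\<lambda>a. face a 1 0 2) ` A"
  unfolding Gamma_Q_def face_subsimplex subsimplex_def simplex_map_def vmap_swap[symmetric]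
  by (simp add: numeral_2_eq_2 comp_def)

lemma face_face:
  assumes "i' < 3" "j' < 3" "l' < 3"
  shows "face (face a i j l) i' j' l' = face a ([i,j,l] ! i') ([i,j,l] ! j') ([i,j,l] ! l')"
  using assms by (simp add: face_subsimplex subsimplex_subsimplex)

lemma face_ident: "singular_simplex 2 (top_of_set M) a \<Longrightarrow> face a 0 1 2 = a"
  using subsimplex_ident[of 2 M a] by (simp add: face_subsimplex upt_rec numeral_2_eq_2)

lemma singular_face2:
  "\<lbrakk>singular_simplex 2 (top_of_set M) a; i \<le> 2; j \<le> 2; l \<le> 2\<rbrakk>
    \<Longrightarrow> singular_simplex 2 (top_of_set M) (face a i j l)"
  unfolding face_subsimplex by (rule singular_subsimplex) auto

text \<open>The inverse relabelling carries homotopies back, so the image of a class is a whole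
  class and not just part of one.\<close>

lemma face_image_triangle_class:
  fixes a :: "(nat \<Rightarrow> real) \<Rightarrow> 'a::topological_space"
  assumes a: "singular_simplex 2 (top_of_set M) a"
    and L: "i \<le> 2" "j \<le> 2" "l \<le> 2" and L': "i' \<le> 2" "j' \<le> 2" "l' \<le> 2"
    and inv1: "\<And>b::(nat \<Rightarrow> real) \<Rightarrow> 'a. face (face b i j l) i' j' l' = face b 0 1 2"
    and inv2: "\<And>b::(nat \<Rightarrow> real) \<Rightarrow> 'a. face (face b i' j' l') i j l = face b 0 1 2"
  shows "(\<lambda>a. face a i j l) ` triangle_class M a = triangle_class M (face a i j l)"
proof
  have *: "tri_htpy M (face b i j l) (face c i j l)"
    if "tri_htpy M b c" "i \<le> 2" "j \<le> 2" "l \<le> 2" for b c i j l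
    unfolding face_subsimplex using that by (intro tri_htpy_subsimplex) auto
  show "(\<lambda>a. face a i j l) ` triangle_class M a \<subseteq> triangle_class M (face a i j l)"
    using L * by (auto simp: triangle_class_iff singular_face2)
  show "triangle_class M (face a i j l) \<subseteq> (\<lambda>a. face a i j l) ` triangle_class M a"
  proof
    fix b assume "b \<in> triangle_class M (face a i j l)"
    then have b: "singular_simplex 2 (top_of_set M) b" "tri_htpy M (face a i j l) b"
      by (auto simp: triangle_class_iff)
    have "tri_htpy M a (face b i' j' l')"
      using *[OF b(2) L'] by (simp add: inv1 face_ident[OF a] del: One_nat_def)
    then have "face b i' j' l' \<in> triangle_class M a"
      using b(1) L' by (simp add: triangle_class_iff singular_face2)
    moreover have "b = face (face b i' j' l') i j l"
      by (simp add: inv2 face_ident[OF b(1)] del: One_nat_def)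
    ultimately show "b \<in> (\<lambda>a. face a i j l) ` triangle_class M a" by blast
  qed
qed

lemma Gamma_P_class:
  assumes "singular_simplex 2 (top_of_set M) a"
  shows "Gamma_P (triangle_class M a) = triangle_class M (face a 1 2 0)"
  unfolding Gamma_P_image
  by (rule face_image_triangle_class[OF assms, where i' = 2 and j' = 0 and l' = 1])
     (simp_all add: face_face)

lemma Gamma_Q_class:
  assumes "singular_simplex 2 (top_of_set M) a"
  shows "Gamma_Q (triangle_class M a) = triangle_class M (face a 1 0 2)"
  unfolding Gamma_Q_image
  by (rule face_image_triangle_class[OF assms, where i' = 1 and j' = 0 and l' = 2])
     (simp_all add: face_face)

text \<open>The filling selected inside \<open>Gamma_m\<close> may have other representatives as
  faces; by \<open>tetra_unique\<close> its last face still represents the same class. From here on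
  any filling computes \<open>m\<close>.\<close>

lemma Gamma_m_class:
  assumes t: "tetra M a b c d"
  shows "Gamma_m M (triangle_class M a) (triangle_class M b) (triangle_class M c) = triangle_class M d"
proof -
  define \<omega> where "\<omega> = (SOME \<omega>. \<exists>a'\<in>triangle_class M a. \<exists>b'\<in>triangle_class M b. \<exists>c'\<in>triangle_class M c.
      tetrahedron_filling M a' b' c' \<omega>)"
  obtain \<omega>0 where "tetrahedron_filling M a b c \<omega>0"
    using t by (auto simp: tetra_def)
  then have "\<exists>\<omega>. \<exists>a'\<in>triangle_class M a. \<exists>b'\<in>triangle_class M b. \<exists>c'\<in>triangle_class M c.
      tetrahedron_filling M a' b' c' \<omega>"
    using triangle_class_self tetra_singular(1-3)[OF t] by blast
  then have "\<exists>a'\<in>triangle_class M a. \<exists>b'\<in>triangle_class M b. \<exists>c'\<in>triangle_class M c.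
      tetrahedron_filling M a' b' c' \<omega>"
    unfolding \<omega>_def by (rule someI_ex)
  then obtain a' b' c' where *: "tri_htpy M a a'" "tri_htpy M b b'" "tri_htpy M c c'"
    "tetrahedron_filling M a' b' c' \<omega>"
    by (auto simp: triangle_class_iff)
  then have "tetra M a' b' c' (face \<omega> 1 2 3)" by (auto simp: tetra_def)
  from tetra_unique[OF t this *(1-3)] show ?thesis
    unfolding Gamma_m_def \<omega>_def[symmetric] by (rule triangle_class_eqI[symmetric])
qed

section \<open>The operations on cells with edges given by a section, and the Delta-group
  laws\<close>

locale pointed_section =
  fixes M :: "'a::topological_space set" and m :: 'a and s :: "(real \<Rightarrow> 'a) set \<Rightarrow> real \<Rightarrow> 'a"
  assumes base: "m \<in> M" and sect: "loop_section M m s"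
begin

abbreviation G where "G \<equiv> pi1 M m"
abbreviation T where "T \<equiv> triangles M m s"
abbreviation cls where "cls \<equiv> triangle_class M"

sublocale group G by (rule pi1_group[OF base])

lemma s_inv: "\<lbrakk>\<alpha> \<in> carrier G; t \<in> {0..1}\<rbrakk> \<Longrightarrow> s (inv\<^bsub>G\<^esub> \<alpha>) t = s \<alpha> (1 - t)"
  using sect by (simp add: loop_section_def)

lemma triangles_singular: "a \<in> T \<alpha> \<beta> \<Longrightarrow> singular_simplex 2 (top_of_set M) a"
  by (simp add: triangles_def)

lemma triangles_edge:
  assumes "a \<in> T \<alpha> \<beta>" "t \<in> {0..1}"
  shows "a (edge_point 1 0 t) = s \<alpha> t" "a (edge_point 2 1 t) = s \<beta> t"
    "a (edge_point 2 0 t) = s (\<beta> \<otimes>\<^bsub>G\<^esub> \<alpha>) t"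
    "a (edge_point 0 1 t) = s \<alpha> (1 - t)" "a (edge_point 1 2 t) = s \<beta> (1 - t)"
    "a (edge_point 0 2 t) = s (\<beta> \<otimes>\<^bsub>G\<^esub> \<alpha>) (1 - t)"
  using assms edge_point_reverse[of 0 1 t] edge_point_reverse[of 1 2 t] edge_point_reverse[of 0 2 t]
  by (auto simp: triangles_def)

lemma trianglesI:
  assumes "singular_simplex 2 (top_of_set M) a"
    and "\<And>t. t \<in> {0..1} \<Longrightarrow> a (edge_point 1 0 t) = s \<alpha> t"
    and "\<And>t. t \<in> {0..1} \<Longrightarrow> a (edge_point 2 1 t) = s \<beta> t"
    and "\<And>t. t \<in> {0..1} \<Longrightarrow> a (edge_point 2 0 t) = s (\<beta> \<otimes>\<^bsub>G\<^esub> \<alpha>) t"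
  shows "a \<in> T \<alpha> \<beta>"
  using assms by (simp add: triangles_def)

lemma face_edge:
  "\<lbrakk>p < 3; q < 3; t \<in> {0..1}\<rbrakk>
    \<Longrightarrow> face a i j l (edge_point p q t) = a (edge_point ([i,j,l] ! p) ([i,j,l] ! q) t)"
  unfolding face_subsimplex by (rule subsimplex_edge) auto

text \<open>The relabelled edges read \<beta>, the reverse of \<beta>\<alpha> and the reverse of
  \<alpha>; reversal is inversion by the choice of \<open>s\<close>.\<close>

lemma triangles_P:
  assumes "\<alpha> \<in> carrier G" "\<beta> \<in> carrier G" "a \<in> T \<alpha> \<beta>"
  shows "face a 1 2 0 \<in> T \<beta> (inv\<^bsub>G\<^esub> \<alpha> \<otimes>\<^bsub>G\<^esub> inv\<^bsub>G\<^esub> \<beta>)"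
proof -
  have "inv\<^bsub>G\<^esub> \<alpha> \<otimes>\<^bsub>G\<^esub> inv\<^bsub>G\<^esub> \<beta> = inv\<^bsub>G\<^esub> (\<beta> \<otimes>\<^bsub>G\<^esub> \<alpha>)" "(inv\<^bsub>G\<^esub> \<alpha> \<otimes>\<^bsub>G\<^esub> inv\<^bsub>G\<^esub> \<beta>) \<otimes>\<^bsub>G\<^esub> \<beta> = inv\<^bsub>G\<^esub> \<alpha>"
    using assms(1,2) by (simp_all add: inv_mult_group m_assoc)
  then show ?thesis
    by (intro trianglesI singular_face2 triangles_singular[OF assms(3)])
       (use assms triangles_edge[OF assms(3)] in \<open>simp_all add: face_edge s_inv del: One_nat_def\<close>)
qed

lemma triangles_Q:
  assumes "\<alpha> \<in> carrier G" "\<beta> \<in> carrier G" "a \<in> T \<alpha> \<beta>"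
  shows "face a 1 0 2 \<in> T (inv\<^bsub>G\<^esub> \<alpha>) (\<beta> \<otimes>\<^bsub>G\<^esub> \<alpha>)"
proof -
  have "(\<beta> \<otimes>\<^bsub>G\<^esub> \<alpha>) \<otimes>\<^bsub>G\<^esub> inv\<^bsub>G\<^esub> \<alpha> = \<beta>"
    using assms(1,2) by (simp add: m_assoc)
  then show ?thesis
    by (intro trianglesI singular_face2 triangles_singular[OF assms(3)])
       (use assms triangles_edge[OF assms(3)] in \<open>simp_all add: face_edge s_inv del: One_nat_def\<close>)
qed

text \<open>The middle class cancels; this is why the edge \<open>[2,0]\<close> of \<open>c\<close>
  serves as the edge \<open>[2,0]\<close> of the new face.\<close>

lemma mult_cancel_mid:
  "\<lbrakk>x \<in> carrier G; y \<in> carrier G; z \<in> carrier G\<rbrakk>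
    \<Longrightarrow> (inv\<^bsub>G\<^esub> z \<otimes>\<^bsub>G\<^esub> y) \<otimes>\<^bsub>G\<^esub> (inv\<^bsub>G\<^esub> y \<otimes>\<^bsub>G\<^esub> x) = inv\<^bsub>G\<^esub> z \<otimes>\<^bsub>G\<^esub> x"
  by (metis inv_closed m_assoc m_closed r_inv l_one)

lemma tetra_triangles:
  assumes "\<alpha> \<in> carrier G" "\<beta> \<in> carrier G" "\<gamma> \<in> carrier G"
    and abc: "a \<in> T \<alpha> (inv\<^bsub>G\<^esub> \<beta>)" "b \<in> T \<beta> (inv\<^bsub>G\<^esub> \<gamma>)"
      "c \<in> T (inv\<^bsub>G\<^esub> \<beta> \<otimes>\<^bsub>G\<^esub> \<alpha>) (inv\<^bsub>G\<^esub> \<gamma> \<otimes>\<^bsub>G\<^esub> \<beta>)"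
    and t: "tetra M a b c d"
  shows "d \<in> T \<alpha> (inv\<^bsub>G\<^esub> \<gamma>)"
  by (intro trianglesI tetra_singular(4)[OF t])
     (use tetra_edges[OF t] triangles_edge[OF abc(1)] triangles_edge[OF abc(2)]
       triangles_edge[OF abc(3)] mult_cancel_mid[OF assms(1-3)] in \<open>simp_all del: One_nat_def\<close>)

text \<open>The edges match pointwise: for the common edge of \<open>a\<close> and \<open>b\<close>
  this is the reversal property of \<open>s\<close>; for the other two, both sides are the same
  value of \<open>s\<close>.\<close>

lemma tetra_exists_triangles:
  assumes "\<alpha> \<in> carrier G" "\<beta> \<in> carrier G" "\<gamma> \<in> carrier G"
    and abc: "a \<in> T \<alpha> (inv\<^bsub>G\<^esub> \<beta>)" "b \<in> T \<beta> (inv\<^bsub>G\<^esub> \<gamma>)"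
      "c \<in> T (inv\<^bsub>G\<^esub> \<beta> \<otimes>\<^bsub>G\<^esub> \<alpha>) (inv\<^bsub>G\<^esub> \<gamma> \<otimes>\<^bsub>G\<^esub> \<beta>)"
  obtains d where "tetra M a b c d"
  by (rule tetra_exists[OF triangles_singular[OF abc(1)] triangles_singular[OF abc(2)]
          triangles_singular[OF abc(3)]])
     (use assms triangles_edge[OF abc(1)] triangles_edge[OF abc(2)] triangles_edge[OF abc(3)] that
       in \<open>simp_all add: s_inv del: One_nat_def\<close>)

lemma triangles_htpy:
  assumes a: "a \<in> T \<alpha> \<beta>" and b: "b \<in> cls a"
  shows "b \<in> T \<alpha> \<beta>"
proof -
  have "b x = a x" if "x \<in> triangle_boundary" for x
    using b rel_htpy_on[of triangle_boundary "standard_simplex 2" M a b x] that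
    by (simp add: triangle_class_iff)
  then show ?thesis
    by (intro trianglesI)
       (use b triangles_edge[OF a] in \<open>simp_all add: triangle_class_iff edge_point_in_boundary del: One_nat_def\<close>)
qed

lemma GammaE:
  assumes "A \<in> Gamma M m s \<alpha> \<beta>"
  obtains a where "a \<in> T \<alpha> \<beta>" "A = cls a"
  using assms by (auto simp: Gamma_def)

lemma GammaI: "a \<in> T \<alpha> \<beta> \<Longrightarrow> cls a \<in> Gamma M m s \<alpha> \<beta>"
  by (simp add: Gamma_def)

lemma Gamma_memD:
  assumes "A \<in> Gamma M m s \<alpha> \<beta>" "a \<in> A"
  shows "a \<in> T \<alpha> \<beta>" "A = cls a"
proof -
  obtain a' where a': "a' \<in> T \<alpha> \<beta>" "A = cls a'" using assms(1) by (rule GammaE)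
  show "a \<in> T \<alpha> \<beta>" using triangles_htpy[OF a'(1)] a'(2) assms(2) by simp
  show "A = cls a" unfolding a'(2)
    by (rule triangle_class_eqI) (use assms(2) a'(2) in \<open>simp add: triangle_class_iff\<close>)
qed

lemma m_well_defined: "Gamma_m_well_defined M m s"
  unfolding Gamma_m_well_defined_def
proof (intro ballI conjI allI impI)
  fix \<alpha> \<beta> \<gamma> A B C a b c
  assume g: "\<alpha> \<in> carrier G" "\<beta> \<in> carrier G" "\<gamma> \<in> carrier G"
    and ABC: "A \<in> Gamma M m s \<alpha> (inv\<^bsub>G\<^esub> \<beta>)" "B \<in> Gamma M m s \<beta> (inv\<^bsub>G\<^esub> \<gamma>)"
      "C \<in> Gamma M m s (inv\<^bsub>G\<^esub> \<beta> \<otimes>\<^bsub>G\<^esub> \<alpha>) (inv\<^bsub>G\<^esub> \<gamma> \<otimes>\<^bsub>G\<^esub> \<beta>)"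
    and abc: "a \<in> A" "b \<in> B" "c \<in> C"
  note a = Gamma_memD[OF ABC(1) abc(1)] and b = Gamma_memD[OF ABC(2) abc(2)]
    and c = Gamma_memD[OF ABC(3) abc(3)]
  obtain d where "tetra M a b c d"
    using tetra_exists_triangles[OF g a(1) b(1) c(1)] by blast
  then show "\<exists>\<omega>. tetrahedron_filling M a b c \<omega>" by (auto simp: tetra_def)
  fix \<omega> assume "tetrahedron_filling M a b c \<omega>"
  then have "tetra M a b c (face \<omega> 1 2 3)" by (auto simp: tetra_def)
  then show "triangle_class M (face \<omega> 1 2 3) = Gamma_m M A B C"
    unfolding a(2) b(2) c(2) by (rule Gamma_m_class[symmetric])
qed

text \<open>The indices are inert in \<open>Gamma_ops\<close>, so each law is an equation between
  classes. One filling \<open>d\<close>, relabelled by \<open>tetra_P\<close>,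
  \<open>tetra_Q\<close> and \<open>tetra_inverse\<close>, settles every law about \<open>m\<close>
  other than associativity.\<close>

lemma delta_group_Gamma: "delta_group G (Gamma_ops M m s)"
proof (intro delta_group.intro delta_group_axioms.intro, unfold Gamma_ops_def delta_ops.simps)
  show "Group.group G" by (rule pi1_group[OF base])
next
  fix g h k A B C
  assume g: "g \<in> carrier G" "h \<in> carrier G" "k \<in> carrier G"
    and A: "A \<in> Gamma M m s g (inv\<^bsub>G\<^esub> h)" and B: "B \<in> Gamma M m s h (inv\<^bsub>G\<^esub> k)"
    and C: "C \<in> Gamma M m s (inv\<^bsub>G\<^esub> h \<otimes>\<^bsub>G\<^esub> g) (inv\<^bsub>G\<^esub> k \<otimes>\<^bsub>G\<^esub> h)"
  obtain a where a: "a \<in> T g (inv\<^bsub>G\<^esub> h)" "A = cls a" using A by (rule GammaE)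
  obtain b where b: "b \<in> T h (inv\<^bsub>G\<^esub> k)" "B = cls b" using B by (rule GammaE)
  obtain c where c: "c \<in> T (inv\<^bsub>G\<^esub> h \<otimes>\<^bsub>G\<^esub> g) (inv\<^bsub>G\<^esub> k \<otimes>\<^bsub>G\<^esub> h)" "C = cls c" using C by (rule GammaE)
  obtain d where d: "tetra M a b c d"
    using tetra_exists_triangles[OF g a(1) b(1) c(1)] by blast
  have md: "Gamma_m M A B C = cls d"
    unfolding a(2) b(2) c(2) by (rule Gamma_m_class[OF d])
  show "Gamma_m M A B C \<in> Gamma M m s g (inv\<^bsub>G\<^esub> k)"
    unfolding md by (rule GammaI[OF tetra_triangles[OF g a(1) b(1) c(1) d]])
  have d': "singular_simplex 2 (top_of_set M) d" by (rule tetra_singular(4)[OF d])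
  show "Gamma_P (Gamma_m M A B C) = Gamma_m M (Gamma_P B) (Gamma_P C) (Gamma_P A)"
    unfolding md unfolding a(2) b(2) c(2) Gamma_P_class[OF d'] Gamma_P_class[OF triangles_singular[OF a(1)]]
      Gamma_P_class[OF triangles_singular[OF b(1)]] Gamma_P_class[OF triangles_singular[OF c(1)]]
    by (rule Gamma_m_class[OF tetra_P[OF d], symmetric])
  show "Gamma_Q (Gamma_m M A B C) = Gamma_m M (Gamma_Q A) (Gamma_Q C) (Gamma_Q B)"
    unfolding md unfolding a(2) b(2) c(2) Gamma_Q_class[OF d'] Gamma_Q_class[OF triangles_singular[OF a(1)]]
      Gamma_Q_class[OF triangles_singular[OF b(1)]] Gamma_Q_class[OF triangles_singular[OF c(1)]]
    by (rule Gamma_m_class[OF tetra_Q[OF d], symmetric])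
  show "Gamma_m M (Gamma_m M A B C) (Gamma_P (Gamma_P (Gamma_Q B))) (Gamma_P (Gamma_Q C)) = A"
    unfolding md unfolding a(2) b(2) c(2)
    using Gamma_m_class[OF tetra_inverse[OF d]] triangles_singular[OF b(1)] triangles_singular[OF c(1)]
    by (simp add: Gamma_P_class Gamma_Q_class singular_face2 del: One_nat_def)
  fix l D E F
  assume l: "l \<in> carrier G" and D: "D \<in> Gamma M m s k (inv\<^bsub>G\<^esub> l)"
    and E: "E \<in> Gamma M m s (inv\<^bsub>G\<^esub> k \<otimes>\<^bsub>G\<^esub> g) (inv\<^bsub>G\<^esub> l \<otimes>\<^bsub>G\<^esub> k)"
    and F: "F \<in> Gamma M m s (inv\<^bsub>G\<^esub> k \<otimes>\<^bsub>G\<^esub> h) (inv\<^bsub>G\<^esub> l \<otimes>\<^bsub>G\<^esub> k)"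
  obtain u where u: "u \<in> T k (inv\<^bsub>G\<^esub> l)" "D = cls u" using D by (rule GammaE)
  obtain e where e: "e \<in> T (inv\<^bsub>G\<^esub> k \<otimes>\<^bsub>G\<^esub> g) (inv\<^bsub>G\<^esub> l \<otimes>\<^bsub>G\<^esub> k)" "E = cls e" using E by (rule GammaE)
  obtain f where f: "f \<in> T (inv\<^bsub>G\<^esub> k \<otimes>\<^bsub>G\<^esub> h) (inv\<^bsub>G\<^esub> l \<otimes>\<^bsub>G\<^esub> k)" "F = cls f" using F by (rule GammaE)
  obtain v where v: "tetra M b u f v"
    using tetra_exists_triangles[OF g(2,3) l b(1) u(1) f(1)] by blast
  have gs: "inv\<^bsub>G\<^esub> h \<otimes>\<^bsub>G\<^esub> g \<in> carrier G" "inv\<^bsub>G\<^esub> h \<otimes>\<^bsub>G\<^esub> k \<in> carrier G" "inv\<^bsub>G\<^esub> h \<otimes>\<^bsub>G\<^esub> l \<in> carrier G"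
    using g l by simp_all
  \<comment> \<open>The cell conditions for \<open>c\<close>, the reflected \<open>f\<close> and
    \<open>e\<close> take the required form only after these cancellations in the group.\<close>
  have i1: "inv\<^bsub>G\<^esub> (inv\<^bsub>G\<^esub> h \<otimes>\<^bsub>G\<^esub> k) = inv\<^bsub>G\<^esub> k \<otimes>\<^bsub>G\<^esub> h" "inv\<^bsub>G\<^esub> (inv\<^bsub>G\<^esub> h \<otimes>\<^bsub>G\<^esub> l) = inv\<^bsub>G\<^esub> l \<otimes>\<^bsub>G\<^esub> h"
    "inv\<^bsub>G\<^esub> (inv\<^bsub>G\<^esub> k \<otimes>\<^bsub>G\<^esub> h) = inv\<^bsub>G\<^esub> h \<otimes>\<^bsub>G\<^esub> k"
    using g l by (simp_all add: inv_mult_group)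
  have i2: "(inv\<^bsub>G\<^esub> k \<otimes>\<^bsub>G\<^esub> h) \<otimes>\<^bsub>G\<^esub> (inv\<^bsub>G\<^esub> h \<otimes>\<^bsub>G\<^esub> g) = inv\<^bsub>G\<^esub> k \<otimes>\<^bsub>G\<^esub> g"
    "(inv\<^bsub>G\<^esub> l \<otimes>\<^bsub>G\<^esub> h) \<otimes>\<^bsub>G\<^esub> (inv\<^bsub>G\<^esub> h \<otimes>\<^bsub>G\<^esub> k) = inv\<^bsub>G\<^esub> l \<otimes>\<^bsub>G\<^esub> k"
    "(inv\<^bsub>G\<^esub> l \<otimes>\<^bsub>G\<^esub> k) \<otimes>\<^bsub>G\<^esub> (inv\<^bsub>G\<^esub> k \<otimes>\<^bsub>G\<^esub> h) = inv\<^bsub>G\<^esub> l \<otimes>\<^bsub>G\<^esub> h"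
    using g l by (simp_all add: mult_cancel_mid)
  have qf: "face f 1 0 2 \<in> T (inv\<^bsub>G\<^esub> h \<otimes>\<^bsub>G\<^esub> k) (inv\<^bsub>G\<^esub> l \<otimes>\<^bsub>G\<^esub> h)"
    using triangles_Q[OF _ _ f(1)] g l by (simp add: i1 i2 del: One_nat_def)
  obtain w where w: "tetra M c (face f 1 0 2) e w"
    using tetra_exists_triangles[OF gs, of c "face f 1 0 2" e] c(1) qf e(1) unfolding i1 i2 by blast
  \<comment> \<open>A common last face for the fillings on both sides.\<close>
  obtain z where z: "tetra M d u e z" "tetra M a v w z"
    using tetra_assoc[OF d v w] by blast
  show "Gamma_m M (Gamma_m M A B C) D E = Gamma_m M A (Gamma_m M B D F) (Gamma_m M C (Gamma_Q F) E)"
    unfolding md unfolding a(2) b(2) c(2) u(2) e(2) f(2) Gamma_Q_class[OF triangles_singular[OF f(1)]]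
      Gamma_m_class[OF v] Gamma_m_class[OF w] Gamma_m_class[OF z(1)] Gamma_m_class[OF z(2)] ..
next
  fix g h A
  assume g: "g \<in> carrier G" "h \<in> carrier G" and A: "A \<in> Gamma M m s g h"
  obtain a where a: "a \<in> T g h" "A = cls a" using A by (rule GammaE)
  note sa = triangles_singular[OF a(1)]
  show "Gamma_P A \<in> Gamma M m s h (inv\<^bsub>G\<^esub> g \<otimes>\<^bsub>G\<^esub> inv\<^bsub>G\<^esub> h)"
    unfolding a(2) Gamma_P_class[OF sa] by (rule GammaI[OF triangles_P[OF g a(1)]])
  show "Gamma_Q A \<in> Gamma M m s (inv\<^bsub>G\<^esub> g) (h \<otimes>\<^bsub>G\<^esub> g)"
    unfolding a(2) Gamma_Q_class[OF sa] by (rule GammaI[OF triangles_Q[OF g a(1)]])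
  show "Gamma_P (Gamma_P (Gamma_P A)) = A" "Gamma_Q (Gamma_Q A) = A"
    "Gamma_P (Gamma_P (Gamma_Q A)) = Gamma_Q (Gamma_P A)"
    unfolding a(2) using sa
    by (simp_all add: Gamma_P_class Gamma_Q_class singular_face2 face_face face_ident del: One_nat_def)
qed

end

section \<open>Prisms over a triangle\<close>

definition prism :: "((nat \<Rightarrow> real) \<times> real) set" where
  "prism = standard_simplex 2 \<times> {0..1}"

definition prism_cup :: "((nat \<Rightarrow> real) \<times> real) set" where
  "prism_cup = standard_simplex 2 \<times> {0} \<union> triangle_boundary \<times> {0..1}"

text \<open>Radial projection of the prism onto its bottom and sides, from the point at height 2 above
  the barycenter; the scale is the reciprocal of the dilation factor.\<close>

definition prism_scale :: "(nat \<Rightarrow> real) \<times> real \<Rightarrow> real" where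
  "prism_scale z = max (1 - snd z / 2) (1 - 3 * min (fst z 0) (min (fst z 1) (fst z 2)))"

definition prism_retract :: "(nat \<Rightarrow> real) \<times> real \<Rightarrow> (nat \<Rightarrow> real) \<times> real" where
  "prism_retract z = ((\<lambda>i. if i \<le> 2 then 1/3 + (fst z i - 1/3) / prism_scale z else 0),
     2 - (2 - snd z) / prism_scale z)"

lemma standard_simplex_2_iff:
  "x \<in> standard_simplex 2 \<longleftrightarrow> 0 \<le> x 0 \<and> 0 \<le> x 1 \<and> 0 \<le> x 2 \<and> (\<forall>i>2. x i = 0) \<and> x 0 + x 1 + x 2 = 1"
proof
  assume "x \<in> standard_simplex 2"
  then show "0 \<le> x 0 \<and> 0 \<le> x 1 \<and> 0 \<le> x 2 \<and> (\<forall>i>2. x i = 0) \<and> x 0 + x 1 + x 2 = 1"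
    by (simp add: standard_simplex_def eval_nat_numeral)
next
  assume *: "0 \<le> x 0 \<and> 0 \<le> x 1 \<and> 0 \<le> x 2 \<and> (\<forall>i>2. x i = 0) \<and> x 0 + x 1 + x 2 = 1"
  have "0 \<le> x i \<and> x i \<le> 1" for i
  proof (cases "i \<le> 2")
    case True
    then consider "i = 0" | "i = 1" | "i = 2" by (auto simp: le_2_cases)
    then show ?thesis using * by cases auto
  qed (use * in simp)
  then show "x \<in> standard_simplex 2"
    using * by (simp add: standard_simplex_def eval_nat_numeral)
qed

lemma prism_cup_subset: "prism_cup \<subseteq> prism"
  using triangle_boundary_subset by (auto simp: prism_def prism_cup_def)

text \<open>The apex lies above the whole prism, so the scale stays away from 0 and can safely be a
  denominator.\<close>

lemma prism_scale_bounds: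
  assumes "z \<in> prism"
  shows "1/2 \<le> prism_scale z" "prism_scale z \<le> 1"
proof -
  have "0 \<le> fst z 0" "0 \<le> fst z 1" "0 \<le> fst z 2" "0 \<le> snd z" "snd z \<le> 1"
    using assms by (auto simp: prism_def standard_simplex_2_iff)
  then show "1/2 \<le> prism_scale z" "prism_scale z \<le> 1"
    by (simp_all add: prism_scale_def min_def max_def)
qed

text \<open>Being at least each of the four candidates, the scale stops the ray before it leaves
  through the bottom or a side; being at most 1, it keeps the height from exceeding 1.\<close>

lemma prism_retract_in_prism:
  assumes z: "z \<in> prism"
  shows "prism_retract z \<in> prism"
proof -
  define \<rho> where "\<rho> = prism_scale z"
  have \<rho>: "1/2 \<le> \<rho>" "\<rho> \<le> 1" using prism_scale_bounds[OF z] by (simp_all add: \<rho>_def)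
  have x: "fst z 0 + fst z 1 + fst z 2 = 1" and \<tau>: "0 \<le> snd z" "snd z \<le> 1"
    using z by (auto simp: prism_def standard_simplex_2_iff)
  have ge: "1 - snd z / 2 \<le> \<rho>" "1 - 3 * fst z 0 \<le> \<rho>" "1 - 3 * fst z 1 \<le> \<rho>" "1 - 3 * fst z 2 \<le> \<rho>"
    by (simp_all add: \<rho>_def prism_scale_def min_def max_def)
  have nn: "0 \<le> 1/3 + (y - 1/3) / \<rho>" if "1 - 3 * y \<le> \<rho>" for y
    using \<rho>(1) that by (simp add: field_simps)
  have "(fst z 0 - 1/3) / \<rho> + (fst z 1 - 1/3) / \<rho> + (fst z 2 - 1/3) / \<rho>
      = (fst z 0 + fst z 1 + fst z 2 - 1) / \<rho>"
    by (simp add: add_divide_distrib[symmetric] diff_divide_distrib[symmetric])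
  then have sum: "(1/3 + (fst z 0 - 1/3) / \<rho>) + (1/3 + (fst z 1 - 1/3) / \<rho>) + (1/3 + (fst z 2 - 1/3) / \<rho>) = 1"
    using x by simp
  have "0 \<le> 2 - (2 - snd z) / \<rho>" "2 - (2 - snd z) / \<rho> \<le> 1"
    using \<rho> ge(1) \<tau> by (simp_all add: field_simps)
  then show ?thesis
    using nn[OF ge(2)] nn[OF ge(3)] nn[OF ge(4)] sum
    by (simp add: prism_def prism_retract_def \<rho>_def[symmetric] standard_simplex_2_iff)
qed

text \<open>The ray from the apex reaches the bottom at scale \<open>1 - snd z / 2\<close> and the
  side where coordinate \<open>i\<close> vanishes at scale \<open>1 - 3 * fst z i\<close>. The
  maximum picks the first of these hits.\<close>

lemma prism_retract_in_cup:
  assumes z: "z \<in> prism"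
  shows "prism_retract z \<in> prism_cup"
proof -
  define \<rho> where "\<rho> = prism_scale z"
  have \<rho>: "1/2 \<le> \<rho>" using prism_scale_bounds[OF z] by (simp_all add: \<rho>_def)
  have R: "fst (prism_retract z) \<in> standard_simplex 2" "snd (prism_retract z) \<in> {0..1}"
    using prism_retract_in_prism[OF z] by (auto simp: prism_def)
  have van: "1/3 + (y - 1/3) / \<rho> = 0" if "\<rho> = 1 - 3 * y" for y
  proof -
    have "y - 1/3 = - \<rho> / 3" using that by simp
    then show ?thesis using \<rho> by simp
  qed
  have "\<rho> = 1 - snd z / 2 \<or> \<rho> = 1 - 3 * fst z 0 \<or> \<rho> = 1 - 3 * fst z 1 \<or> \<rho> = 1 - 3 * fst z 2"
    by (simp add: \<rho>_def prism_scale_def min_def max_def)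
  then have "\<rho> = 1 - snd z / 2 \<or> (\<exists>i\<le>2. \<rho> = 1 - 3 * fst z i)"
    by (auto simp: le_2_cases)
  then consider "\<rho> = 1 - snd z / 2" | i where "i \<le> 2" "\<rho> = 1 - 3 * fst z i"
    by blast
  then show ?thesis
  proof cases
    case 1
    then have "2 - snd z = 2 * \<rho>" by simp
    then have "snd (prism_retract z) = 0"
      using \<rho> by (simp add: prism_retract_def \<rho>_def[symmetric])
    then show ?thesis using R by (cases "prism_retract z") (simp add: prism_cup_def)
  next
    case 2
    then have "fst (prism_retract z) i = 0"
      using van[OF 2(2)] by (simp add: prism_retract_def \<rho>_def[symmetric])
    then show ?thesis
      using R 2(1) by (cases "prism_retract z") (auto simp: prism_cup_def triangle_boundary_def)
  qed
qed

text \<open>On the bottom or a side one of the candidates is 1, and the scale never exceeds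
  1.\<close>

lemma prism_retract_fixed:
  assumes z: "z \<in> prism_cup"
  shows "prism_retract z = z"
proof -
  have zp: "z \<in> prism" using z prism_cup_subset by blast
  have "snd z = 0 \<or> fst z 0 = 0 \<or> fst z 1 = 0 \<or> fst z 2 = 0"
    using z by (auto simp: prism_cup_def triangle_boundary_def le_2_cases)
  then have "1 \<le> prism_scale z"
    by (auto simp: prism_scale_def min_def max_def)
  then have 1: "prism_scale z = 1" using prism_scale_bounds(2)[OF zp] by simp
  have "fst z i = 0" if "\<not> i \<le> 2" for i
    using zp that by (auto simp: prism_def standard_simplex_2_iff)
  then show ?thesis
    by (auto simp: prism_retract_def 1 prod_eq_iff fun_eq_iff)
qed

lemma continuous_on_prism_retract: "continuous_on prism prism_retract"
proof -
  have f: "continuous_on prism (\<lambda>z. fst z i)" for i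
    by (rule continuous_on_product_then_coordinatewise[OF continuous_on_fst[OF continuous_on_id]])
  have s: "continuous_on prism (\<lambda>z. snd z)"
    by (rule continuous_on_snd[OF continuous_on_id])
  have m: "continuous_on prism (\<lambda>z. min (fst z 0) (min (fst z 1) (fst z 2)))"
    by (rule continuous_on_min[OF f continuous_on_min[OF f f]])
  have \<rho>: "continuous_on prism prism_scale"
    unfolding prism_scale_def
    by (rule continuous_on_max[OF
          continuous_on_diff[OF continuous_on_const continuous_on_divide[OF s continuous_on_const]]
          continuous_on_diff[OF continuous_on_const continuous_on_mult[OF continuous_on_const m]]]) simp
  have nz: "\<forall>z\<in>prism. prism_scale z \<noteq> 0" using prism_scale_bounds(1) by fastforce
  have c: "continuous_on prism (\<lambda>z. 1/3 + (fst z i - 1/3) / prism_scale z)" for i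
    by (rule continuous_on_add[OF continuous_on_const
          continuous_on_divide[OF continuous_on_diff[OF f continuous_on_const] \<rho> nz]])
  have "continuous_on prism (\<lambda>z i. if i \<le> 2 then 1/3 + (fst z i - 1/3) / prism_scale z else 0)"
  proof (rule continuous_on_coordinatewise_then_product)
    fix i :: nat
    show "continuous_on prism (\<lambda>z. if i \<le> 2 then 1/3 + (fst z i - 1/3) / prism_scale z else 0)"
      using c[of i] by (cases "i \<le> 2") simp_all
  qed
  moreover have "continuous_on prism (\<lambda>z. 2 - (2 - snd z) / prism_scale z)"
    by (rule continuous_on_diff[OF continuous_on_const
          continuous_on_divide[OF continuous_on_diff[OF continuous_on_const s] \<rho> nz]])
  ultimately show ?thesis
    unfolding prism_retract_def by (rule continuous_on_Pair)
qed

text \<open>The prism is convex, so moving each point along the segment to its projection deforms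
  the prism onto bottom and sides.\<close>

lemma rel_htpy_prism:
  assumes u: "continuous_on prism u" "u ` prism \<subseteq> N" and v: "continuous_on prism v" "v ` prism \<subseteq> N"
    and uv: "\<And>z. z \<in> prism_cup \<Longrightarrow> u z = v z"
  shows "rel_htpy prism_cup prism N u v"
proof (rule rel_htpy_deformation[OF prism_cup_subset _ _ _ _ _ u v uv])
  let ?R = prism_retract
  let ?G = "\<lambda>w::real \<times> (nat \<Rightarrow> real) \<times> real.
    ((\<lambda>i. (1 - fst w) * fst (snd w) i + fst w * fst (?R (snd w)) i),
     (1 - fst w) * snd (snd w) + fst w * snd (?R (snd w)))"
  let ?D = "{0..1::real} \<times> prism"
  have t: "continuous_on ?D (\<lambda>w. fst w)" and t': "continuous_on ?D (\<lambda>w. 1 - fst w)"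
    by (intro continuous_intros)+
  have z: "continuous_on ?D (\<lambda>w. snd w)" by (rule continuous_on_snd[OF continuous_on_id])
  have R: "continuous_on ?D (\<lambda>w. ?R (snd w))"
    by (rule continuous_on_compose2[OF continuous_on_prism_retract z]) auto
  note pc = continuous_on_product_then_coordinatewise
  show "continuous_on ?D ?G"
  proof (rule continuous_on_Pair)
    show "continuous_on ?D (\<lambda>w i. (1 - fst w) * fst (snd w) i + fst w * fst (?R (snd w)) i)"
      by (rule continuous_on_coordinatewise_then_product)
         (rule continuous_on_add[OF continuous_on_mult[OF t' pc[OF continuous_on_fst[OF z]]]
            continuous_on_mult[OF t pc[OF continuous_on_fst[OF R]]]])
    show "continuous_on ?D (\<lambda>w. (1 - fst w) * snd (snd w) + fst w * snd (?R (snd w)))"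
      by (rule continuous_on_add[OF continuous_on_mult[OF t' continuous_on_snd[OF z]]
            continuous_on_mult[OF t continuous_on_snd[OF R]]])
  qed
  have "?G w \<in> prism" if w: "w \<in> ?D" for w
  proof -
    have "snd w \<in> prism" "?R (snd w) \<in> prism" and fw: "0 \<le> fst w" "fst w \<le> 1"
      using w prism_retract_in_prism by auto
    then have "fst (snd w) \<in> standard_simplex 2" "fst (?R (snd w)) \<in> standard_simplex 2"
      and i: "snd (snd w) \<in> {0..1}" "snd (?R (snd w)) \<in> {0..1}"
      by (auto simp: prism_def)
    then have "(\<lambda>i. (1 - fst w) * fst (snd w) i + fst w * fst (?R (snd w)) i) \<in> standard_simplex 2"
      by (intro convex_standard_simplex fw)
    moreover have "(1 - fst w) * snd (snd w) + fst w * snd (?R (snd w)) \<le> 1"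
      using i fw by (intro convex_bound_le) auto
    moreover have "0 \<le> (1 - fst w) * snd (snd w) + fst w * snd (?R (snd w))"
      using i fw by simp
    ultimately show ?thesis by (simp add: prism_def)
  qed
  then show "?G ` ?D \<subseteq> prism" by blast
  show "?G (0, x) = x" for x by (simp add: prod_eq_iff)
  show "?G (1, x) \<in> prism_cup" if "x \<in> prism" for x
    using prism_retract_in_cup[OF that] by simp
  show "?G (t, x) = x" if "x \<in> prism_cup" for t x
    by (simp add: prism_retract_fixed[OF that] prod_eq_iff fun_eq_iff algebra_simps)
qed

lemma closed_triangle_boundary: "closed triangle_boundary"
proof -
  have "triangle_boundary = standard_simplex 2 \<inter> ((\<lambda>x. x 0) -` {0} \<union> (\<lambda>x. x 1) -` {0} \<union> (\<lambda>x. x 2) -` {0})"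
    by (auto simp: triangle_boundary_def le_2_cases)
  moreover have "closed \<dots>"
    by (intro closed_Int closed_Un closed_standard_simplex closed_vimage) auto
  ultimately show ?thesis by simp
qed

text \<open>The parameter \<open>t\<close> moves the bottom by \<open>h\<close> while the sides stay
  put. A constant \<open>h\<close> gives existence of prism maps; a homotopy \<open>h\<close>
  compares two of them.\<close>

lemma prism_extension:
  fixes h :: "real \<times> (nat \<Rightarrow> real) \<Rightarrow> 'a::topological_space"
  assumes h: "continuous_on ({0..1} \<times> standard_simplex 2) h" "h ` ({0..1} \<times> standard_simplex 2) \<subseteq> N"
    and B: "continuous_on (triangle_boundary \<times> {0..1::real}) B" "B ` (triangle_boundary \<times> {0..1}) \<subseteq> N"
    and hB: "\<And>t x. \<lbrakk>t \<in> {0..1}; x \<in> triangle_boundary\<rbrakk> \<Longrightarrow> h (t, x) = B (x, 0)"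
  obtains K where "continuous_on ({0..1::real} \<times> prism) K" "K ` ({0..1} \<times> prism) \<subseteq> N"
    "\<And>t x. \<lbrakk>t \<in> {0..1}; x \<in> standard_simplex 2\<rbrakk> \<Longrightarrow> K (t, (x, 0)) = h (t, x)"
    "\<And>t z. \<lbrakk>t \<in> {0..1}; z \<in> triangle_boundary \<times> {0..1}\<rbrakk> \<Longrightarrow> K (t, z) = B z"
proof -
  let ?I = "{0..1::real}" and ?T = "standard_simplex 2"
  define k where "k = (\<lambda>w. if snd (snd w) = 0 then h (fst w, fst (snd w)) else B (snd w))"
  have k1: "k w = h (fst w, fst (snd w))" if "w \<in> ?I \<times> (?T \<times> {0})" for w
    using that by (auto simp: k_def)
  have k2: "k w = B (snd w)" if "w \<in> ?I \<times> (triangle_boundary \<times> ?I)" for w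
    using that hB by (auto simp: k_def)
  have "continuous_on (?I \<times> (?T \<times> {0})) (\<lambda>w. h (fst w, fst (snd w)))"
    by (rule continuous_on_compose2[OF h(1) continuous_on_Pair[OF continuous_on_fst[OF continuous_on_id]
            continuous_on_fst[OF continuous_on_snd[OF continuous_on_id]]]]) auto
  then have c1: "continuous_on (?I \<times> (?T \<times> {0})) k"
    using k1 by (simp cong: continuous_on_cong)
  have "continuous_on (?I \<times> (triangle_boundary \<times> ?I)) (\<lambda>w. B (snd w))"
    by (rule continuous_on_compose2[OF B(1) continuous_on_snd[OF continuous_on_id]]) auto
  then have c2: "continuous_on (?I \<times> (triangle_boundary \<times> ?I)) k"
    using k2 by (simp cong: continuous_on_cong)
  have D: "?I \<times> prism_cup = ?I \<times> (?T \<times> {0}) \<union> ?I \<times> (triangle_boundary \<times> ?I)"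
    by (auto simp: prism_cup_def)
  have ck: "continuous_on (?I \<times> prism_cup) k"
    unfolding D
    by (intro continuous_on_closed_Un c1 c2 closed_Times closed_standard_simplex closed_triangle_boundary)
       auto
  have ik: "k w \<in> N" if "w \<in> ?I \<times> prism_cup" for w
  proof -
    consider "w \<in> ?I \<times> (?T \<times> {0})" | "w \<in> ?I \<times> (triangle_boundary \<times> ?I)"
      using \<open>w \<in> ?I \<times> prism_cup\<close> unfolding D by blast
    then show ?thesis
    proof cases
      case 1
      then have "(fst w, fst (snd w)) \<in> ?I \<times> ?T" by auto
      then show ?thesis unfolding k1[OF 1] by (rule subsetD[OF h(2) imageI])
    next
      case 2
      then have "snd w \<in> triangle_boundary \<times> ?I" by auto
      then show ?thesis unfolding k2[OF 2] by (rule subsetD[OF B(2) imageI])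
    qed
  qed
  let ?K = "\<lambda>w. k (fst w, prism_retract (snd w))"
  have r: "(fst w, prism_retract (snd w)) \<in> ?I \<times> prism_cup" if "w \<in> ?I \<times> prism" for w
    using that prism_retract_in_cup[of "snd w"] by auto
  show thesis
  proof
    show "continuous_on (?I \<times> prism) ?K"
    proof (rule continuous_on_compose2[OF ck])
      show "continuous_on (?I \<times> prism) (\<lambda>w. (fst w, prism_retract (snd w)))"
        by (rule continuous_on_Pair[OF continuous_on_fst[OF continuous_on_id]
              continuous_on_compose2[OF continuous_on_prism_retract continuous_on_snd[OF continuous_on_id]]])
           auto
      show "(\<lambda>w. (fst w, prism_retract (snd w))) ` (?I \<times> prism) \<subseteq> ?I \<times> prism_cup"
        by (rule image_subsetI) (rule r)
    qed
    show "?K ` (?I \<times> prism) \<subseteq> N" by (rule image_subsetI) (rule ik[OF r])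
    show "?K (t, (x, 0)) = h (t, x)" if "t \<in> ?I" "x \<in> ?T" for t x
    proof -
      have "(x, 0) \<in> prism_cup" using that by (simp add: prism_cup_def)
      then show ?thesis using k1[of "(t, (x, 0))"] that by (simp add: prism_retract_fixed)
    qed
    show "?K (t, z) = B z" if "t \<in> ?I" "z \<in> triangle_boundary \<times> ?I" for t z
    proof -
      have "z \<in> prism_cup" using that by (simp add: prism_cup_def)
      then show ?thesis using k2[of "(t, z)"] that by (simp add: prism_retract_fixed)
    qed
  qed
qed

text \<open>The bottom homotopy extends to a family of prism maps constant on the sides. Its two
  ends agree with \<open>F\<close> and \<open>F'\<close> on bottom and sides, hence are homotopic to
  them relative to that set; the claim is then read off on the top.\<close>

lemma prism_end_unique:
  fixes F F' :: "(nat \<Rightarrow> real) \<times> real \<Rightarrow> 'a::topological_space"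
  assumes F: "continuous_on prism F" "F ` prism \<subseteq> N" and F': "continuous_on prism F'" "F' ` prism \<subseteq> N"
    and side: "\<And>z. z \<in> triangle_boundary \<times> {0..1} \<Longrightarrow> F z = F' z"
    and bot: "tri_htpy N (\<lambda>x. F (x, 0)) (\<lambda>x. F' (x, 0))"
  shows "tri_htpy N (\<lambda>x. F (x, 1)) (\<lambda>x. F' (x, 1))"
proof -
  let ?I = "{0..1::real}" and ?T = "standard_simplex 2"
  obtain h where h: "continuous_on (?I \<times> ?T) h" "h ` (?I \<times> ?T) \<subseteq> N"
    "\<And>x. x \<in> ?T \<Longrightarrow> h (0, x) = F (x, 0)" "\<And>x. x \<in> ?T \<Longrightarrow> h (1, x) = F' (x, 0)"
    "\<And>t x. \<lbrakk>t \<in> ?I; x \<in> triangle_boundary\<rbrakk> \<Longrightarrow> h (t, x) = F (x, 0)"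
    by (rule rel_htpyE[OF bot triangle_boundary_subset]) (rule that; simp)
  have sub: "triangle_boundary \<times> ?I \<subseteq> prism"
    using triangle_boundary_subset by (auto simp: prism_def)
  obtain K where K: "continuous_on (?I \<times> prism) K" "K ` (?I \<times> prism) \<subseteq> N"
    "\<And>t x. \<lbrakk>t \<in> ?I; x \<in> ?T\<rbrakk> \<Longrightarrow> K (t, (x, 0)) = h (t, x)"
    "\<And>t z. \<lbrakk>t \<in> ?I; z \<in> triangle_boundary \<times> ?I\<rbrakk> \<Longrightarrow> K (t, z) = F z"
  proof (rule prism_extension[where N = N and h = h and B = F])
    show "continuous_on (triangle_boundary \<times> ?I) F" by (rule continuous_on_subset[OF F(1) sub])
    show "F ` (triangle_boundary \<times> ?I) \<subseteq> N"
      using image_mono[OF sub] F(2) by (rule order_trans)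
  qed (use h in simp_all)
  have slice: "continuous_on prism (\<lambda>z. K (t, z))" "(\<lambda>z. K (t, z)) ` prism \<subseteq> N" if "t \<in> ?I" for t
  proof -
    show "continuous_on prism (\<lambda>z. K (t, z))"
      by (rule continuous_on_compose2[OF K(1) continuous_on_Pair[OF continuous_on_const continuous_on_id]])
         (use that in auto)
    show "(\<lambda>z. K (t, z)) ` prism \<subseteq> N" using K(2) that by (auto simp: image_subset_iff)
  qed
  \<comment> \<open>The boundary of the top lies in the sides, so a homotopy relative to bottom and
    sides restricts to one relative to the boundary of the triangle.\<close>
  have top: "tri_htpy N (\<lambda>x. u (x, 1)) (\<lambda>x. v (x, 1))" if "rel_htpy prism_cup prism N u v"
    for u v :: "(nat \<Rightarrow> real) \<times> real \<Rightarrow> 'a"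
  proof -
    have "tri_htpy N (u \<circ> (\<lambda>x. (x, 1))) (v \<circ> (\<lambda>x. (x, 1)))"
      by (rule rel_htpy_compose[OF that continuous_on_Pair[OF continuous_on_id continuous_on_const]])
         (auto simp: prism_def prism_cup_def)
    then show ?thesis by (simp add: comp_def)
  qed
  have 1: "tri_htpy N (\<lambda>x. F (x, 1)) (\<lambda>x. K (0, (x, 1)))"
  proof (rule top[OF rel_htpy_prism[OF F slice]])
    show "F z = K (0, z)" if "z \<in> prism_cup" for z
      using that K(3)[of 0] K(4)[of 0 z] h(3) by (auto simp: prism_cup_def)
  qed simp_all
  have 2: "tri_htpy N (\<lambda>x. F' (x, 1)) (\<lambda>x. K (1, (x, 1)))"
  proof (rule top[OF rel_htpy_prism[OF F' slice]])
    show "F' z = K (1, z)" if "z \<in> prism_cup" for z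
      using that K(3)[of 1] K(4)[of 1 z] h(4) side by (auto simp: prism_cup_def)
  qed simp_all
  \<comment> \<open>Along \<open>K\<close> the bottom moves but the sides do not, so on the top the
    boundary stays fixed.\<close>
  have 3: "tri_htpy N (\<lambda>x. K (0, (x, 1))) (\<lambda>x. K (1, (x, 1)))"
  proof (rule rel_htpyI[OF triangle_boundary_subset, where h = "\<lambda>w. K (fst w, (snd w, 1))"])
    show "continuous_on (?I \<times> ?T) (\<lambda>w. K (fst w, (snd w, 1)))"
      by (rule continuous_on_compose2[OF K(1) continuous_on_Pair[OF continuous_on_fst[OF continuous_on_id]
             continuous_on_Pair[OF continuous_on_snd[OF continuous_on_id] continuous_on_const]]])
         (auto simp: prism_def)
    show "(\<lambda>w. K (fst w, (snd w, 1))) ` (?I \<times> ?T) \<subseteq> N"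
      using K(2) by (auto simp: prism_def image_subset_iff)
    show "K (fst (t, x), (snd (t, x), 1)) = K (0, (x, 1))" if "t \<in> ?I" "x \<in> triangle_boundary" for t x
      using that K(4)[of t "(x, 1)"] K(4)[of 0 "(x, 1)"] by simp
  qed simp_all
  show ?thesis
    by (rule rel_htpy_trans[OF rel_htpy_trans[OF 1 3] rel_htpy_sym[OF 2]])
qed

section \<open>The induced map\<close>

lemma edge_point_coords:
  "edge_point 1 0 t 0 = t" "edge_point 1 0 t 1 = 1 - t" "edge_point 1 0 t 2 = 0"
  "edge_point 2 1 t 0 = 0" "edge_point 2 1 t 1 = t" "edge_point 2 1 t 2 = 1 - t"
  "edge_point 2 0 t 0 = t" "edge_point 2 0 t 1 = 0" "edge_point 2 0 t 2 = 1 - t"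
  by (simp_all add: edge_point_def vertex_def)

text \<open>The three pieces meet only over the corners, where every loop homotopy sits at the base
  point \<open>n\<close>.\<close>

lemma boundary_glue:
  fixes Ha Hb Hc :: "real \<times> real \<Rightarrow> 'a::topological_space"
  assumes Ha: "continuous_on ({0..1} \<times> {0..1}) Ha" "Ha ` ({0..1} \<times> {0..1}) \<subseteq> N"
      "\<And>\<tau>. \<tau> \<in> {0..1} \<Longrightarrow> Ha (0, \<tau>) = n \<and> Ha (1, \<tau>) = n"
    and Hb: "continuous_on ({0..1} \<times> {0..1}) Hb" "Hb ` ({0..1} \<times> {0..1}) \<subseteq> N"
      "\<And>\<tau>. \<tau> \<in> {0..1} \<Longrightarrow> Hb (0, \<tau>) = n \<and> Hb (1, \<tau>) = n"
    and Hc: "continuous_on ({0..1} \<times> {0..1}) Hc" "Hc ` ({0..1} \<times> {0..1}) \<subseteq> N"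
      "\<And>\<tau>. \<tau> \<in> {0..1} \<Longrightarrow> Hc (0, \<tau>) = n \<and> Hc (1, \<tau>) = n"
  obtains B where "continuous_on (triangle_boundary \<times> {0..1}) B" "B ` (triangle_boundary \<times> {0..1}) \<subseteq> N"
    "\<And>t \<tau>. \<lbrakk>t \<in> {0..1}; \<tau> \<in> {0..1}\<rbrakk> \<Longrightarrow> B (edge_point 1 0 t, \<tau>) = Ha (t, \<tau>) \<and>
       B (edge_point 2 1 t, \<tau>) = Hb (t, \<tau>) \<and> B (edge_point 2 0 t, \<tau>) = Hc (t, \<tau>)"
proof -
  let ?I = "{0..1::real}"
  let ?E = "\<lambda>i. {x \<in> standard_simplex 2. x i = 0} \<times> ?I"
  \<comment> \<open>The coordinate of the end vertex is the edge parameter: \<open>x 0\<close> on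
    \<open>[1,0]\<close> and \<open>[2,0]\<close>, \<open>x 1\<close> on
    \<open>[2,1]\<close>.\<close>
  define B where "B = (\<lambda>z::(nat \<Rightarrow> real) \<times> real. if fst z 2 = 0 then Ha (fst z 0, snd z)
    else if fst z 0 = 0 then Hb (fst z 1, snd z) else Hc (fst z 0, snd z))"
  have cl: "closed (?E i)" for i
  proof -
    have "{x \<in> standard_simplex 2. x i = 0} = standard_simplex 2 \<inter> (\<lambda>x. x i) -` {0}" by auto
    moreover have "closed \<dots>"
      using closed_standard_simplex by (intro closed_Int closed_vimage) auto
    ultimately show ?thesis by (simp add: closed_Times)
  qed
  have Ba: "B z = Ha (fst z 0, snd z)" if "z \<in> ?E 2" for z
    using that by (auto simp: B_def)
  have Bb: "B z = Hb (fst z 1, snd z)" if "z \<in> ?E 0" for z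
    using that Ha(3)[of "snd z"] Hb(3)[of "snd z"] by (auto simp: B_def standard_simplex_2_iff)
  have Bc: "B z = Hc (fst z 0, snd z)" if "z \<in> ?E 1" for z
    using that Ha(3)[of "snd z"] Hb(3)[of "snd z"] Hc(3)[of "snd z"]
    by (auto simp: B_def standard_simplex_2_iff)
  have r: "(fst z j, snd z) \<in> ?I \<times> ?I" if "z \<in> ?E i" for z i j
    using that by (auto simp: standard_simplex_def)
  have c: "continuous_on (?E i) (\<lambda>z. K (fst z j, snd z))" if "continuous_on (?I \<times> ?I) K"
    for i j and K :: "real \<times> real \<Rightarrow> 'a"
    by (rule continuous_on_compose2[OF that continuous_on_Pair[OF
          continuous_on_product_then_coordinatewise[OF continuous_on_fst[OF continuous_on_id]]
          continuous_on_snd[OF continuous_on_id]]])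
       (rule image_subsetI, rule r)
  have D: "triangle_boundary \<times> ?I = ?E 2 \<union> ?E 0 \<union> ?E 1"
    by (auto simp: triangle_boundary_def le_2_cases)
  have "continuous_on (?E 2) B" "continuous_on (?E 0) B" "continuous_on (?E 1) B"
    using c[OF Ha(1), of 2 0] c[OF Hb(1), of 0 1] c[OF Hc(1), of 1 0] Ba Bb Bc
    by (simp_all cong: continuous_on_cong)
  then have cB: "continuous_on (triangle_boundary \<times> ?I) B"
    unfolding D by (intro continuous_on_closed_Un cl closed_Un)
  have iB: "B z \<in> N" if z: "z \<in> triangle_boundary \<times> ?I" for z
  proof -
    consider "z \<in> ?E 2" | "z \<in> ?E 0" | "z \<in> ?E 1" using z unfolding D by blast
    then show ?thesis
    proof cases
      case 1
      show ?thesis unfolding Ba[OF 1] by (rule subsetD[OF Ha(2) imageI[OF r[OF 1]]])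
    next
      case 2
      show ?thesis unfolding Bb[OF 2] by (rule subsetD[OF Hb(2) imageI[OF r[OF 2]]])
    next
      case 3
      show ?thesis unfolding Bc[OF 3] by (rule subsetD[OF Hc(2) imageI[OF r[OF 3]]])
    qed
  qed
  have "B (edge_point 1 0 t, \<tau>) = Ha (t, \<tau>)" "B (edge_point 2 1 t, \<tau>) = Hb (t, \<tau>)"
    "B (edge_point 2 0 t, \<tau>) = Hc (t, \<tau>)" if "t \<in> ?I" "\<tau> \<in> ?I" for t \<tau>
  proof -
    have "(edge_point 1 0 t, \<tau>) \<in> ?E 2" "(edge_point 2 1 t, \<tau>) \<in> ?E 0" "(edge_point 2 0 t, \<tau>) \<in> ?E 1"
      using that edge_point_in_simplex[of 1 2 0 t] edge_point_in_simplex[of 2 2 1 t]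
        edge_point_in_simplex[of 2 2 0 t] by (simp_all add: edge_point_coords del: One_nat_def)
    from Ba[OF this(1)] Bb[OF this(2)] Bc[OF this(3)]
    show "B (edge_point 1 0 t, \<tau>) = Ha (t, \<tau>)" "B (edge_point 2 1 t, \<tau>) = Hb (t, \<tau>)"
      "B (edge_point 2 0 t, \<tau>) = Hc (t, \<tau>)"
      by (simp_all add: edge_point_coords del: One_nat_def)
  qed
  then show thesis
    by (intro that[OF cB]) (use iB in auto)
qed

lemma triangle_homotopy_iff:
  "triangle_homotopy M m N f H \<alpha> \<beta> a F \<longleftrightarrow>
     continuous_on prism F \<and> F ` prism \<subseteq> N \<and> (\<forall>x\<in>standard_simplex 2. F (x, 0) = f (a x)) \<and>
     (\<forall>t\<in>{0..1}. \<forall>\<tau>\<in>{0..1}.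
        F (edge_point 1 0 t, \<tau>) = H \<alpha> (t, \<tau>) \<and>
        F (edge_point 2 1 t, \<tau>) = H \<beta> (t, \<tau>) \<and>
        F (edge_point 2 0 t, \<tau>) = H (\<beta> \<otimes>\<^bsub>pi1 M m\<^esub> \<alpha>) (t, \<tau>))"
  unfolding triangle_homotopy_def prism_def
  by (simp add: euclidean_product_topology image_subset_iff_funcset conj_assoc)

lemma homotopy_end_singular:
  assumes "continuous_on prism F" "F ` prism \<subseteq> N"
  shows "singular_simplex 2 (top_of_set N) (homotopy_end F)"
proof -
  have "continuous_on (standard_simplex 2) (\<lambda>x. F (x, 1))"
    by (rule continuous_on_compose2[OF assms(1) continuous_on_Pair[OF continuous_on_id continuous_on_const]])
       (auto simp: prism_def)
  then show ?thesis
    using assms(2) by (auto simp: singular_simplex_iff homotopy_end_def prism_def)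
qed

lemma tri_htpy_compose_left:
  assumes "tri_htpy M a b" "continuous_on M f" "f ` M \<subseteq> N"
  shows "tri_htpy N (\<lambda>x. f (a x)) (\<lambda>x. f (b x))"
proof -
  have "homotopic_with (\<lambda>h. \<forall>x\<in>triangle_boundary. h x = f (a x)) (top_of_set (standard_simplex 2))
      (top_of_set N) (f \<circ> a) (f \<circ> b)"
    by (rule homotopic_with_compose_continuous_map_left[OF assms(1)[unfolded rel_htpy_def]])
       (use assms(2,3) in \<open>auto simp: image_subset_iff_funcset\<close>)
  then show ?thesis by (simp add: rel_htpy_def comp_def)
qed

lemma singular_compose:
  assumes "singular_simplex k (top_of_set M) a" "continuous_on M f" "f ` M \<subseteq> N"
  shows "singular_simplex k (top_of_set N) (restrict (\<lambda>x. f (a x)) (standard_simplex k))"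
proof -
  have "continuous_on (standard_simplex k) (\<lambda>x. f (a x))"
    by (rule continuous_on_compose2[OF assms(2)]) (use assms(1) in \<open>auto simp: singular_simplex_iff\<close>)
  then show ?thesis using assms by (auto simp: singular_simplex_iff)
qed

lemma subsimplex_compose:
  assumes "length L = Suc k" "set L \<subseteq> {..p}"
  shows "subsimplex (restrict (\<lambda>x. f (\<omega> x)) (standard_simplex p)) L =
    restrict (\<lambda>x. f (subsimplex \<omega> L x)) (standard_simplex k)"
proof
  fix x
  show "subsimplex (restrict (\<lambda>x. f (\<omega> x)) (standard_simplex p)) L x =
    restrict (\<lambda>x. f (subsimplex \<omega> L x)) (standard_simplex k) x"
    using vmap_in_simplex[of x k L p] assms by (simp add: subsimplex_def)
qed

lemma tetra_compose:
  assumes t: "tetra M a b c d" and f: "continuous_on M f" "f ` M \<subseteq> N"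
  shows "tetra N (restrict (\<lambda>x. f (a x)) (standard_simplex 2)) (restrict (\<lambda>x. f (b x)) (standard_simplex 2))
    (restrict (\<lambda>x. f (c x)) (standard_simplex 2)) (restrict (\<lambda>x. f (d x)) (standard_simplex 2))"
proof -
  obtain \<omega> where \<omega>: "singular_simplex 3 (top_of_set M) \<omega>" and
    e: "a = subsimplex \<omega> [1,2,0]" "b = subsimplex \<omega> [0,2,3]" "c = subsimplex \<omega> [1,0,3]"
    "d = subsimplex \<omega> [1,2,3]"
    using t by (auto simp: tetra_iff)
  show ?thesis
    unfolding tetra_iff e
    by (intro exI[of _ "restrict (\<lambda>x. f (\<omega> x)) (standard_simplex 3)"] conjI
          singular_compose[OF \<omega> f] subsimplex_compose) auto
qed

section \<open>The map induced on cells and its compatibility with the operations\<close>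

locale induced_map =
  source: pointed_section M m s\<^sub>M + target: pointed_section N n s\<^sub>N
  for M :: "'a::topological_space set" and m s\<^sub>M and N :: "'b::topological_space set" and n s\<^sub>N +
  fixes f :: "'a \<Rightarrow> 'b" and H :: "(real \<Rightarrow> 'a) set \<Rightarrow> real \<times> real \<Rightarrow> 'b"
  assumes f: "continuous_on M f" "f ` M \<subseteq> N" and fm: "f m = n"
    and H: "loop_homotopies M m N n f s\<^sub>M s\<^sub>N H"
begin

abbreviation \<phi> where "\<phi> \<equiv> pi1_map N f"
abbreviation homotopy_of where "homotopy_of \<equiv> triangle_homotopy M m N f H"

lemma \<phi>_hom: "\<phi> \<in> hom source.G target.G"
  using pi1_map_hom[OF source.base f] by (simp add: fm)

lemma \<phi>_mult: "\<lbrakk>g \<in> carrier source.G; h \<in> carrier source.G\<rbrakk> \<Longrightarrow> \<phi> (g \<otimes>\<^bsub>source.G\<^esub> h) = \<phi> g \<otimes>\<^bsub>target.G\<^esub> \<phi> h"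
  using \<phi>_hom by (rule hom_mult)

lemma H_props:
  assumes "g \<in> carrier source.G"
  shows "continuous_on ({0..1} \<times> {0..1}) (H g)" "H g ` ({0..1} \<times> {0..1}) \<subseteq> N"
    "\<And>t. t \<in> {0..1} \<Longrightarrow> H g (t, 0) = f (s\<^sub>M g t)" "\<And>t. t \<in> {0..1} \<Longrightarrow> H g (t, 1) = s\<^sub>N (\<phi> g) t"
    "\<And>\<tau>. \<tau> \<in> {0..1} \<Longrightarrow> H g (0, \<tau>) = n \<and> H g (1, \<tau>) = n"
    "\<And>t \<tau>. \<lbrakk>t \<in> {0..1}; \<tau> \<in> {0..1}\<rbrakk> \<Longrightarrow> H (inv\<^bsub>source.G\<^esub> g) (t, \<tau>) = H g (1 - t, \<tau>)"
  using H assms unfolding loop_homotopies_def by blast+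

lemma homotopy_ofD:
  assumes "homotopy_of \<alpha> \<beta> a F"
  shows "continuous_on prism F" "F ` prism \<subseteq> N" "\<And>x. x \<in> standard_simplex 2 \<Longrightarrow> F (x, 0) = f (a x)"
  using assms by (simp_all add: triangle_homotopy_iff)

lemma homotopy_of_edge:
  assumes "homotopy_of \<alpha> \<beta> a F" "t \<in> {0..1}" "\<tau> \<in> {0..1}"
  shows "F (edge_point 1 0 t, \<tau>) = H \<alpha> (t, \<tau>)" "F (edge_point 2 1 t, \<tau>) = H \<beta> (t, \<tau>)"
    "F (edge_point 2 0 t, \<tau>) = H (\<beta> \<otimes>\<^bsub>source.G\<^esub> \<alpha>) (t, \<tau>)"
    "F (edge_point 0 1 t, \<tau>) = H \<alpha> (1 - t, \<tau>)" "F (edge_point 1 2 t, \<tau>) = H \<beta> (1 - t, \<tau>)"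
    "F (edge_point 0 2 t, \<tau>) = H (\<beta> \<otimes>\<^bsub>source.G\<^esub> \<alpha>) (1 - t, \<tau>)"
  using assms edge_point_reverse[of 0 1 t] edge_point_reverse[of 1 2 t] edge_point_reverse[of 0 2 t]
  by (auto simp: triangle_homotopy_iff)

text \<open>Bottom and sides fit because each \<open>H\<close> starts at \<open>f\<close> applied to
  the section loop, which is what \<open>f\<close> after \<open>a\<close> is along the
  edges.\<close>

lemma homotopy_of_exists:
  assumes "\<alpha> \<in> carrier source.G" "\<beta> \<in> carrier source.G" and a: "a \<in> source.T \<alpha> \<beta>"
  obtains F where "homotopy_of \<alpha> \<beta> a F"
proof -
  have \<beta>\<alpha>: "\<beta> \<otimes>\<^bsub>source.G\<^esub> \<alpha> \<in> carrier source.G" using assms by simp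
  note H\<alpha> = H_props[OF assms(1)] and H\<beta> = H_props[OF assms(2)] and H\<beta>\<alpha> = H_props[OF \<beta>\<alpha>]
  obtain B where B: "continuous_on (triangle_boundary \<times> {0..1}) B" "B ` (triangle_boundary \<times> {0..1}) \<subseteq> N"
    "\<And>t \<tau>. \<lbrakk>t \<in> {0..1}; \<tau> \<in> {0..1}\<rbrakk> \<Longrightarrow> B (edge_point 1 0 t, \<tau>) = H \<alpha> (t, \<tau>) \<and>
       B (edge_point 2 1 t, \<tau>) = H \<beta> (t, \<tau>) \<and>
       B (edge_point 2 0 t, \<tau>) = H (\<beta> \<otimes>\<^bsub>source.G\<^esub> \<alpha>) (t, \<tau>)"
    by (rule boundary_glue[OF H\<alpha>(1,2) _ H\<beta>(1,2) _ H\<beta>\<alpha>(1,2)])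
       ((rule H\<alpha>(5) H\<beta>(5) H\<beta>\<alpha>(5), assumption)+, (rule that; simp))
  have sa: "continuous_on (standard_simplex 2) a" "a ` standard_simplex 2 \<subseteq> M"
    using source.triangles_singular[OF a] by (auto simp: singular_simplex_iff)
  obtain K where K: "continuous_on ({0..1::real} \<times> prism) K" "K ` ({0..1} \<times> prism) \<subseteq> N"
    "\<And>t x. \<lbrakk>t \<in> {0..1}; x \<in> standard_simplex 2\<rbrakk> \<Longrightarrow> K (t, (x, 0)) = f (a (snd (t, x)))"
    "\<And>t z. \<lbrakk>t \<in> {0..1}; z \<in> triangle_boundary \<times> {0..1}\<rbrakk> \<Longrightarrow> K (t, z) = B z"
  \<comment> \<open>The bottom map does not depend on the parameter, so the slice at 0 will
    serve.\<close>
  proof (rule prism_extension[where N = N and h = "\<lambda>w. f (a (snd w))" and B = B])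
    show "continuous_on ({0..1::real} \<times> standard_simplex 2) (\<lambda>w. f (a (snd w)))"
      by (rule continuous_on_compose2[OF f(1) continuous_on_compose2[OF sa(1) continuous_on_snd[OF continuous_on_id]]])
         (use sa(2) in auto)
    show "(\<lambda>w. f (a (snd w))) ` ({0..1::real} \<times> standard_simplex 2) \<subseteq> N"
      using sa(2) f(2) by (auto simp: image_subset_iff)
    fix t :: real and x assume "x \<in> triangle_boundary"
    then show "f (a (snd (t, x))) = B (x, 0)"
      by (cases rule: triangle_boundary_cases)
         (use B(3)[where \<tau> = 0] source.triangles_edge[OF a] H\<alpha>(3) H\<beta>(3) H\<beta>\<alpha>(3) in \<open>simp_all del: One_nat_def\<close>)
  qed (use B in simp_all)
  show thesis
  proof (rule that[of "\<lambda>z. K (0, z)"], unfold triangle_homotopy_iff, intro conjI ballI)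
    show "continuous_on prism (\<lambda>z. K (0, z))"
      by (rule continuous_on_compose2[OF K(1) continuous_on_Pair[OF continuous_on_const continuous_on_id]]) auto
    show "(\<lambda>z. K (0, z)) ` prism \<subseteq> N" using K(2) by (auto simp: image_subset_iff)
    show "K (0, (x, 0)) = f (a x)" if "x \<in> standard_simplex 2" for x using K(3)[of 0 x] that by simp
    fix t \<tau> :: real assume t: "t \<in> {0..1}" and \<tau>: "\<tau> \<in> {0..1}"
    note e = edge_point_in_boundary[OF _ _ t]
    show "K (0, (edge_point 1 0 t, \<tau>)) = H \<alpha> (t, \<tau>)"
      using K(4)[of 0 "(edge_point 1 0 t, \<tau>)"] B(3)[OF t \<tau>] e[of 1 0] \<tau> by simp
    show "K (0, (edge_point 2 1 t, \<tau>)) = H \<beta> (t, \<tau>)"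
      using K(4)[of 0 "(edge_point 2 1 t, \<tau>)"] B(3)[OF t \<tau>] e[of 2 1] \<tau> by simp
    show "K (0, (edge_point 2 0 t, \<tau>)) = H (\<beta> \<otimes>\<^bsub>source.G\<^esub> \<alpha>) (t, \<tau>)"
      using K(4)[of 0 "(edge_point 2 0 t, \<tau>)"] B(3)[OF t \<tau>] e[of 2 0] \<tau> by simp
  qed
qed

text \<open>The bottom of \<open>F'\<close> need only be homotopic to \<open>f\<close> after
  \<open>a\<close>; this is the form required when \<open>F'\<close> arises from a different
  filling.\<close>

lemma homotopy_end_unique:
  assumes F: "homotopy_of \<alpha> \<beta> a F"
    and F': "continuous_on prism F'" "F' ` prism \<subseteq> N"
      "\<And>t \<tau>. \<lbrakk>t \<in> {0..1}; \<tau> \<in> {0..1}\<rbrakk> \<Longrightarrow> F' (edge_point 1 0 t, \<tau>) = H \<alpha> (t, \<tau>) \<and>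
        F' (edge_point 2 1 t, \<tau>) = H \<beta> (t, \<tau>) \<and>
        F' (edge_point 2 0 t, \<tau>) = H (\<beta> \<otimes>\<^bsub>source.G\<^esub> \<alpha>) (t, \<tau>)"
    and bot: "tri_htpy N (\<lambda>x. f (a x)) (\<lambda>x. F' (x, 0))"
  shows "tri_htpy N (homotopy_end F) (homotopy_end F')"
proof -
  have "tri_htpy N (\<lambda>x. F (x, 1)) (\<lambda>x. F' (x, 1))"
  proof (rule prism_end_unique[OF homotopy_ofD(1,2)[OF F] F'(1,2)])
    show "F z = F' z" if "z \<in> triangle_boundary \<times> {0..1}" for z
    proof -
      obtain x \<tau> where z: "z = (x, \<tau>)" "x \<in> triangle_boundary" "\<tau> \<in> {0..1}" using \<open>z \<in> _\<close> by blast
      show ?thesis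
        unfolding z(1) using z(2)
        by (cases rule: triangle_boundary_cases)
           (use homotopy_of_edge[OF F _ z(3)] F'(3)[OF _ z(3)] in \<open>simp_all del: One_nat_def\<close>)
    qed
    show "tri_htpy N (\<lambda>x. F (x, 0)) (\<lambda>x. F' (x, 0))"
      by (rule rel_htpy_eq[OF bot]) (simp_all add: homotopy_ofD(3)[OF F] triangle_boundary_subset)
  qed
  then show ?thesis
    by (rule rel_htpy_eq) (simp_all add: homotopy_end_def triangle_boundary_subset)
qed

lemma homotopy_end_class:
  assumes F: "homotopy_of \<alpha> \<beta> a F" and F': "homotopy_of \<alpha> \<beta> a' F'" and aa: "tri_htpy M a a'"
  shows "target.cls (homotopy_end F) = target.cls (homotopy_end F')"
proof (rule triangle_class_eqI, rule homotopy_end_unique[OF F homotopy_ofD(1,2)[OF F']])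
  show "tri_htpy N (\<lambda>x. f (a x)) (\<lambda>x. F' (x, 0))"
    by (rule rel_htpy_eq[OF tri_htpy_compose_left[OF aa f]])
       (simp_all add: homotopy_ofD(3)[OF F'] triangle_boundary_subset)
qed (simp add: homotopy_of_edge[OF F'] del: One_nat_def)

lemma homotopy_end_triangles:
  assumes "\<alpha> \<in> carrier source.G" "\<beta> \<in> carrier source.G" and F: "homotopy_of \<alpha> \<beta> a F"
  shows "homotopy_end F \<in> target.T (\<phi> \<alpha>) (\<phi> \<beta>)"
proof (rule target.trianglesI[OF homotopy_end_singular[OF homotopy_ofD(1,2)[OF F]]])
  fix t :: real assume t: "t \<in> {0..1}"
  have \<beta>\<alpha>: "\<beta> \<otimes>\<^bsub>source.G\<^esub> \<alpha> \<in> carrier source.G" using assms by simp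
  have e: "edge_point 1 0 t \<in> standard_simplex 2" "edge_point 2 1 t \<in> standard_simplex 2"
    "edge_point 2 0 t \<in> standard_simplex 2"
    using t by (auto intro: edge_point_in_simplex)
  show "homotopy_end F (edge_point 1 0 t) = s\<^sub>N (\<phi> \<alpha>) t"
    using homotopy_of_edge(1)[OF F t, of 1] H_props(4)[OF assms(1) t] e(1) by (simp add: homotopy_end_def)
  show "homotopy_end F (edge_point 2 1 t) = s\<^sub>N (\<phi> \<beta>) t"
    using homotopy_of_edge(2)[OF F t, of 1] H_props(4)[OF assms(2) t] e(2) by (simp add: homotopy_end_def)
  show "homotopy_end F (edge_point 2 0 t) = s\<^sub>N (\<phi> \<beta> \<otimes>\<^bsub>target.G\<^esub> \<phi> \<alpha>) t"
    using homotopy_of_edge(3)[OF F t, of 1] H_props(4)[OF \<beta>\<alpha> t] e(3)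
    by (simp add: homotopy_end_def \<phi>_mult[OF assms(2,1)])
qed

text \<open>As with \<open>Gamma_m\<close>, the selected homotopy may start from another
  representative; \<open>homotopy_end_class\<close> makes any homotopy as good.\<close>

lemma Gamma_map_class:
  assumes a: "a \<in> source.T \<alpha> \<beta>" and F: "homotopy_of \<alpha> \<beta> a F"
  shows "Gamma_map M m N f H \<alpha> \<beta> (source.cls a) = target.cls (homotopy_end F)"
proof -
  define F' where "F' = (SOME F. \<exists>a'\<in>source.cls a. homotopy_of \<alpha> \<beta> a' F)"
  have "\<exists>F. \<exists>a'\<in>source.cls a. homotopy_of \<alpha> \<beta> a' F"
    using F triangle_class_self[OF source.triangles_singular[OF a]] by blast
  then have "\<exists>a'\<in>source.cls a. homotopy_of \<alpha> \<beta> a' F'"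
    unfolding F'_def by (rule someI_ex)
  then obtain a' where "tri_htpy M a a'" "homotopy_of \<alpha> \<beta> a' F'"
    by (auto simp: triangle_class_iff)
  then show ?thesis
    unfolding Gamma_map_def F'_def[symmetric] using homotopy_end_class[OF F] by metis
qed

lemma map_well_defined: "Gamma_map_well_defined M m N f s\<^sub>M H"
  unfolding Gamma_map_well_defined_def
proof (intro ballI conjI allI impI)
  fix \<alpha> \<beta> A a
  assume g: "\<alpha> \<in> carrier source.G" "\<beta> \<in> carrier source.G" and A: "A \<in> Gamma M m s\<^sub>M \<alpha> \<beta>" "a \<in> A"
  note a = source.Gamma_memD[OF A]
  obtain F where "homotopy_of \<alpha> \<beta> a F" by (rule homotopy_of_exists[OF g a(1)])
  then show "\<exists>F. homotopy_of \<alpha> \<beta> a F" by blast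
  fix F assume "homotopy_of \<alpha> \<beta> a F"
  from Gamma_map_class[OF a(1) this] show "target.cls (homotopy_end F) = Gamma_map M m N f H \<alpha> \<beta> A"
    unfolding a(2) ..
qed

lemma homotopy_end_reparametrize:
  assumes F: "continuous_on prism F" "F ` prism \<subseteq> N" and i: "i \<le> 2" "j \<le> 2" "l \<le> 2"
  defines "F' \<equiv> \<lambda>z. F (vmap [i,j,l] (fst z), snd z)"
  shows "continuous_on prism F'" "F' ` prism \<subseteq> N" "homotopy_end F' = face (homotopy_end F) i j l"
proof -
  have v: "vmap [i,j,l] x \<in> standard_simplex 2" if "x \<in> standard_simplex 2" for x
    by (rule vmap_in_simplex[OF that]) (use i in auto)
  then have r: "(vmap [i,j,l] (fst z), snd z) \<in> prism" if "z \<in> prism" for z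
    using that by (auto simp: prism_def)
  show "continuous_on prism F'"
    unfolding F'_def
    by (rule continuous_on_compose2[OF F(1) continuous_on_Pair[OF
          continuous_on_vmap[OF continuous_on_fst[OF continuous_on_id]] continuous_on_snd[OF continuous_on_id]]])
       (rule image_subsetI, rule r)
  show "F' ` prism \<subseteq> N"
    unfolding F'_def by (rule image_subsetI) (rule subsetD[OF F(2) imageI[OF r]])
  show "homotopy_end F' = face (homotopy_end F) i j l"
    using v by (auto simp: homotopy_end_def face_subsimplex subsimplex_def F'_def numeral_2_eq_2 fun_eq_iff)
qed

text \<open>The symmetry of \<open>H\<close> under inversion gives the relabelled homotopy its
  prescribed edges, two of which are now traversed backwards.\<close>

lemma homotopy_of_P:
  assumes g: "\<alpha> \<in> carrier source.G" "\<beta> \<in> carrier source.G" and F: "homotopy_of \<alpha> \<beta> a F"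
  shows "homotopy_of \<beta> (inv\<^bsub>source.G\<^esub> \<alpha> \<otimes>\<^bsub>source.G\<^esub> inv\<^bsub>source.G\<^esub> \<beta>) (face a 1 2 0)
    (\<lambda>z. F (vmap [1,2,0] (fst z), snd z))"
proof -
  have e: "inv\<^bsub>source.G\<^esub> \<alpha> \<otimes>\<^bsub>source.G\<^esub> inv\<^bsub>source.G\<^esub> \<beta> = inv\<^bsub>source.G\<^esub> (\<beta> \<otimes>\<^bsub>source.G\<^esub> \<alpha>)"
    "inv\<^bsub>source.G\<^esub> (\<beta> \<otimes>\<^bsub>source.G\<^esub> \<alpha>) \<otimes>\<^bsub>source.G\<^esub> \<beta> = inv\<^bsub>source.G\<^esub> \<alpha>"
    using g by (simp_all add: source.inv_mult_group source.m_assoc)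
  have \<beta>\<alpha>: "\<beta> \<otimes>\<^bsub>source.G\<^esub> \<alpha> \<in> carrier source.G" using g by simp
  note r = homotopy_end_reparametrize[OF homotopy_ofD(1,2)[OF F], of 1 2 0]
  have v: "vmap [1,2,0] x \<in> standard_simplex 2" if "x \<in> standard_simplex 2" for x
    by (rule vmap_in_simplex[OF that]) auto
  show ?thesis
    unfolding triangle_homotopy_iff e
    by (intro conjI ballI r(1,2))
       (simp_all add: v homotopy_ofD(3)[OF F] face_subsimplex subsimplex_apply_triangle vmap_edge_point
         homotopy_of_edge[OF F] H_props(6)[OF g(1)] H_props(6)[OF \<beta>\<alpha>] del: One_nat_def)
qed

lemma homotopy_of_Q:
  assumes g: "\<alpha> \<in> carrier source.G" "\<beta> \<in> carrier source.G" and F: "homotopy_of \<alpha> \<beta> a F"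
  shows "homotopy_of (inv\<^bsub>source.G\<^esub> \<alpha>) (\<beta> \<otimes>\<^bsub>source.G\<^esub> \<alpha>) (face a 1 0 2)
    (\<lambda>z. F (vmap [1,0,2] (fst z), snd z))"
proof -
  have e: "(\<beta> \<otimes>\<^bsub>source.G\<^esub> \<alpha>) \<otimes>\<^bsub>source.G\<^esub> inv\<^bsub>source.G\<^esub> \<alpha> = \<beta>"
    using g by (simp add: source.m_assoc)
  note r = homotopy_end_reparametrize[OF homotopy_ofD(1,2)[OF F], of 1 0 2]
  have v: "vmap [1,0,2] x \<in> standard_simplex 2" if "x \<in> standard_simplex 2" for x
    by (rule vmap_in_simplex[OF that]) auto
  show ?thesis
    unfolding triangle_homotopy_iff e
    by (intro conjI ballI r(1,2))
       (simp_all add: v homotopy_ofD(3)[OF F] face_subsimplex subsimplex_apply_triangle vmap_edge_point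
         homotopy_of_edge[OF F] H_props(6)[OF g(1)] del: One_nat_def)
qed

text \<open>The three face homotopies extend over the tetrahedron. The slice at time 0 fills the
  images of \<open>a\<close>, \<open>b\<close>, \<open>c\<close>, so its last face is homotopic to
  the image of \<open>d\<close>; the slice at time 1 fills the three ends; and the track of the last
  face is a prism map comparable with \<open>Fd\<close>.\<close>

lemma homotopy_end_tetra:
  assumes g: "g \<in> carrier source.G" "h \<in> carrier source.G" "k \<in> carrier source.G"
    and t: "tetra M a b c d"
    and Fa: "homotopy_of g (inv\<^bsub>source.G\<^esub> h) a Fa" and Fb: "homotopy_of h (inv\<^bsub>source.G\<^esub> k) b Fb"
    and Fc: "homotopy_of (inv\<^bsub>source.G\<^esub> h \<otimes>\<^bsub>source.G\<^esub> g) (inv\<^bsub>source.G\<^esub> k \<otimes>\<^bsub>source.G\<^esub> h) c Fc"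
    and Fd: "homotopy_of g (inv\<^bsub>source.G\<^esub> k) d Fd"
  obtains d' where "tetra N (homotopy_end Fa) (homotopy_end Fb) (homotopy_end Fc) d'"
    "tri_htpy N (homotopy_end Fd) d'"
proof -
  let ?I = "{0..1::real}" and ?S = "standard_simplex 3" and ?T = "standard_simplex 2"
  have sw: "continuous_on (?I \<times> ?T) (\<lambda>w. F (snd w, fst w))" "(\<lambda>w. F (snd w, fst w)) ` (?I \<times> ?T) \<subseteq> N"
    if "homotopy_of \<alpha> \<beta> x F" for \<alpha> \<beta> x F
  proof -
    show "continuous_on (?I \<times> ?T) (\<lambda>w. F (snd w, fst w))"
      by (rule continuous_on_compose2[OF homotopy_ofD(1)[OF that] continuous_on_Pair[OF
            continuous_on_snd[OF continuous_on_id] continuous_on_fst[OF continuous_on_id]]])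
         (auto simp: prism_def)
    show "(\<lambda>w. F (snd w, fst w)) ` (?I \<times> ?T) \<subseteq> N"
      using homotopy_ofD(2)[OF that] by (auto simp: prism_def image_subset_iff)
  qed
  obtain K where K: "continuous_on (?I \<times> ?S) K" "K ` (?I \<times> ?S) \<subseteq> N"
    "\<forall>\<tau>\<in>?I. \<forall>y\<in>?T. K (\<tau>, vmap [1,2,0] y) = Fa (snd (\<tau>, y), fst (\<tau>, y)) \<and>
       K (\<tau>, vmap [0,2,3] y) = Fb (snd (\<tau>, y), fst (\<tau>, y)) \<and>
       K (\<tau>, vmap [1,0,3] y) = Fc (snd (\<tau>, y), fst (\<tau>, y))"
    by (rule tetra_extend[where T = ?I and N = N and Ka = "\<lambda>w. Fa (snd w, fst w)"
          and Kb = "\<lambda>w. Fb (snd w, fst w)" and Kc = "\<lambda>w. Fc (snd w, fst w)"])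
       (use that in \<open>simp_all add: sw[OF Fa] sw[OF Fb] sw[OF Fc] homotopy_of_edge[OF Fa]
         homotopy_of_edge[OF Fb] homotopy_of_edge[OF Fc] H_props(6) g del: One_nat_def\<close>)
  define \<Omega> where "\<Omega> \<tau> = restrict (\<lambda>x. K (\<tau>, x)) ?S" for \<tau>
  have s\<Omega>: "singular_simplex 3 (top_of_set N) (\<Omega> \<tau>)" if "\<tau> \<in> ?I" for \<tau>
    unfolding \<Omega>_def by (rule restrict_slice_singular[OF K(1,2) that])
  have t\<Omega>: "tetra N (restrict (\<lambda>x. Fa (x, \<tau>)) ?T) (restrict (\<lambda>x. Fb (x, \<tau>)) ?T)
      (restrict (\<lambda>x. Fc (x, \<tau>)) ?T) (subsimplex (\<Omega> \<tau>) [1,2,3])" if "\<tau> \<in> ?I" for \<tau>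
    unfolding tetra_iff
  proof (intro exI[of _ "\<Omega> \<tau>"] conjI s\<Omega>[OF that])
    show "subsimplex (\<Omega> \<tau>) [1,2,0] = restrict (\<lambda>x. Fa (x, \<tau>)) ?T"
      "subsimplex (\<Omega> \<tau>) [0,2,3] = restrict (\<lambda>x. Fb (x, \<tau>)) ?T"
      "subsimplex (\<Omega> \<tau>) [1,0,3] = restrict (\<lambda>x. Fc (x, \<tau>)) ?T"
      unfolding \<Omega>_def using K(3) that
      by (auto intro!: subsimplex_restrict_slice simp: numeral_2_eq_2[symmetric])
  qed simp
  have cut: "restrict (\<lambda>x. F (x, 0)) ?T = restrict (\<lambda>x. f (y x)) ?T" if "homotopy_of \<alpha> \<beta> y F" for \<alpha> \<beta> y F
    using homotopy_ofD(3)[OF that] by (auto intro: restrict_ext)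
  have t0: "tetra N (restrict (\<lambda>x. f (a x)) ?T) (restrict (\<lambda>x. f (b x)) ?T)
      (restrict (\<lambda>x. f (c x)) ?T) (subsimplex (\<Omega> 0) [1,2,3])"
    using t\<Omega>[of 0] by (simp add: cut[OF Fa] cut[OF Fb] cut[OF Fc] del: One_nat_def)
  note tf = tetra_compose[OF t f]
  \<comment> \<open>Two fillings with the same three faces are compared: the image of the given one
    and the slice at time 0.\<close>
  have d0: "tri_htpy N (restrict (\<lambda>x. f (d x)) ?T) (subsimplex (\<Omega> 0) [1,2,3])"
    by (rule tetra_unique[OF tf t0]) (rule tri_htpy_refl tetra_singular[OF tf])+
  let ?F = "\<lambda>z. K (snd z, vmap [1,2,3] (fst z))"
  have v: "vmap [1,2,3] x \<in> ?S" if "x \<in> ?T" for x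
    by (rule vmap_in_simplex[OF that]) auto
  have r: "(snd z, vmap [1,2,3] (fst z)) \<in> ?I \<times> ?S" if "z \<in> prism" for z
    using that v by (auto simp: prism_def)
  have "tri_htpy N (homotopy_end Fd) (homotopy_end ?F)"
  proof (rule homotopy_end_unique[OF Fd])
    show "continuous_on prism ?F"
      by (rule continuous_on_compose2[OF K(1) continuous_on_Pair[OF continuous_on_snd[OF continuous_on_id]
            continuous_on_vmap[OF continuous_on_fst[OF continuous_on_id]]]])
         (rule image_subsetI, rule r)
    show "?F ` prism \<subseteq> N"
      by (rule image_subsetI) (rule subsetD[OF K(2) imageI[OF r]])
    show "tri_htpy N (\<lambda>x. f (d x)) (\<lambda>x. ?F (x, 0))"
      by (rule rel_htpy_eq[OF d0])
         (simp_all add: subsimplex_apply_triangle \<Omega>_def v triangle_boundary_subset del: One_nat_def)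
    \<comment> \<open>Each edge of the last face is shared with one of the other faces, so the sides
      of \<open>?F\<close> are the prescribed loop homotopies.\<close>
    fix t' \<tau> assume t': "t' \<in> ?I" and \<tau>: "\<tau> \<in> ?I"
    have e: "edge_point 1 0 t' \<in> ?T" "edge_point 2 1 t' \<in> ?T" "edge_point 2 0 t' \<in> ?T"
      using t' by (auto intro: edge_point_in_simplex)
    note K' = K(3)[rule_format, OF \<tau>]
    show "?F (edge_point 1 0 t', \<tau>) = H g (t', \<tau>) \<and> ?F (edge_point 2 1 t', \<tau>) = H (inv\<^bsub>source.G\<^esub> k) (t', \<tau>) \<and>
        ?F (edge_point 2 0 t', \<tau>) = H (inv\<^bsub>source.G\<^esub> k \<otimes>\<^bsub>source.G\<^esub> g) (t', \<tau>)"
      using K'[OF e(1)] K'[OF e(2)] K'[OF e(3)] homotopy_of_edge(1)[OF Fa t' \<tau>]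
        homotopy_of_edge(2)[OF Fb t' \<tau>] homotopy_of_edge(3)[OF Fc t' \<tau>] source.mult_cancel_mid[OF g]
      by (simp add: vmap_edge_point del: One_nat_def)
  qed
  moreover have "homotopy_end ?F = subsimplex (\<Omega> 1) [1,2,3]"
  proof
    fix x
    show "homotopy_end ?F x = subsimplex (\<Omega> 1) [1,2,3] x"
      using v[of x] by (simp add: homotopy_end_def subsimplex_def \<Omega>_def numeral_2_eq_2)
  qed
  moreover have "tetra N (homotopy_end Fa) (homotopy_end Fb) (homotopy_end Fc) (subsimplex (\<Omega> 1) [1,2,3])"
    using t\<Omega>[of 1] by (simp add: homotopy_end_def)
  ultimately show thesis using that by simp
qed

lemma delta_morphism_Gamma_map:
  "delta_morphism source.G (Gamma_ops M m s\<^sub>M) target.G (Gamma_ops N n s\<^sub>N) \<phi> (Gamma_map M m N f H)"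
proof (intro delta_morphism.intro delta_morphism_axioms.intro source.delta_group_Gamma
    target.delta_group_Gamma \<phi>_hom, unfold Gamma_ops_def delta_ops.simps)
  fix g h k A B C
  assume g: "g \<in> carrier source.G" "h \<in> carrier source.G" "k \<in> carrier source.G"
    and A: "A \<in> Gamma M m s\<^sub>M g (inv\<^bsub>source.G\<^esub> h)" and B: "B \<in> Gamma M m s\<^sub>M h (inv\<^bsub>source.G\<^esub> k)"
    and C: "C \<in> Gamma M m s\<^sub>M (inv\<^bsub>source.G\<^esub> h \<otimes>\<^bsub>source.G\<^esub> g) (inv\<^bsub>source.G\<^esub> k \<otimes>\<^bsub>source.G\<^esub> h)"
  obtain a where a: "a \<in> source.T g (inv\<^bsub>source.G\<^esub> h)" "A = source.cls a" using A by (rule source.GammaE)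
  obtain b where b: "b \<in> source.T h (inv\<^bsub>source.G\<^esub> k)" "B = source.cls b" using B by (rule source.GammaE)
  obtain c where c: "c \<in> source.T (inv\<^bsub>source.G\<^esub> h \<otimes>\<^bsub>source.G\<^esub> g) (inv\<^bsub>source.G\<^esub> k \<otimes>\<^bsub>source.G\<^esub> h)" "C = source.cls c"
    using C by (rule source.GammaE)
  obtain d where d: "tetra M a b c d"
    using source.tetra_exists_triangles[OF g a(1) b(1) c(1)] by blast
  have dT: "d \<in> source.T g (inv\<^bsub>source.G\<^esub> k)"
    by (rule source.tetra_triangles[OF g a(1) b(1) c(1) d])
  have gs: "inv\<^bsub>source.G\<^esub> h \<in> carrier source.G" "inv\<^bsub>source.G\<^esub> k \<in> carrier source.G"
    "inv\<^bsub>source.G\<^esub> h \<otimes>\<^bsub>source.G\<^esub> g \<in> carrier source.G" "inv\<^bsub>source.G\<^esub> k \<otimes>\<^bsub>source.G\<^esub> h \<in> carrier source.G"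
    using g by simp_all
  obtain Fa where Fa: "homotopy_of g (inv\<^bsub>source.G\<^esub> h) a Fa" by (rule homotopy_of_exists[OF g(1) gs(1) a(1)])
  obtain Fb where Fb: "homotopy_of h (inv\<^bsub>source.G\<^esub> k) b Fb" by (rule homotopy_of_exists[OF g(2) gs(2) b(1)])
  obtain Fc where Fc: "homotopy_of (inv\<^bsub>source.G\<^esub> h \<otimes>\<^bsub>source.G\<^esub> g) (inv\<^bsub>source.G\<^esub> k \<otimes>\<^bsub>source.G\<^esub> h) c Fc"
    by (rule homotopy_of_exists[OF gs(3,4) c(1)])
  obtain Fd where Fd: "homotopy_of g (inv\<^bsub>source.G\<^esub> k) d Fd" by (rule homotopy_of_exists[OF g(1) gs(2) dT])
  obtain d' where d': "tetra N (homotopy_end Fa) (homotopy_end Fb) (homotopy_end Fc) d'"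
    "tri_htpy N (homotopy_end Fd) d'"
    by (rule homotopy_end_tetra[OF g d Fa Fb Fc Fd])
  show "Gamma_map M m N f H g (inv\<^bsub>source.G\<^esub> k) (Gamma_m M A B C) =
      Gamma_m N (Gamma_map M m N f H g (inv\<^bsub>source.G\<^esub> h) A) (Gamma_map M m N f H h (inv\<^bsub>source.G\<^esub> k) B)
        (Gamma_map M m N f H (inv\<^bsub>source.G\<^esub> h \<otimes>\<^bsub>source.G\<^esub> g) (inv\<^bsub>source.G\<^esub> k \<otimes>\<^bsub>source.G\<^esub> h) C)"
    unfolding a(2) b(2) c(2) Gamma_m_class[OF d] Gamma_map_class[OF a(1) Fa] Gamma_map_class[OF b(1) Fb]
      Gamma_map_class[OF c(1) Fc] Gamma_map_class[OF dT Fd] Gamma_m_class[OF d'(1)]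
    by (rule triangle_class_eqI[OF d'(2)])
next
  fix g h A
  assume g: "g \<in> carrier source.G" "h \<in> carrier source.G" and A: "A \<in> Gamma M m s\<^sub>M g h"
  obtain a where a: "a \<in> source.T g h" "A = source.cls a" using A by (rule source.GammaE)
  obtain F where F: "homotopy_of g h a F" by (rule homotopy_of_exists[OF g a(1)])
  have e: "homotopy_end F \<in> target.T (\<phi> g) (\<phi> h)" by (rule homotopy_end_triangles[OF g F])
  show "Gamma_map M m N f H g h A \<in> Gamma N n s\<^sub>N (\<phi> g) (\<phi> h)"
    unfolding a(2) Gamma_map_class[OF a(1) F] by (rule target.GammaI[OF e])
  have endF: "homotopy_end (\<lambda>z. F (vmap [i,j,l] (fst z), snd z)) = face (homotopy_end F) i j l"
    if "i \<le> 2" "j \<le> 2" "l \<le> 2" for i j l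
    by (rule homotopy_end_reparametrize(3)[OF homotopy_ofD(1,2)[OF F] that])
  show "Gamma_map M m N f H h (inv\<^bsub>source.G\<^esub> g \<otimes>\<^bsub>source.G\<^esub> inv\<^bsub>source.G\<^esub> h) (Gamma_P A) =
      Gamma_P (Gamma_map M m N f H g h A)"
    unfolding a(2) Gamma_map_class[OF a(1) F] Gamma_P_class[OF source.triangles_singular[OF a(1)]]
      Gamma_P_class[OF target.triangles_singular[OF e]]
      Gamma_map_class[OF source.triangles_P[OF g a(1)] homotopy_of_P[OF g F]]
    by (subst endF) simp_all
  show "Gamma_map M m N f H (inv\<^bsub>source.G\<^esub> g) (h \<otimes>\<^bsub>source.G\<^esub> g) (Gamma_Q A) =
      Gamma_Q (Gamma_map M m N f H g h A)"
    unfolding a(2) Gamma_map_class[OF a(1) F] Gamma_Q_class[OF source.triangles_singular[OF a(1)]]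
      Gamma_Q_class[OF target.triangles_singular[OF e]]
      Gamma_map_class[OF source.triangles_Q[OF g a(1)] homotopy_of_Q[OF g F]]
    by (subst endF) simp_all
qed

end

section \<open>Choosing loop homotopies symmetric under inversion, and the conclusion\<close>

lemma (in pointed_section) section_rep:
  assumes "g \<in> carrier G"
  shows "s g \<in> loops M m" "g = loop_class M (s g)"
proof -
  obtain p where p: "p \<in> loops M m" "g = loop_class M p" using assms by (rule pi1_carrierE)
  have sg: "s g \<in> loop_class M p" using sect assms p(2) by (simp add: loop_section_def)
  show "s g \<in> loops M m" by (rule in_loop_class_loops[OF p(1) sg])
  show "g = loop_class M (s g)"
    unfolding p(2) by (rule loop_class_eqI) (use sg p(2) in \<open>simp add: loop_class_def\<close>)
qed

text \<open>Homotopies chosen independently need not respect inversion. Choosing on one member of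
  each inverse pair and reversing on the other enforces it; the identity takes the constant
  homotopy, as both its ends are constant.\<close>

lemma loop_homotopies_exist:
  assumes M: "pointed_section M m s\<^sub>M" and N: "pointed_section N n s\<^sub>N"
    and o: "\<forall>g\<in>carrier (pi1 M m). group.ord (pi1 M m) g \<noteq> 2"
    and f: "continuous_on M f" "f ` M \<subseteq> N" and fm: "f m = n"
  shows "\<exists>H. loop_homotopies M m N n f s\<^sub>M s\<^sub>N H"
proof -
  interpret source: pointed_section M m s\<^sub>M by (rule M)
  interpret target: pointed_section N n s\<^sub>N by (rule N)
  let ?G = "pi1 M m" and ?\<phi> = "pi1_map N f"
  have hom: "?\<phi> \<in> hom ?G (pi1 N n)" using pi1_map_hom[OF source.base f] by (simp add: fm)
  interpret gh: group_hom ?G "pi1 N n" ?\<phi>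
    using hom source.group_axioms target.group_axioms
    by (simp add: group_hom_def group_hom_axioms_def)
  have "\<exists>h. continuous_on ({0..1} \<times> {0..1}) h \<and> h ` ({0..1} \<times> {0..1}) \<subseteq> N \<and>
      (\<forall>t\<in>{0..1}. h (0, t) = f (s\<^sub>M g t) \<and> h (1, t) = s\<^sub>N (?\<phi> g) t) \<and>
      (\<forall>\<tau>\<in>{0..1::real}. h (\<tau>, 0::real) = n \<and> h (\<tau>, 1) = n)" if g: "g \<in> carrier ?G" for g
  proof -
    note sg = source.section_rep[OF g]
    have "?\<phi> g = loop_class N (f \<circ> s\<^sub>M g)"
      using pi1_map_loop_class[OF sg(1) f] sg(2) by simp
    moreover have "s\<^sub>N (?\<phi> g) \<in> ?\<phi> g"
      using target.sect gh.hom_closed[OF g] by (simp add: loop_section_def)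
    ultimately have "homotopic_paths N (f \<circ> s\<^sub>M g) (s\<^sub>N (?\<phi> g))"
      by (simp add: loop_class_def)
    moreover have "pathstart (f \<circ> s\<^sub>M g) = n" "pathfinish (f \<circ> s\<^sub>M g) = n"
      using loops_compose[OF sg(1) f] by (simp_all add: loops_def fm)
    ultimately obtain h where h: "continuous_on ({0..1} \<times> {0..1}) h" "h \<in> {0..1} \<times> {0..1} \<rightarrow> N"
      "\<forall>x\<in>{0..1}. h (0, x) = (f \<circ> s\<^sub>M g) x" "\<forall>x\<in>{0..1}. h (1, x) = s\<^sub>N (?\<phi> g) x"
      "\<forall>t\<in>{0..1::real}. pathstart (h \<circ> Pair t) = n \<and> pathfinish (h \<circ> Pair t) = n"
      unfolding homotopic_paths by metis
    show ?thesis
      by (intro exI[of _ h] conjI) (use h in \<open>simp_all add: image_subset_iff_funcset pathstart_def pathfinish_def\<close>)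
  qed
  then have "\<exists>k. \<forall>g\<in>carrier ?G. continuous_on ({0..1} \<times> {0..1}) (k g) \<and> k g ` ({0..1} \<times> {0..1}) \<subseteq> N \<and>
      (\<forall>t\<in>{0..1}. k g (0, t) = f (s\<^sub>M g t) \<and> k g (1, t) = s\<^sub>N (?\<phi> g) t) \<and>
      (\<forall>\<tau>\<in>{0..1::real}. k g (\<tau>, 0::real) = n \<and> k g (\<tau>, 1) = n)"
    by (intro bchoice ballI)
  then obtain k where kk: "\<forall>g\<in>carrier ?G. continuous_on ({0..1} \<times> {0..1}) (k g) \<and>
      k g ` ({0..1} \<times> {0..1}) \<subseteq> N \<and>
      (\<forall>t\<in>{0..1}. k g (0, t) = f (s\<^sub>M g t) \<and> k g (1, t) = s\<^sub>N (?\<phi> g) t) \<and>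
      (\<forall>\<tau>\<in>{0..1::real}. k g (\<tau>, 0::real) = n \<and> k g (\<tau>, 1) = n)"
    by (rule exE)
  have k: "continuous_on ({0..1} \<times> {0..1}) (k g)" "k g ` ({0..1} \<times> {0..1}) \<subseteq> N"
    "\<And>t. t \<in> {0..1} \<Longrightarrow> k g (0, t) = f (s\<^sub>M g t)"
    "\<And>t. t \<in> {0..1} \<Longrightarrow> k g (1, t) = s\<^sub>N (?\<phi> g) t"
    "\<And>\<tau>. \<tau> \<in> {0..1} \<Longrightarrow> k g (\<tau>, 0) = n \<and> k g (\<tau>, 1) = n" if "g \<in> carrier ?G" for g
    using bspec[OF kk that] by simp_all
  obtain S where S: "\<And>x. \<lbrakk>x \<in> carrier ?G; x \<noteq> \<one>\<^bsub>?G\<^esub>\<rbrakk> \<Longrightarrow> x \<in> S \<longleftrightarrow> inv\<^bsub>?G\<^esub> x \<notin> S"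
    using source.inverse_pair_choice[OF o] by blast
  \<comment> \<open>In \<open>k\<close> the homotopy time comes first, in \<open>H\<close> last,
    hence the swap.\<close>
  define H where "H g = (\<lambda>z. if g = \<one>\<^bsub>?G\<^esub> then n else if g \<in> S then k g (snd z, fst z)
    else k (inv\<^bsub>?G\<^esub> g) (snd z, 1 - fst z))" for g
  have one: "s\<^sub>M \<one>\<^bsub>?G\<^esub> t = m" "s\<^sub>N (?\<phi> \<one>\<^bsub>?G\<^esub>) t = n" if "t \<in> {0..1}" for t
    using source.sect target.sect that by (simp_all add: loop_section_def)
  have nN: "n \<in> N" by (rule target.base)
  have "loop_homotopies M m N n f s\<^sub>M s\<^sub>N H"
    unfolding loop_homotopies_def
  proof (intro conjI ballI)
    fix g assume g: "g \<in> carrier ?G"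
    then have g': "inv\<^bsub>?G\<^esub> g \<in> carrier ?G" by simp
    consider "g = \<one>\<^bsub>?G\<^esub>" | "g \<noteq> \<one>\<^bsub>?G\<^esub>" "g \<in> S" | "g \<noteq> \<one>\<^bsub>?G\<^esub>" "g \<notin> S" by blast
    note cs = this
    have sw: "continuous_on ({0..1} \<times> {0..1}) (\<lambda>z. k g (snd z, fst z))"
      by (rule continuous_on_compose2[OF k(1)[OF g]]) (auto intro!: continuous_intros)
    have sw': "continuous_on ({0..1} \<times> {0..1}) (\<lambda>z. k (inv\<^bsub>?G\<^esub> g) (snd z, 1 - fst z))"
      by (rule continuous_on_compose2[OF k(1)[OF g']]) (auto intro!: continuous_intros)
    show "continuous_on ({0..1} \<times> {0..1}) (H g)"
      using cs by cases (simp_all add: H_def sw sw')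
    show "H g ` ({0..1} \<times> {0..1}) \<subseteq> N"
      using cs by cases (use k(2)[OF g] k(2)[OF g'] nN in \<open>auto simp: H_def image_subset_iff\<close>)
    show "H (inv\<^bsub>?G\<^esub> g) (t, \<tau>) = H g (1 - t, \<tau>)" for t \<tau>
      using cs S[OF g] g by cases (simp_all add: H_def source.inv_eq_1_iff)
    fix t :: real assume t: "t \<in> {0..1}"
    then have t': "1 - t \<in> {0..1}" by simp
    show "H g (t, 0) = f (s\<^sub>M g t)"
      using cs
    proof cases
      case 3
      then show ?thesis using k(3)[OF g' t'] source.s_inv[OF g t'] by (simp add: H_def)
    qed (use k(3)[OF g t] one[OF t] fm in \<open>simp_all add: H_def\<close>)
    show "H g (t, 1) = s\<^sub>N (?\<phi> g) t"
      using cs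
    proof cases
      case 3
      \<comment> \<open>The end is correct because \<open>pi1_map\<close> respects inverses and
        \<open>s\<^sub>N\<close> reverses them.\<close>
      then show ?thesis
        using k(4)[OF g' t'] target.s_inv[OF gh.hom_closed[OF g] t'] gh.hom_inv[OF g] by (simp add: H_def)
    qed (use k(4)[OF g t] one[OF t] in \<open>simp_all add: H_def\<close>)
    show "H g (0, t) = n" "H g (1, t) = n"
      using cs by (cases; use k(5)[OF g t] k(5)[OF g' t] in \<open>simp add: H_def\<close>)+
  next
    show "H \<one>\<^bsub>?G\<^esub> (t, \<tau>) = n" for t \<tau> by (simp add: H_def)
  qed
  then show ?thesis by blast
qed

text \<open>Existence of sections and loop homotopies is included so that the claims quantified over
  them are not vacuous.\<close>

theorem theorem3p5:
  fixes M :: "'a::topological_space set" and m\<^sub>0 :: 'a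
  assumes "manifold M" and "m\<^sub>0 \<in> M"
    and "\<forall>g\<in>carrier (pi1 M m\<^sub>0). group.ord (pi1 M m\<^sub>0) g \<noteq> 2"
  shows
    "(\<exists>s. loop_section M m\<^sub>0 s) \<and>
     (\<forall>s. loop_section M m\<^sub>0 s \<longrightarrow>
        Gamma_m_well_defined M m\<^sub>0 s \<and> delta_group (pi1 M m\<^sub>0) (Gamma_ops M m\<^sub>0 s)) \<and>
     (\<forall>(N :: 'b::topological_space set) n\<^sub>0 f s\<^sub>M s\<^sub>N.
        manifold N \<and> n\<^sub>0 \<in> N \<and> (\<forall>g\<in>carrier (pi1 N n\<^sub>0). group.ord (pi1 N n\<^sub>0) g \<noteq> 2) \<and>
        continuous_on M f \<and> f ` M \<subseteq> N \<and> f m\<^sub>0 = n\<^sub>0 \<and>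
        loop_section M m\<^sub>0 s\<^sub>M \<and> loop_section N n\<^sub>0 s\<^sub>N \<longrightarrow>
        (\<exists>H. loop_homotopies M m\<^sub>0 N n\<^sub>0 f s\<^sub>M s\<^sub>N H) \<and>
        (\<forall>H. loop_homotopies M m\<^sub>0 N n\<^sub>0 f s\<^sub>M s\<^sub>N H \<longrightarrow>
           Gamma_map_well_defined M m\<^sub>0 N f s\<^sub>M H \<and>
           delta_morphism (pi1 M m\<^sub>0) (Gamma_ops M m\<^sub>0 s\<^sub>M) (pi1 N n\<^sub>0) (Gamma_ops N n\<^sub>0 s\<^sub>N)
             (pi1_map N f) (Gamma_map M m\<^sub>0 N f H)))"
proof (intro conjI allI impI)
  show "\<exists>s. loop_section M m\<^sub>0 s" by (rule loop_section_exists[OF assms(2,3)])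
next
  fix s assume "loop_section M m\<^sub>0 s"
  then interpret pointed_section M m\<^sub>0 s using assms(2) by unfold_locales
  show "Gamma_m_well_defined M m\<^sub>0 s" by (rule m_well_defined)
  show "delta_group (pi1 M m\<^sub>0) (Gamma_ops M m\<^sub>0 s)" by (rule delta_group_Gamma)
next
  fix N :: "'b set" and n\<^sub>0 f s\<^sub>M s\<^sub>N
  assume *: "manifold N \<and> n\<^sub>0 \<in> N \<and> (\<forall>g\<in>carrier (pi1 N n\<^sub>0). group.ord (pi1 N n\<^sub>0) g \<noteq> 2) \<and>
        continuous_on M f \<and> f ` M \<subseteq> N \<and> f m\<^sub>0 = n\<^sub>0 \<and>
        loop_section M m\<^sub>0 s\<^sub>M \<and> loop_section N n\<^sub>0 s\<^sub>N"
  have M: "pointed_section M m\<^sub>0 s\<^sub>M" and N: "pointed_section N n\<^sub>0 s\<^sub>N"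
    using * assms(2) by (simp_all add: pointed_section_def)
  show "\<exists>H. loop_homotopies M m\<^sub>0 N n\<^sub>0 f s\<^sub>M s\<^sub>N H"
    by (rule loop_homotopies_exist[OF M N assms(3)]) (use * in simp_all)
  fix H assume H: "loop_homotopies M m\<^sub>0 N n\<^sub>0 f s\<^sub>M s\<^sub>N H"
  interpret induced_map M m\<^sub>0 s\<^sub>M N n\<^sub>0 s\<^sub>N f H
    using M N * H by (simp add: induced_map_def induced_map_axioms_def)
  show "Gamma_map_well_defined M m\<^sub>0 N f s\<^sub>M H" by (rule map_well_defined)
  show "delta_morphism (pi1 M m\<^sub>0) (Gamma_ops M m\<^sub>0 s\<^sub>M) (pi1 N n\<^sub>0) (Gamma_ops N n\<^sub>0 s\<^sub>N)
             (pi1_map N f) (Gamma_map M m\<^sub>0 N f H)"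
    by (rule delta_morphism_Gamma_map)
qed

end
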